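(* Let $F\subset\operatorname{Aut}(\mathbb A^2)$ be the subgroup generated by $\mathbf u:=(x+y^2,y)$ and $\mathbf v:=(x,y+x^2)$, and denote by $\mathfrak F:=\overline F$ its closure in $\operatorname{Aut}(\mathbb A^2)$. Furthermore, define $\mathfrak A:=\{\mathbf g\in\operatorname{Aut}(\mathbb A^2)\mid\mathbf g(0)=0,\ (d\mathbf g)_0=\mathrm{id}\}$. (1) $F$ is a free group in the two generators $\mathbf u,\mathbf v$, containing elements which are not locally finite. (2) $\mathfrak F=\mathfrak A^S=\operatorname{Cent}_{\mathfrak A}(S)$, where $S:=\{(\zeta x,\zeta^2y)\mid\zeta\in\Bbbk,\ \zeta^3=1\}$ is the centralizer of $F$ in $\operatorname{Aut}(\mathbb A^2)$. (3) $\mathfrak F$ is a free product $\mathfrak J*\mathfrak J^-$ where $\mathfrak J:=\{(x+y^2f(y^3),y)\mid f\in\Bbbk[y]\}$ and $\mathfrak J^-:=\{(x,y+x^2f(x^3))\mid f\in\Bbbk[x]\}=\tau\mathfrak J\tau$, with $\tau:=(y,x)$. In particular, $\mathfrak J$ is a commutative nested unipotent closed ind-subgroup of $\operatorname{Aut}(\mathbb A^2)$ isomorphic to $\Bbbk[y]^+$. (4) Every algebraic subgroup of $\mathfrak F$ is commutative and unipotent and is conjugate to a subgroup of $\mathfrak J$ or of $\mathfrak J^-$.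
   Context: $\Bbbk$ is an algebraically closed field of characteristic zero. An automorphism of $\mathbb A^2$ is written as a pair $(f,h)$ of polynomials in $\Bbbk[x,y]$; its degree is $\max\{\deg f,\deg h\}$. $\operatorname{Aut}(\mathbb A^2)$ is an ind-group, filtered by the affine varieties $\operatorname{Aut}(\mathbb A^2)_d$ of automorphisms $\mathbf g$ with $\deg\mathbf g\le d$ and $\deg\mathbf g^{-1}\le d$; a subset is closed if its intersection with each $\operatorname{Aut}(\mathbb A^2)_d$ is closed. An algebraic subgroup is a subgroup which is bounded (contained in some $\operatorname{Aut}(\mathbb A^2)_d$) and locally closed; it is then a closed linear algebraic group. A subgroup is nested unipotent if it is the union of an ascending sequence of unipotent algebraic subgroups. $\Bbbk[y]^+$ is the additive group of $\Bbbk[y]$, with the ind-group structure given by the finite dimensional subspaces of polynomials of bounded degree. An automorphism $\mathbf g$ is locally finite if $\mathbf g^*$ acts on $\Bbbk[x,y]$ so that every element lies in a finite dimensional $\mathbf g^*$-invariant subspace. $\mathfrak A^S$ is the group of $\mathbf g\in\mathfrak A$ with $\mathbf g\circ s=s\circ\mathbf g$ for all $s\in S$. *)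

theory Defs
  imports
    "HOL-Computational_Algebra.Polynomial"
    "HOL-Algebra.Generated_Groups"
    "HOL-Analysis.Abstract_Topology"
begin

section \<open>Polynomials in two variables\<close>

text \<open>
  The type \<^typ>\<open>'k poly poly\<close> is read as \<open>k[x][y]\<close>: the inner variable is \<open>x\<close>, the outer
  variable is \<open>y\<close>, so that \<open>coeff (coeff p j) i\<close> is the coefficient of \<open>x^i y^j\<close>.
\<close>

definition varX :: "'k::comm_ring_1 poly poly" where
  "varX = [:[:0, 1:]:]"

definition varY :: "'k::comm_ring_1 poly poly" where
  "varY = [:0, 1:]"

definition total_degree :: "'k::comm_ring_1 poly poly \<Rightarrow> nat" where
  "total_degree p = Max (insert 0 {i + j | i j. coeff (coeff p j) i \<noteq> 0})"

definition eval2 :: "'k::comm_ring_1 poly poly \<Rightarrow> 'k \<times> 'k \<Rightarrow> 'k" where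
  "eval2 p z = poly (poly p [:snd z:]) (fst z)"

definition partial_x :: "'k::field poly poly \<Rightarrow> 'k poly poly" where
  "partial_x p = map_poly pderiv p"

definition partial_y :: "'k::field poly poly \<Rightarrow> 'k poly poly" where
  "partial_y p = pderiv p"

definition subst1 :: "'k::comm_ring_1 poly \<Rightarrow> 'k poly poly \<Rightarrow> 'k poly poly" where
  "subst1 f P = poly (map_poly (\<lambda>c. [:[:c:]:]) f) P"

text \<open>\<open>subst2 p (f, h)\<close> is \<open>p(f, h)\<close>, that is, the comorphism of \<open>(f, h)\<close> applied to \<open>p\<close>.\<close>

definition subst2 :: "'k::comm_ring_1 poly poly \<Rightarrow> 'k poly poly \<times> 'k poly poly \<Rightarrow> 'k poly poly" where
  "subst2 p g = poly (map_poly (\<lambda>q. subst1 q (fst g)) p) (snd g)"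

definition scale2 :: "'k::comm_ring_1 \<Rightarrow> 'k poly poly \<Rightarrow> 'k poly poly" where
  "scale2 c p = smult [:c:] p"

lemma vector_space_scale2: "vector_space (scale2 :: 'k::field \<Rightarrow> _)"
proof
  fix a b :: 'k and p q :: "'k poly poly"
  show "scale2 a (p + q) = scale2 a p + scale2 a q"
    by (simp add: scale2_def smult_add_right)
  have "[:a + b:] = [:a:] + [:b:]" by simp
  then show "scale2 (a + b) p = scale2 a p + scale2 b p"
    by (simp add: scale2_def flip: smult_add_left)
  show "scale2 a (scale2 b p) = scale2 (a * b) p"
    by (simp add: scale2_def mult.commute)
  show "scale2 1 p = p"
    by (simp add: scale2_def flip: one_pCons)
qed


section \<open>The automorphism group of the affine plane\<close>

type_synonym 'k endo = "'k poly poly \<times> 'k poly poly"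

definition endo_comp :: "'k::comm_ring_1 endo \<Rightarrow> 'k endo \<Rightarrow> 'k endo" where
  "endo_comp g h = (subst2 (fst g) h, subst2 (snd g) h)"

definition End_A2 :: "'k::comm_ring_1 endo monoid" where
  "End_A2 = \<lparr>carrier = UNIV, mult = endo_comp, one = (varX, varY)\<rparr>"

definition Aut_A2 :: "'k::comm_ring_1 endo monoid" where
  "Aut_A2 = units_of End_A2"

definition endo_degree :: "'k::comm_ring_1 endo \<Rightarrow> nat" where
  "endo_degree g = max (total_degree (fst g)) (total_degree (snd g))"

definition endo_point :: "'k::comm_ring_1 endo \<Rightarrow> 'k \<times> 'k \<Rightarrow> 'k \<times> 'k" where
  "endo_point g z = (eval2 (fst g) z, eval2 (snd g) z)"

definition differential_at :: "'k::field endo \<Rightarrow> 'k \<times> 'k \<Rightarrow> 'k \<times> 'k \<Rightarrow> 'k \<times> 'k" where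
  "differential_at g z = (\<lambda>(a, b).
     (eval2 (partial_x (fst g)) z * a + eval2 (partial_y (fst g)) z * b,
      eval2 (partial_x (snd g)) z * a + eval2 (partial_y (snd g)) z * b))"

definition locally_finite :: "'k::field endo \<Rightarrow> bool" where
  "locally_finite g \<longleftrightarrow>
     (\<forall>p. \<exists>B. finite B \<and> p \<in> module.span scale2 B \<and>
          (\<lambda>q. subst2 q g) ` module.span scale2 B \<subseteq> module.span scale2 B)"

lemma subst1_pCons: "subst1 (pCons a f) P = [:[:a:]:] + P * subst1 f P"
  by (simp add: subst1_def map_poly_pCons)

lemma subst1_0 [simp]: "subst1 0 P = 0"
  by (simp add: subst1_def)

lemma subst1_const: "subst1 [:c:] P = [:[:c:]:]"
  by (simp add: subst1_pCons)

lemma subst1_1: "subst1 1 P = 1"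
  by (simp add: one_pCons subst1_const)

lemma subst1_add: "subst1 (f + g) P = subst1 f P + subst1 g P"
proof (induction f arbitrary: g)
  case 0
  then show ?case by simp
next
  case (pCons a f)
  note IH = pCons.IH
  show ?case
  proof (cases g)
    case (pCons b h)
    have "[:[:a + b:]:] = [:[:a:]:] + [:[:b:]:]" by simp
    then show ?thesis
      unfolding pCons by (simp only: subst1_pCons add_pCons IH algebra_simps)
  qed
qed

lemma subst1_smult: "subst1 (smult c f) P = [:[:c:]:] * subst1 f P"
  by (induction f) (simp_all add: subst1_pCons algebra_simps)

lemma subst1_mult: "subst1 (f * g) P = subst1 f P * subst1 g P"
  by (induction f) (simp_all add: subst1_pCons subst1_add subst1_smult algebra_simps)

lemma subst2_pCons: "subst2 (pCons q p) g = subst1 q (fst g) + snd g * subst2 p g"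
  by (simp add: subst2_def map_poly_pCons)

lemma subst2_0 [simp]: "subst2 0 g = 0"
  by (simp add: subst2_def)

lemma subst2_const: "subst2 [:q:] g = subst1 q (fst g)"
  by (simp add: subst2_pCons)

lemma subst2_1: "subst2 1 g = 1"
  by (simp add: one_pCons subst2_const subst1_const)

lemma subst2_add: "subst2 (p + q) g = subst2 p g + subst2 q g"
proof (induction p arbitrary: q)
  case 0
  then show ?case by simp
next
  case (pCons a f)
  then show ?case
    by (cases q rule: pCons_cases) (simp add: subst2_pCons subst1_add algebra_simps)
qed

lemma subst2_smult: "subst2 (smult c p) g = subst1 c (fst g) * subst2 p g"
  by (induction p) (simp_all add: subst2_pCons subst1_mult algebra_simps)

lemma subst2_mult: "subst2 (p * q) g = subst2 p g * subst2 q g"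
  by (induction p) (simp_all add: subst2_pCons subst2_add subst2_smult algebra_simps)

lemma subst2_subst1: "subst2 (subst1 f P) g = subst1 f (subst2 P g)"
  by (induction f) (simp_all add: subst1_pCons subst2_add subst2_mult subst2_const subst1_const)

lemma subst2_subst2: "subst2 (subst2 p g) h = subst2 p (endo_comp g h)"
  by (induction p) (simp_all add: subst2_pCons subst2_add subst2_mult subst2_subst1 endo_comp_def)

lemma subst1_varX: "subst1 f varX = [:f:]"
  by (induction f) (simp_all add: subst1_pCons varX_def)

lemma subst2_id: "subst2 p (varX, varY) = p"
  by (induction p) (simp_all add: subst2_pCons subst1_varX varY_def)

lemma subst2_varX: "subst2 varX g = fst g"
  by (simp add: varX_def subst2_const subst1_pCons subst1_1 flip: one_pCons)

lemma subst2_varY: "subst2 varY g = snd g"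
  by (simp add: varY_def subst2_pCons subst2_1 flip: one_pCons)

lemma monoid_End_A2: "monoid End_A2"
  by unfold_locales
    (simp_all add: End_A2_def subst2_subst2 subst2_varX subst2_varY subst2_id endo_comp_def)

lemma group_Aut_A2: "group Aut_A2"
  unfolding Aut_A2_def by (rule monoid.units_group[OF monoid_End_A2])


section \<open>Ind-varieties\<close>

text \<open>
  An ind-variety is given by its filtration by affine varieties together with a set of coordinate
  functions, whose polynomial expressions, restricted to the member \<open>d\<close> of the filtration, are the
  regular functions on it.
\<close>

record ('x, 'k) ind_variety =
  strat :: "nat \<Rightarrow> 'x set"
  coords :: "('x \<Rightarrow> 'k) set"

inductive_set regular_functions :: "('x, 'k::field) ind_variety \<Rightarrow> ('x \<Rightarrow> 'k) set"
  for V :: "('x, 'k) ind_variety" where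
  coord: "f \<in> coords V \<Longrightarrow> f \<in> regular_functions V"
| const: "(\<lambda>_. c) \<in> regular_functions V"
| add: "f \<in> regular_functions V \<Longrightarrow> g \<in> regular_functions V \<Longrightarrow>
    (\<lambda>x. f x + g x) \<in> regular_functions V"
| mult: "f \<in> regular_functions V \<Longrightarrow> g \<in> regular_functions V \<Longrightarrow>
    (\<lambda>x. f x * g x) \<in> regular_functions V"

definition zariski_closed :: "('x, 'k::field) ind_variety \<Rightarrow> nat \<Rightarrow> 'x set \<Rightarrow> bool" where
  "zariski_closed V d C \<longleftrightarrow>
     (\<exists>P \<subseteq> regular_functions V. C = {x \<in> strat V d. \<forall>f\<in>P. f x = 0})"

definition ind_topology :: "('x, 'k::field) ind_variety \<Rightarrow> 'x topology" where
  "ind_topology V = topology (\<lambda>U. U \<subseteq> (\<Union>d. strat V d) \<and>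
     (\<forall>d. zariski_closed V d (strat V d - U)))"

lemma zariski_closed_Un:
  assumes "zariski_closed V d C" "zariski_closed V d D"
  shows "zariski_closed V d (C \<union> D)"
proof -
  obtain P Q where P: "P \<subseteq> regular_functions V" "C = {x \<in> strat V d. \<forall>f\<in>P. f x = 0}"
    and Q: "Q \<subseteq> regular_functions V" "D = {x \<in> strat V d. \<forall>f\<in>Q. f x = 0}"
    using assms unfolding zariski_closed_def by (elim exE conjE)
  define R where "R = (\<lambda>(f, g) x. f x * g x) ` (P \<times> Q)"
  have R: "(\<forall>h\<in>R. h x = 0) \<longleftrightarrow> (\<forall>f\<in>P. \<forall>g\<in>Q. f x * g x = 0)" for x
    unfolding R_def by simp
  have "R \<subseteq> regular_functions V"
    unfolding R_def using P(1) Q(1) by (auto intro!: regular_functions.mult)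
  moreover have "C \<union> D = {x \<in> strat V d. \<forall>h\<in>R. h x = 0}"
    unfolding R P(2) Q(2) mult_eq_0_iff by blast
  ultimately show ?thesis unfolding zariski_closed_def by (intro exI[of _ R] conjI)
qed

lemma zariski_closed_Inter:
  assumes "\<And>C. C \<in> \<C> \<Longrightarrow> zariski_closed V d C"
  shows "zariski_closed V d (strat V d \<inter> \<Inter>\<C>)"
proof -
  let ?P = "{f \<in> regular_functions V. \<exists>C\<in>\<C>. \<forall>x\<in>C. f x = 0}"
  have "x \<in> C" if x: "x \<in> strat V d" "\<forall>f\<in>?P. f x = 0" and C: "C \<in> \<C>" for x C
  proof -
    obtain Q where Q: "Q \<subseteq> regular_functions V" "C = {x \<in> strat V d. \<forall>f\<in>Q. f x = 0}"
      using assms[OF C] unfolding zariski_closed_def by (elim exE conjE)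
    have "Q \<subseteq> ?P"
    proof
      fix f assume "f \<in> Q"
      then have "f \<in> regular_functions V" "\<forall>x\<in>C. f x = 0" using Q by auto
      then show "f \<in> ?P" using C by blast
    qed
    then show "x \<in> C" using x Q(2) by blast
  qed
  then have "strat V d \<inter> \<Inter>\<C> = {x \<in> strat V d. \<forall>f\<in>?P. f x = 0}" by blast
  then show ?thesis unfolding zariski_closed_def by (intro exI[of _ ?P]) blast
qed

lemma openin_ind_topology:
  "openin (ind_topology V) U \<longleftrightarrow>
     U \<subseteq> (\<Union>d. strat V d) \<and> (\<forall>d. zariski_closed V d (strat V d - U))"
proof -
  let ?S = "\<Union>d. strat V d"
  have "istopology (\<lambda>U. U \<subseteq> ?S \<and> (\<forall>d. zariski_closed V d (strat V d - U)))"
    unfolding istopology_def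
  proof (intro conjI allI impI)
    fix S T d
    assume "S \<subseteq> ?S \<and> (\<forall>d. zariski_closed V d (strat V d - S))"
      and "T \<subseteq> ?S \<and> (\<forall>d. zariski_closed V d (strat V d - T))"
    then show "S \<inter> T \<subseteq> ?S" "zariski_closed V d (strat V d - S \<inter> T)"
      by (auto simp: Diff_Int intro: zariski_closed_Un)
  next
    fix \<K> d
    assume K: "\<forall>K\<in>\<K>. K \<subseteq> ?S \<and> (\<forall>d. zariski_closed V d (strat V d - K))"
    then show "\<Union>\<K> \<subseteq> ?S" by blast
    have "zariski_closed V d (strat V d \<inter> \<Inter>((\<lambda>K. strat V d - K) ` \<K>))"
      by (rule zariski_closed_Inter) (use K in blast)
    moreover have "strat V d \<inter> \<Inter>((\<lambda>K. strat V d - K) ` \<K>) = strat V d - \<Union>\<K>"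
      by blast
    ultimately show "zariski_closed V d (strat V d - \<Union>\<K>)" by (simp only:)
  qed
  then show ?thesis unfolding ind_topology_def by (simp only: topology_inverse')
qed

lemma topspace_ind_topology [simp]:
  fixes V :: "('x, 'k::field) ind_variety"
  shows "topspace (ind_topology V) = (\<Union>d. strat V d)"
proof (rule subset_antisym)
  show "topspace (ind_topology V) \<subseteq> (\<Union>d. strat V d)"
    using openin_topspace[of "ind_topology V"] unfolding openin_ind_topology by (rule conjunct1)
  have "zariski_closed V d {}" for d
    unfolding zariski_closed_def
  proof (rule exI[of _ "{\<lambda>_. 1 :: 'k}"], rule conjI)
    show "{\<lambda>_. 1 :: 'k} \<subseteq> regular_functions V"
      using regular_functions.const[of 1 V] by simp
    show "{} = {x \<in> strat V d. \<forall>f\<in>{\<lambda>_. 1 :: 'k}. f x = 0}" by simp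
  qed
  moreover have "strat V d - (\<Union>d. strat V d) = {}" for d by auto
  ultimately have "openin (ind_topology V) (\<Union>d. strat V d)"
    unfolding openin_ind_topology by (simp only: subset_refl simp_thms)
  then show "(\<Union>d. strat V d) \<subseteq> topspace (ind_topology V)" by (rule openin_subset)
qed

lemma closedin_ind_topology:
  "closedin (ind_topology V) C \<longleftrightarrow>
     C \<subseteq> (\<Union>d. strat V d) \<and> (\<forall>d. zariski_closed V d (C \<inter> strat V d))"
proof (cases "C \<subseteq> (\<Union>d. strat V d)")
  case True
  then have "strat V d - ((\<Union>d. strat V d) - C) = C \<inter> strat V d" for d by auto
  moreover have "(\<Union>d. strat V d) - C \<subseteq> (\<Union>d. strat V d)" by (rule Diff_subset)
  ultimately show ?thesis
    unfolding closedin_def openin_ind_topology topspace_ind_topology by (simp only: simp_thms)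
next
  case False
  then show ?thesis
    unfolding closedin_def topspace_ind_topology by (simp only: simp_thms)
qed

definition ind_subvariety :: "('x, 'k) ind_variety \<Rightarrow> 'x set \<Rightarrow> ('x, 'k) ind_variety" where
  "ind_subvariety V Z = \<lparr>strat = (\<lambda>d. strat V d \<inter> Z), coords = coords V\<rparr>"

definition ind_morphism ::
    "('x, 'k::field) ind_variety \<Rightarrow> ('y, 'k) ind_variety \<Rightarrow> ('x \<Rightarrow> 'y) \<Rightarrow> bool" where
  "ind_morphism V W \<phi> \<longleftrightarrow>
     (\<forall>d. \<exists>e. \<phi> ` strat V d \<subseteq> strat W e \<and>
        (\<forall>f \<in> regular_functions W. \<exists>g \<in> regular_functions V. \<forall>x \<in> strat V d. f (\<phi> x) = g x))"

definition ind_group_isomorphic ::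
    "'x monoid \<Rightarrow> ('x, 'k::field) ind_variety \<Rightarrow> 'y monoid \<Rightarrow> ('y, 'k) ind_variety \<Rightarrow> bool" where
  "ind_group_isomorphic G V H W \<longleftrightarrow>
     (\<exists>\<phi> \<in> iso G H. ind_morphism V W \<phi> \<and> ind_morphism W V (inv_into (carrier G) \<phi>))"

text \<open>
  The coordinates on \<open>Aut(A^2)\<close> are the coefficients of an automorphism and of its inverse: its
  filtration is embedded as a closed subset of pairs of endomorphisms by \<open>g \<mapsto> (g, g\<^sup>-\<^sup>1)\<close>.
\<close>

definition Aut_ind :: "('k::field endo, 'k) ind_variety" where
  "Aut_ind =
     \<lparr>strat = (\<lambda>d. {g \<in> carrier Aut_A2. endo_degree g \<le> d \<and> endo_degree (inv\<^bsub>Aut_A2\<^esub> g) \<le> d}),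
      coords = (\<Union>i j. {\<lambda>g. coeff (coeff (fst g) j) i, \<lambda>g. coeff (coeff (snd g) j) i,
                  \<lambda>g. coeff (coeff (fst (inv\<^bsub>Aut_A2\<^esub> g)) j) i,
                  \<lambda>g. coeff (coeff (snd (inv\<^bsub>Aut_A2\<^esub> g)) j) i})\<rparr>"

definition poly_add_group :: "'k::comm_ring_1 poly monoid" where
  "poly_add_group = \<lparr>carrier = UNIV, mult = (+), one = 0\<rparr>"

definition poly_ind :: "('k::field poly, 'k) ind_variety" where
  "poly_ind = \<lparr>strat = (\<lambda>d. {f. degree f \<le> d}), coords = range (\<lambda>i f. coeff f i)\<rparr>"


section \<open>Algebraic and unipotent subgroups of the automorphism group\<close>

definition algebraic_subgroup :: "'k::field endo set \<Rightarrow> bool" where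
  "algebraic_subgroup H \<longleftrightarrow> subgroup H Aut_A2 \<and> (\<exists>d. H \<subseteq> strat Aut_ind d) \<and>
     (\<exists>U C. openin (ind_topology Aut_ind) U \<and> closedin (ind_topology Aut_ind) C \<and> H = U \<inter> C)"

text \<open>
  An element \<open>g\<close> of a linear algebraic group \<open>H\<close> is unipotent if right translation \<open>\<rho>\<^sub>g\<close> on the
  coordinate ring \<open>k[H]\<close> is locally unipotent, i.e. \<open>\<rho>\<^sub>g - id\<close> is locally nilpotent; \<open>H\<close> is
  unipotent if all its elements are. An algebraic subgroup of \<open>Aut(A^2)\<close> is closed in a member of
  the filtration, so \<open>k[H]\<close> consists of the restrictions of the regular functions to \<open>H\<close>.
\<close>

definition unipotent_algebraic_subgroup :: "'k::field endo set \<Rightarrow> bool" where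
  "unipotent_algebraic_subgroup H \<longleftrightarrow> algebraic_subgroup H \<and>
     (\<forall>g\<in>H. \<forall>f \<in> regular_functions Aut_ind. \<exists>n. \<forall>h\<in>H.
        ((\<lambda>\<psi> x. \<psi> (x \<otimes>\<^bsub>Aut_A2\<^esub> g) - \<psi> x) ^^ n) f h = 0)"

definition nested_unipotent :: "'k::field endo set \<Rightarrow> bool" where
  "nested_unipotent H \<longleftrightarrow>
     (\<exists>U :: nat \<Rightarrow> 'k endo set. (\<forall>n. unipotent_algebraic_subgroup (U n)) \<and>
        (\<forall>n. U n \<subseteq> U (Suc n)) \<and> H = (\<Union>n. U n))"

definition centralizer :: "('g, 'm) monoid_scheme \<Rightarrow> 'g set \<Rightarrow> 'g set" where
  "centralizer G S = {g \<in> carrier G. \<forall>s\<in>S. g \<otimes>\<^bsub>G\<^esub> s = s \<otimes>\<^bsub>G\<^esub> g}"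


section \<open>Free groups and free products\<close>

inductive_set word_congruence :: "'l set \<Rightarrow> ('l list \<times> 'l list) set \<Rightarrow> ('l list \<times> 'l list) set"
  for L :: "'l set" and R :: "('l list \<times> 'l list) set" where
  rel: "(v, w) \<in> R \<Longrightarrow> v \<in> lists L \<Longrightarrow> w \<in> lists L \<Longrightarrow> (v, w) \<in> word_congruence L R"
| refl: "w \<in> lists L \<Longrightarrow> (w, w) \<in> word_congruence L R"
| sym: "(v, w) \<in> word_congruence L R \<Longrightarrow> (w, v) \<in> word_congruence L R"
| trans: "(v, w) \<in> word_congruence L R \<Longrightarrow> (w, w') \<in> word_congruence L R \<Longrightarrow>
    (v, w') \<in> word_congruence L R"
| append: "(v, w) \<in> word_congruence L R \<Longrightarrow> (v', w') \<in> word_congruence L R \<Longrightarrow>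
    (v @ v', w @ w') \<in> word_congruence L R"

definition presented_monoid :: "'l set \<Rightarrow> ('l list \<times> 'l list) set \<Rightarrow> 'l list set monoid" where
  "presented_monoid L R =
     \<lparr>carrier = lists L // word_congruence L R,
      mult = (\<lambda>A B. \<Union>v\<in>A. \<Union>w\<in>B. word_congruence L R `` {v @ w}),
      one = word_congruence L R `` {[]}\<rparr>"

text \<open>
  The map from a presented monoid to \<open>G\<close> induced by a map \<open>\<phi>\<close> on the letters; it is meaningful when
  \<open>\<phi>\<close> respects the relations.
\<close>

definition induced_map :: "('g, 'm) monoid_scheme \<Rightarrow> ('l \<Rightarrow> 'g) \<Rightarrow> 'l list set \<Rightarrow> 'g" where
  "induced_map G \<phi> A = the_elem ((\<lambda>w. foldr (\<lambda>l g. \<phi> l \<otimes>\<^bsub>G\<^esub> g) w \<one>\<^bsub>G\<^esub>) ` A)"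

text \<open>The letter \<open>(i, True)\<close> stands for the generator \<open>i\<close>, and \<open>(i, False)\<close> for its inverse.\<close>

definition free_group :: "'i set \<Rightarrow> ('i \<times> bool) list set monoid" where
  "free_group I = presented_monoid (I \<times> UNIV) {([(i, b), (i, \<not> b)], []) | i b. i \<in> I}"

definition freely_generated :: "('g, 'm) monoid_scheme \<Rightarrow> 'i set \<Rightarrow> ('i \<Rightarrow> 'g) \<Rightarrow> bool" where
  "freely_generated G I x \<longleftrightarrow> x ` I \<subseteq> carrier G \<and>
     induced_map G (\<lambda>(i, b). if b then x i else inv\<^bsub>G\<^esub> (x i)) \<in> iso (free_group I) G"

definition free_product ::
    "('a, 'm) monoid_scheme \<Rightarrow> ('b, 'n) monoid_scheme \<Rightarrow> ('a + 'b) list set monoid" where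
  "free_product G H = presented_monoid (carrier G <+> carrier H)
     ({([Inl \<one>\<^bsub>G\<^esub>], []), ([Inr \<one>\<^bsub>H\<^esub>], [])} \<union>
      {([Inl a, Inl b], [Inl (a \<otimes>\<^bsub>G\<^esub> b)]) | a b. a \<in> carrier G \<and> b \<in> carrier G} \<union>
      {([Inr a, Inr b], [Inr (a \<otimes>\<^bsub>H\<^esub> b)]) | a b. a \<in> carrier H \<and> b \<in> carrier H})"

definition is_free_product_of :: "('g, 'm) monoid_scheme \<Rightarrow> 'g set \<Rightarrow> 'g set \<Rightarrow> bool" where
  "is_free_product_of G A B \<longleftrightarrow> subgroup A G \<and> subgroup B G \<and>
     induced_map G (case_sum (\<lambda>a. a) (\<lambda>b. b))
       \<in> iso (free_product (G\<lparr>carrier := A\<rparr>) (G\<lparr>carrier := B\<rparr>)) G"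

end

theory Submission
  imports Defs
begin

text \<open>
  The group generated by \<open>u = (x + y\<^sup>2, y)\<close> and \<open>v = (x, y + x\<^sup>2)\<close> commutes with the group \<open>S\<close> of cube roots
  of unity and is tangent to the identity at the origin. Both conditions are polynomial conditions
  on coefficients: the monomials \<open>x\<^sup>i y\<^sup>j\<close> of the two components satisfy \<open>i + 2 j \<equiv> 1\<close> and \<open>i + 2 j \<equiv> 2\<close>
  modulo \<open>3\<close>, and the linear part is the identity. They define the group \<open>equivariant_Aut\<close>, which is
  therefore closed. The theorem follows from four facts about it.

  Generation. The group \<open>equivariant_Aut\<close> is generated by the shears \<open>(x + y\<^sup>2 f(y\<^sup>3), y)\<close> and
  \<open>(x, y + x\<^sup>2 f(x\<^sup>3))\<close>. This is a version of Jung's theorem, and the proof rests on locally nilpotent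
  derivations. If \<open>(f, h)\<close> is an automorphism, then the derivation \<open>q \<mapsto> jac f q\<close> is locally nilpotent,
  and the same holds for every weighted leading form of \<open>f\<close>
  (\<open>leading_form_locally_nilpotent\<close>). The degree function of a locally nilpotent derivation is
  additive, which restricts such forms to \<open>c x\<^sup>s\<close>, \<open>c y\<^sup>r\<close> and powers of \<open>x - a y\<^sup>p\<close> or \<open>x\<^sup>q - a y\<close>
  (\<open>locally_nilpotent_homogeneous_form\<close>). For the ordinary degree, equivariance leaves only the powers
  of \<open>x\<close> or \<open>y\<close>; the steepest edge of the Newton polygon then exhibits a shear that lowers the degree of \<open>f\<close>
  (\<open>equivariant_degree_reduction\<close>).

  Freeness. Nontrivial shears in alternating directions at least double the degree at each step
  (\<open>shear_word_growth\<close>). So alternating words are nontrivial, which gives the free product, and the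
  powers of \<open>u v\<close> have unbounded degree, which excludes local finiteness. For words in \<open>u\<close> and \<open>v\<close> the
  leading coefficients also count the repetitions of a letter (\<open>free_word_growth\<close>).

  Density. A closed set that contains infinitely many points of a polynomial curve of automorphisms
  contains the whole curve. Conjugating \<open>(x, y + e\<^sup>3 x\<^sup>2)\<close> by \<open>(x + p(y)/e, y)\<close> gives a curve whose limit
  for \<open>e = 0\<close> is \<open>(x - p\<^sup>2 p', y)\<close> (\<open>degenerating_curve\<close>). Starting with \<open>p = y\<^sup>2\<close> and polarizing, one
  reaches all shears (\<open>shears_subset_curve_closure\<close>), hence the whole of \<open>equivariant_Aut\<close>.

  Bounded subgroups. Since degrees grow along words, a bounded subgroup of the free product contains
  no conjugate of a cyclically reduced word of length at least two. This forces it to be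
  conjugate to a subgroup of one factor (\<open>bounded_subgroup_conjugate_into_factor\<close>). The
  coefficients of a shear change by constants under translations, and all regular functions are
  polynomials in them; so a conjugate of a group of shears is unipotent
  (\<open>unipotent_if_conjugate_to_shears\<close>).

  Finally, an automorphism that commutes with \<open>u\<close> and \<open>v\<close> has components depending on one variable each,
  and these are additive polynomials; this determines the centralizer
  (\<open>commutes_with_shears_imp_cube_root\<close>).
\<close>

section \<open>Coefficients and total degree\<close>

abbreviation cst :: "'k::comm_ring_1 \<Rightarrow> 'k poly poly" where
  "cst c \<equiv> [:[:c:]:]"

abbreviation cf :: "'k::comm_ring_1 poly poly \<Rightarrow> nat \<Rightarrow> nat \<Rightarrow> 'k" where
  "cf p i j \<equiv> coeff (coeff p j) i"

lemma poly2_eqI: "(\<And>i j. cf p i j = cf q i j) \<Longrightarrow> p = q"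
  by (intro poly_eqI) auto

lemma poly2_induct [case_names const X Y add mult]:
  fixes p :: "'k::comm_ring_1 poly poly"
  assumes c: "\<And>c. P (cst c)" and X: "P varX" and Y: "P varY"
    and a: "\<And>p q. P p \<Longrightarrow> P q \<Longrightarrow> P (p + q)" and m: "\<And>p q. P p \<Longrightarrow> P q \<Longrightarrow> P (p * q)"
  shows "P p"
proof -
  have inner: "P [:q:]" for q
  proof (induction q)
    case 0
    show ?case using c[of 0] by simp
  next
    case (pCons b q)
    have "[:pCons b q:] = cst b + varX * [:q:]" by (simp add: varX_def)
    then show ?case using a[OF c[of b] m[OF X pCons(2)]] by simp
  qed
  show ?thesis
  proof (induction p)
    case 0
    show ?case using c[of 0] by simp
  next
    case (pCons b q)
    have "pCons b q = [:b:] + varY * q" by (simp add: varY_def)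
    then show ?case using a[OF inner[of b] m[OF Y pCons(2)]] by simp
  qed
qed

lemma cf_cst: "cf (cst c) i j = (if i = 0 \<and> j = 0 then c else 0)"
  by (auto simp: coeff_pCons split: nat.splits)

lemma cf_cst_mult: "cf (cst c * p) i j = c * cf p i j"
  by simp

lemma cf_X_mult: "cf (varX * p) i j = (if i = 0 then 0 else cf p (i - 1) j)"
  by (auto simp: varX_def coeff_pCons split: nat.splits)

lemma cf_Y_mult: "cf (varY * p) i j = (if j = 0 then 0 else cf p i (j - 1))"
  by (auto simp: varY_def coeff_pCons split: nat.splits)

lemma cf_Xpow_mult: "cf (varX ^ n * p) i j = (if i < n then 0 else cf p (i - n) j)"
  by (induction n arbitrary: i) (auto simp: cf_X_mult mult.assoc not_less)

lemma cf_Ypow_mult: "cf (varY ^ n * p) i j = (if j < n then 0 else cf p i (j - n))"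
  by (induction n arbitrary: j) (auto simp: cf_Y_mult mult.assoc not_less)

lemma cf_1: "cf 1 i j = (if i = 0 \<and> j = 0 then 1 else 0)"
  using cf_cst[where c=1 and i=i and j=j] by (simp flip: one_pCons)

lemma cf_Xpow: "cf (varX ^ n) i j = (if i = n \<and> j = 0 then 1 else 0)"
  using cf_Xpow_mult[where n=n and p=1 and i=i and j=j] by (auto simp: cf_1)

lemma cf_Ypow: "cf (varY ^ n) i j = (if i = 0 \<and> j = n then 1 else 0)"
  using cf_Ypow_mult[where n=n and p=1 and i=i and j=j] by (auto simp: cf_1)

lemma cf_varX: "cf varX i j = (if i = 1 \<and> j = 0 then 1 else 0)"
  using cf_Xpow[where n=1 and i=i and j=j] by simp

lemma cf_varY: "cf varY i j = (if i = 0 \<and> j = 1 then 1 else 0)"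
  using cf_Ypow[where n=1 and i=i and j=j] by simp

lemma finite_support2: "finite {(i, j). cf p i j \<noteq> 0}"
proof -
  have "i \<le> degree (coeff p j) \<and> j \<le> degree p" if "cf p i j \<noteq> 0" for i j
    using that le_degree[of "coeff p j" i] le_degree[of p j] by (cases "coeff p j = 0") auto
  then have "{(i, j). cf p i j \<noteq> 0} \<subseteq> (\<Union>j\<le>degree p. {..degree (coeff p j)} \<times> {j})"
    by auto
  then show ?thesis by (rule finite_subset) auto
qed

lemma poly2_as_sum: "p = (\<Sum>(i, j)\<in>{(i, j). cf p i j \<noteq> 0}. cst (cf p i j) * varX ^ i * varY ^ j)"
proof (rule poly2_eqI)
  fix a b
  let ?T = "{(i, j). cf p i j \<noteq> 0}"
  have "cf (\<Sum>(i, j)\<in>?T. cst (cf p i j) * varX ^ i * varY ^ j) a b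
     = (\<Sum>z\<in>?T. case z of (i, j) \<Rightarrow> if (a, b) = (i, j) then cf p a b else 0)"
    unfolding coeff_sum
    by (intro sum.cong HOL.refl) (auto simp: mult.assoc cf_Xpow_mult cf_Ypow split: if_splits)
  also have "\<dots> = (\<Sum>z\<in>?T. if (a, b) = z then cf p a b else 0)"
    by (rule sum.cong[OF HOL.refl]) (simp add: case_prod_beta prod_eq_iff)
  also have "\<dots> = cf p a b"
    using finite_support2[of p] by (simp add: sum.delta')
  finally show "cf p a b = cf (\<Sum>(i, j)\<in>?T. cst (cf p i j) * varX ^ i * varY ^ j) a b" by simp
qed

lemma total_degree_le_iff: "total_degree p \<le> n \<longleftrightarrow> (\<forall>i j. cf p i j \<noteq> 0 \<longrightarrow> i + j \<le> n)"
proof -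
  have "{i + j | i j. cf p i j \<noteq> 0} = (\<lambda>(i, j). i + j) ` {(i, j). cf p i j \<noteq> 0}" by auto
  then have "finite (insert 0 {i + j | i j. cf p i j \<noteq> 0})"
    using finite_support2[of p] by simp
  then show ?thesis unfolding total_degree_def by (subst Max_le_iff) auto
qed

lemma total_degreeD: "cf p i j \<noteq> 0 \<Longrightarrow> i + j \<le> total_degree p"
  using total_degree_le_iff[of p "total_degree p"] by blast

lemma cf_eq_0_if_degree: "total_degree p < i + j \<Longrightarrow> cf p i j = 0"
  using total_degreeD[of p j i] by fastforce

lemma total_degree_attained: "total_degree p > 0 \<Longrightarrow> \<exists>i j. cf p i j \<noteq> 0 \<and> i + j = total_degree p"
proof (rule ccontr)
  assume "total_degree p > 0" and no: "\<not> ?thesis"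
  have "total_degree p \<le> total_degree p - 1"
    unfolding total_degree_le_iff
  proof (intro allI impI)
    fix i j assume "cf p i j \<noteq> 0"
    then show "i + j \<le> total_degree p - 1" using total_degreeD[of p j i] no by fastforce
  qed
  then show False using \<open>total_degree p > 0\<close> by simp
qed

lemma total_degree_add: "total_degree (p + q) \<le> max (total_degree p) (total_degree q)"
  unfolding total_degree_le_iff
proof (intro allI impI)
  fix i j assume "cf (p + q) i j \<noteq> 0"
  then have "cf p i j \<noteq> 0 \<or> cf q i j \<noteq> 0" by auto
  then show "i + j \<le> max (total_degree p) (total_degree q)"
    using total_degreeD[of p j i] total_degreeD[of q j i] by auto
qed

lemma cf_mult: "cf (p * q) i j = (\<Sum>b\<le>j. \<Sum>a\<le>i. cf p a b * cf q (i - a) (j - b))"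
  by (simp add: coeff_mult coeff_sum)

lemma total_degree_mult: "total_degree (p * q) \<le> total_degree p + total_degree q"
  unfolding total_degree_le_iff
proof (intro allI impI)
  fix i j assume "cf (p * q) i j \<noteq> 0"
  then obtain b where b: "b \<le> j" "(\<Sum>a\<le>i. cf p a b * cf q (i - a) (j - b)) \<noteq> 0"
    unfolding cf_mult by (metis (no_types, lifting) atMost_iff sum.neutral)
  then obtain a where a: "a \<le> i" "cf p a b * cf q (i - a) (j - b) \<noteq> 0"
    by (metis (no_types, lifting) atMost_iff sum.neutral)
  then have "cf p a b \<noteq> 0" "cf q (i - a) (j - b) \<noteq> 0" by auto
  then show "i + j \<le> total_degree p + total_degree q"
    using total_degreeD[of p b a] total_degreeD[of q "j - b" "i - a"] a b by linarith
qed

lemma total_degree_cst: "total_degree (cst c) = 0"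
  using total_degree_le_iff[of "cst c" 0] by (auto simp: cf_cst split: if_splits)

lemma total_degree_power: "total_degree (p ^ n) \<le> n * total_degree p"
proof (induction n)
  case 0
  then show ?case using total_degree_cst[of 1] by (simp flip: one_pCons)
next
  case (Suc n)
  then show ?case using total_degree_mult[of p "p ^ n"] by simp
qed

lemma total_degree_varX [simp]: "total_degree (varX :: 'k::comm_ring_1 poly poly) = 1"
proof (rule antisym)
  show "total_degree (varX :: 'k poly poly) \<le> 1"
    by (auto simp: total_degree_le_iff cf_varX split: if_splits)
  show "1 \<le> total_degree (varX :: 'k poly poly)"
    using total_degreeD[of "varX :: 'k poly poly" 0 1] by (simp add: cf_varX)
qed

lemma total_degree_varY [simp]: "total_degree (varY :: 'k::comm_ring_1 poly poly) = 1"
proof (rule antisym)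
  show "total_degree (varY :: 'k poly poly) \<le> 1"
    by (auto simp: total_degree_le_iff cf_varY split: if_splits)
  show "1 \<le> total_degree (varY :: 'k poly poly)"
    using total_degreeD[of "varY :: 'k poly poly" 1 0] by (simp add: cf_varY)
qed

lemma total_degree_sum_le:
  assumes "finite A" "\<And>a. a \<in> A \<Longrightarrow> total_degree (f a) \<le> n"
  shows "total_degree (sum f A) \<le> n"
  using assms
proof (induction A rule: finite_induct)
  case empty
  then show ?case using total_degree_cst[of 0] by (metis le0 pCons_0_0 sum.empty)
next
  case (insert x A)
  then show ?case using total_degree_add[of "f x" "sum f A"] by fastforce
qed


section \<open>Substitution\<close>

lemma subst2_cst [simp]: "subst2 (cst c) g = cst c"
  by (simp add: subst2_const subst1_const)

lemma subst2_power: "subst2 (p ^ n) g = subst2 p g ^ n"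
  by (induction n) (simp_all add: subst2_1 subst2_mult)

lemma subst2_sum: "subst2 (sum f A) g = (\<Sum>a\<in>A. subst2 (f a) g)"
  by (induction A rule: infinite_finite_induct) (simp_all add: subst2_add)

lemma subst2_uminus: "subst2 (- p) g = - subst2 p g"
  using subst2_add[of p "- p" g] by (simp add: eq_neg_iff_add_eq_0 add.commute)

lemma subst2_diff: "subst2 (p - q) g = subst2 p g - subst2 q g"
  using subst2_add[of p "- q" g] by (simp add: subst2_uminus)

lemmas subst2_simps = subst2_add subst2_mult subst2_power subst2_varX subst2_varY subst2_cst
  subst2_subst1 subst2_uminus subst2_diff subst2_1

lemma subst2_monomial_sum:
  "subst2 p g = (\<Sum>(i, j)\<in>{(i, j). cf p i j \<noteq> 0}. cst (cf p i j) * fst g ^ i * snd g ^ j)"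
proof -
  have "subst2 p g = subst2 (\<Sum>(i, j)\<in>{(i, j). cf p i j \<noteq> 0}. cst (cf p i j) * varX ^ i * varY ^ j) g"
    using poly2_as_sum[of p] by simp
  also have "\<dots> = (\<Sum>(i, j)\<in>{(i, j). cf p i j \<noteq> 0}. cst (cf p i j) * fst g ^ i * snd g ^ j)"
    unfolding subst2_sum by (intro sum.cong HOL.refl) (auto simp: subst2_simps simp del: mult_pCons_left)
  finally show ?thesis .
qed

text \<open>A polynomial all of whose monomials have small weight stays of small degree when \<open>x\<close> and \<open>y\<close>
  are replaced by polynomials whose degrees are those weights.\<close>

lemma total_degree_subst2_weighted:
  assumes "total_degree (fst g) \<le> a" "total_degree (snd g) \<le> b"
    and "\<And>i j. cf p i j \<noteq> 0 \<Longrightarrow> a * i + b * j \<le> n"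
  shows "total_degree (subst2 p g) \<le> n"
  unfolding subst2_monomial_sum
proof (rule total_degree_sum_le[OF finite_support2], clarify)
  fix i j assume "cf p i j \<noteq> 0"
  then have n: "a * i + b * j \<le> n" by (rule assms(3))
  have "total_degree (cst (cf p i j) * fst g ^ i * snd g ^ j)
      \<le> total_degree (cst (cf p i j)) + total_degree (fst g ^ i) + total_degree (snd g ^ j)"
    using total_degree_mult[of "cst (cf p i j) * fst g ^ i" "snd g ^ j"]
      total_degree_mult[of "cst (cf p i j)" "fst g ^ i"] by linarith
  also have "\<dots> \<le> i * a + j * b"
    using total_degree_power[of "fst g" i] total_degree_power[of "snd g" j] assms(1,2)
    by (simp add: total_degree_cst) (meson add_mono le_trans mult_le_mono2)
  finally show "total_degree (cst (cf p i j) * fst g ^ i * snd g ^ j) \<le> n"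
    using n by (simp add: mult.commute)
qed

lemma total_degree_subst2: "total_degree (subst2 p g) \<le> total_degree p * endo_degree g"
proof (rule total_degree_subst2_weighted[of g "endo_degree g" "endo_degree g"])
  fix i j assume "cf p i j \<noteq> 0"
  then have "i + j \<le> total_degree p" by (rule total_degreeD)
  then have "(i + j) * endo_degree g \<le> total_degree p * endo_degree g" by (rule mult_le_mono1)
  then show "endo_degree g * i + endo_degree g * j \<le> total_degree p * endo_degree g"
    by (simp add: algebra_simps)
qed (simp_all add: endo_degree_def)

lemma endo_degree_comp: "endo_degree (endo_comp g h) \<le> endo_degree g * endo_degree h"
proof -
  have "total_degree (subst2 p h) \<le> endo_degree g * endo_degree h" if "total_degree p \<le> endo_degree g" for p
    using total_degree_subst2[of p h] mult_le_mono1[OF that] by (rule le_trans)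
  then show ?thesis
    unfolding endo_degree_def[of "endo_comp g h"] endo_comp_def by (simp add: endo_degree_def)
qed

lemma cf_subst1_varY: "cf (subst1 q varY) i j = (if i = 0 then coeff q j else 0)"
proof (induction q arbitrary: j)
  case (pCons a q)
  then show ?case
    by (auto simp: subst1_pCons cf_Y_mult coeff_pCons split: nat.splits)
qed simp

lemma cf_swap: "cf (subst2 p (varY, varX)) i j = cf p j i"
proof (induction p arbitrary: i)
  case (pCons q p)
  then show ?case
    by (auto simp: subst2_pCons cf_X_mult cf_subst1_varY coeff_pCons split: nat.splits)
qed simp

lemma total_degree_swap: "total_degree (subst2 p (varY, varX)) = total_degree p"
proof (rule antisym)
  show "total_degree (subst2 p (varY, varX)) \<le> total_degree p"
    using total_degreeD[of p] by (auto simp: total_degree_le_iff cf_swap add.commute)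
  show "total_degree p \<le> total_degree (subst2 p (varY, varX))"
    unfolding total_degree_le_iff[of p]
    using total_degreeD[of "subst2 p (varY, varX)"] by (metis add.commute cf_swap)
qed

lemma cf_subst1_scale: "cf (subst1 q (scale2 c varX)) i j = (if j = 0 then c ^ i * coeff q i else 0)"
proof (induction q arbitrary: i)
  case (pCons a q)
  have "scale2 c varX * subst1 q (scale2 c varX) = cst c * (varX * subst1 q (scale2 c varX))"
    by (simp add: scale2_def)
  then have "cf (scale2 c varX * subst1 q (scale2 c varX)) i j
     = (if i = 0 then 0 else c * (if j = 0 then c ^ (i - 1) * coeff q (i - 1) else 0))" for i
    using pCons(2)[of "i - 1"] by (simp only: cf_cst_mult cf_X_mult) simp
  then show ?case
    by (cases i; cases j) (simp_all add: subst1_pCons)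
qed simp

lemma cf_subst2_scale: "cf (subst2 p (scale2 c varX, scale2 d varY)) i j = c ^ i * d ^ j * cf p i j"
proof (induction p arbitrary: j)
  case (pCons q p)
  let ?s = "(scale2 c varX, scale2 d varY)"
  have "scale2 d varY * subst2 p ?s = cst d * (varY * subst2 p ?s)"
    by (simp add: scale2_def)
  then have "cf (scale2 d varY * subst2 p ?s) i j
     = (if j = 0 then 0 else d * (c ^ i * d ^ (j - 1) * cf p i (j - 1)))" for j
    using pCons(2)[of "j - 1"] by (simp only: cf_cst_mult cf_Y_mult) simp
  then show ?case
    by (cases j) (simp_all add: subst2_pCons cf_subst1_scale mult_ac)
qed simp


section \<open>Automorphisms\<close>

lemma carrier_Aut_iff:
  "g \<in> carrier Aut_A2 \<longleftrightarrow> (\<exists>h. endo_comp g h = (varX, varY) \<and> endo_comp h g = (varX, varY))"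
  by (auto simp: Aut_A2_def units_of_def Units_def End_A2_def simp del: split_paired_Ex)

lemma carrier_AutI: "endo_comp g h = (varX, varY) \<Longrightarrow> endo_comp h g = (varX, varY) \<Longrightarrow> g \<in> carrier Aut_A2"
  unfolding carrier_Aut_iff by blast

lemma mult_Aut [simp]: "monoid.mult Aut_A2 = endo_comp" and one_Aut [simp]: "one Aut_A2 = (varX, varY)"
  by (simp_all add: Aut_A2_def units_of_def End_A2_def)

interpretation Aut: group Aut_A2
  by (rule group_Aut_A2)

lemma inv_Aut_eqI:
  assumes "endo_comp g h = (varX, varY)" "endo_comp h g = (varX, varY)"
  shows "inv\<^bsub>Aut_A2\<^esub> g = h"
proof -
  have "g \<in> carrier Aut_A2" "h \<in> carrier Aut_A2" using assms by (auto intro: carrier_AutI)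
  then show ?thesis using assms by (intro Aut.inv_equality) auto
qed

lemma swap_in_Aut: "(varY, varX) \<in> carrier Aut_A2"
  by (rule carrier_AutI[where h = "(varY, varX)"]) (simp_all add: endo_comp_def subst2_varX subst2_varY)

lemma endo_comp_assoc: "endo_comp (endo_comp f g) h = endo_comp f (endo_comp g h)"
  by (simp add: endo_comp_def subst2_subst2)

lemma endo_comp_id [simp]: "endo_comp g (varX, varY) = g" "endo_comp (varX, varY) g = g"
  by (simp_all add: endo_comp_def subst2_id subst2_varX subst2_varY)

section \<open>Locally nilpotent derivations\<close>

locale derivation =
  fixes D :: "'a::{idom, ring_char_0} \<Rightarrow> 'a"
  assumes D_add: "D (p + q) = D p + D q"
    and D_mult: "D (p * q) = D p * q + p * D q"
begin

lemma D_0 [simp]: "D 0 = 0"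
  using D_add[of 0 0] by simp

lemma D_1 [simp]: "D 1 = 0"
  using D_mult[of 1 1] by simp

lemma D_uminus: "D (- p) = - D p"
  using D_add[of p "- p"] by (simp add: eq_neg_iff_add_eq_0 add.commute)

lemma D_diff: "D (p - q) = D p - D q"
  using D_add[of p "- q"] by (simp add: D_uminus)

lemma D_power: "D (p ^ Suc n) = of_nat (Suc n) * p ^ n * D p"
  by (induction n) (simp_all add: D_mult algebra_simps)

lemma iter_0 [simp]: "(D ^^ n) 0 = 0"
  by (induction n) auto

lemma iter_add: "(D ^^ n) (p + q) = (D ^^ n) p + (D ^^ n) q"
  by (induction n) (auto simp: D_add)

lemma iter_Suc: "(D ^^ Suc n) p = (D ^^ n) (D p)"
  by (simp add: funpow_swap1)

lemma iter_ker_mult: "D p = 0 \<Longrightarrow> (D ^^ n) (p * q) = p * (D ^^ n) q"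
  by (induction n) (auto simp: D_mult)

lemma iter_zero_mono: "(D ^^ m) p = 0 \<Longrightarrow> m \<le> n \<Longrightarrow> (D ^^ n) p = 0"
  by (metis comp_apply funpow_add iter_0 le_add_diff_inverse2)

text \<open>Among the terms of the Leibniz formula for \<open>D\<^bsup>m+n\<^esup>(p q)\<close> only the middle one
  survives; its binomial coefficient enters only through being positive.\<close>

lemma Leibniz_top:
  assumes "(D ^^ Suc m) p = 0" "(D ^^ Suc n) q = 0"
  shows "(D ^^ Suc (m + n)) (p * q) = 0 \<and>
    (\<exists>c>0. (D ^^ (m + n)) (p * q) = of_nat c * (D ^^ m) p * (D ^^ n) q)"
  using assms
proof (induction "m + n" arbitrary: m n p q)
  case 0
  then show ?case by (auto simp: D_mult intro: exI[of _ 1])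
next
  case (Suc N)
  consider "m = 0" | "n = 0" | m' n' where "m = Suc m'" "n = Suc n'"
    by (metis not0_implies_Suc)
  then show ?case
  proof cases
    case 1
    then have "(D ^^ k) (p * q) = p * (D ^^ k) q" for k
      using Suc.prems(1) by (intro iter_ker_mult) simp
    then show ?thesis using 1 Suc.prems(2) by (intro conjI exI[of _ 1]) (simp_all only: add_0 mult_zero_right funpow_0 of_nat_1 mult_1 zero_less_one)
  next
    case 2
    then have "(D ^^ k) (q * p) = q * (D ^^ k) p" for k
      using Suc.prems(2) by (intro iter_ker_mult) simp
    then have k: "(D ^^ k) (p * q) = (D ^^ k) p * q" for k
      by (simp add: mult.commute)
    show ?thesis unfolding k using 2 Suc.prems(1) by (auto intro!: exI[of _ 1])
  next
    case 3
    have z: "(D ^^ Suc m') (D p) = 0" "(D ^^ Suc n') (D q) = 0"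
      using Suc.prems 3 by (simp_all only: iter_Suc)
    have "N = m' + n" "N = m + n'" using Suc.hyps(2) 3 by auto
    note IH1 = Suc.hyps(1)[OF \<open>N = m' + n\<close> z(1) Suc.prems(2)]
      and IH2 = Suc.hyps(1)[OF \<open>N = m + n'\<close> Suc.prems(1) z(2)]
    obtain c1 where c1: "c1 > 0" "(D ^^ N) (D p * q) = of_nat c1 * (D ^^ m') (D p) * (D ^^ n) q"
      using IH1 \<open>N = m' + n\<close> by blast
    obtain c2 where c2: "c2 > 0" "(D ^^ N) (p * D q) = of_nat c2 * (D ^^ m) p * (D ^^ n') (D q)"
      using IH2 \<open>N = m + n'\<close> by blast
    have "(D ^^ Suc N) (p * q) = (D ^^ N) (D p * q) + (D ^^ N) (p * D q)"
      by (simp only: iter_Suc D_mult iter_add)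
    also have "\<dots> = of_nat (c1 + c2) * (D ^^ m) p * (D ^^ n) q"
      unfolding c1(2) c2(2) unfolding 3 iter_Suc by (simp add: algebra_simps)
    finally have "(D ^^ (m + n)) (p * q) = of_nat (c1 + c2) * (D ^^ m) p * (D ^^ n) q"
      using Suc.hyps(2) by simp
    moreover have "(D ^^ Suc (m + n)) (p * q) = (D ^^ Suc N) (D p * q) + (D ^^ Suc N) (p * D q)"
      unfolding Suc.hyps(2)[symmetric] by (simp only: iter_Suc[of "Suc N" "p * q"] D_mult iter_add)
    moreover have "(D ^^ Suc N) (D p * q) = 0" "(D ^^ Suc N) (p * D q) = 0"
      using IH1 IH2 \<open>N = m' + n\<close> \<open>N = m + n'\<close> by simp_all
    ultimately show ?thesis using c1(1) by (intro conjI exI[of _ "c1 + c2"]) simp_all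
  qed
qed

text \<open>The value \<open>n\<close> of the degree function of \<open>D\<close> at \<open>p\<close>.\<close>

definition nil_degree :: "nat \<Rightarrow> 'a \<Rightarrow> bool" where
  "nil_degree n p \<longleftrightarrow> (D ^^ n) p \<noteq> 0 \<and> (D ^^ Suc n) p = 0"

lemma nil_degree_0: "nil_degree 0 p \<longleftrightarrow> p \<noteq> 0 \<and> D p = 0"
  by (simp add: nil_degree_def)

lemma nil_degree_Suc: "nil_degree (Suc n) p \<longleftrightarrow> nil_degree n (D p)"
  by (simp only: nil_degree_def iter_Suc)

lemma nil_degree_unique: "nil_degree m p \<Longrightarrow> nil_degree n p \<Longrightarrow> m = n"
  unfolding nil_degree_def by (metis Suc_leI iter_zero_mono linorder_neqE_nat)

lemma nil_degree_exists: "p \<noteq> 0 \<Longrightarrow> (D ^^ n) p = 0 \<Longrightarrow> \<exists>m. nil_degree m p"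
proof (induction n)
  case (Suc n)
  then show ?case by (cases "(D ^^ n) p = 0") (auto simp: nil_degree_def)
qed simp

lemma nil_degree_mult: "nil_degree m p \<Longrightarrow> nil_degree n q \<Longrightarrow> nil_degree (m + n) (p * q)"
  unfolding nil_degree_def using Leibniz_top[of m p n q] by auto

lemma nil_degree_power: "nil_degree m p \<Longrightarrow> nil_degree (n * m) (p ^ n)"
proof (induction n)
  case 0
  show ?case by (simp add: nil_degree_0)
next
  case (Suc n)
  then show ?case using nil_degree_mult[of m p "n * m" "p ^ n"] by simp
qed

lemma nilpotent_mult:
  assumes "(D ^^ m) p = 0" "(D ^^ n) q = 0"
  shows "\<exists>k. (D ^^ k) (p * q) = 0"
  using Leibniz_top[of m p n q] assms by auto

lemma nilpotent_add:
  assumes "(D ^^ m) p = 0" "(D ^^ n) q = 0"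
  shows "\<exists>k. (D ^^ k) (p + q) = 0"
  using iter_zero_mono[OF assms(1), of "max m n"] iter_zero_mono[OF assms(2), of "max m n"]
  by (intro exI[of _ "max m n"]) (simp add: iter_add)

end

locale locally_nilpotent_derivation = derivation +
  assumes locally_nilpotent: "\<exists>n. (D ^^ n) p = 0"
begin

lemma nil_degree_ex: "p \<noteq> 0 \<Longrightarrow> \<exists>m. nil_degree m p"
  using locally_nilpotent nil_degree_exists by blast

text \<open>The degree function is additive, so a product of degree \<open>0\<close> has factors of degree \<open>0\<close>.\<close>

lemma kernel_factorially_closed:
  assumes "D (p * q) = 0" "p * q \<noteq> 0"
  shows "D p = 0" "D q = 0"
proof -
  obtain m n where mn: "nil_degree m p" "nil_degree n q"
    using nil_degree_ex assms(2) by (metis mult_zero_left mult_zero_right)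
  then have "m + n = 0"
    using nil_degree_mult[OF mn] assms nil_degree_unique nil_degree_0 by blast
  then show "D p = 0" "D q = 0" using mn by (simp_all add: nil_degree_0)
qed

lemma kernel_power:
  assumes "D (p ^ n) = 0" "p \<noteq> 0" "n > 0"
  shows "D p = 0"
proof -
  have "p ^ n = p * p ^ (n - 1)" using assms(3) by (simp flip: power_Suc)
  then show ?thesis using kernel_factorially_closed(1)[of p "p ^ (n - 1)"] assms by auto
qed

end


section \<open>The Jacobian derivation\<close>

lemma cf_partial_x: "cf (partial_x p) i j = of_nat (Suc i) * cf p (Suc i) j"
  by (simp add: partial_x_def coeff_map_poly coeff_pderiv)

lemma cf_partial_y: "cf (partial_y p) i j = of_nat (Suc j) * cf p i (Suc j)"
proof -
  have "coeff (of_nat n * q) i = of_nat n * coeff q i" for n and q :: "'a poly"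
    by (simp add: of_nat_poly)
  then show ?thesis unfolding partial_y_def coeff_pderiv by blast
qed

lemma partial_x_add: "partial_x (p + q) = partial_x p + partial_x q"
  and partial_y_add: "partial_y (p + q) = partial_y p + partial_y q"
  by (rule poly2_eqI; simp add: cf_partial_x cf_partial_y algebra_simps)+

lemma partial_x_pCons: "partial_x (pCons q p) = [:pderiv q:] + varY * partial_x p"
  by (simp add: partial_x_def map_poly_pCons varY_def)

lemma partial_x_smult: "partial_x (smult q p) = smult (pderiv q) p + smult q (partial_x p)"
  by (induction p) (simp_all add: partial_x_pCons pderiv_mult varY_def algebra_simps, simp add: partial_x_def)

lemma partial_x_mult: "partial_x (p * q) = partial_x p * q + p * partial_x q"
proof (induction p)
  case 0
  then show ?case by (simp add: partial_x_def)
next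
  case (pCons a p)
  have "partial_x (pCons a p * q) = partial_x (smult a q) + partial_x (pCons 0 (p * q))"
    by (simp add: partial_x_add)
  also have "\<dots> = partial_x (pCons a p) * q + pCons a p * partial_x q"
    unfolding partial_x_smult partial_x_pCons pCons(2) by (simp add: varY_def algebra_simps)
  finally show ?case .
qed

lemma partial_y_mult: "partial_y (p * q) = partial_y p * q + p * partial_y q"
  by (simp add: partial_y_def pderiv_mult algebra_simps)

lemma partial_cst [simp]: "partial_x (cst c) = 0" "partial_y (cst c) = 0"
  by (simp_all add: partial_x_def partial_y_def map_poly_pCons)

lemma partial_var [simp]:
  "partial_x varX = 1" "partial_x varY = 0" "partial_y varX = 0" "partial_y varY = 1"
  by (simp_all add: partial_x_def partial_y_def map_poly_pCons varX_def varY_def one_pCons pderiv_pCons)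

definition jac :: "'k::field poly poly \<Rightarrow> 'k poly poly \<Rightarrow> 'k poly poly" where
  "jac f h = partial_x f * partial_y h - partial_y f * partial_x h"

lemma jac_derivation: "derivation (jac (f :: 'k::field_char_0 poly poly))"
  by unfold_locales
    (simp_all add: jac_def partial_x_add partial_y_add partial_x_mult partial_y_mult algebra_simps)

lemma jac_cst [simp]: "jac f (cst c) = 0"
  by (simp add: jac_def)

lemma jac_self [simp]: "jac f f = 0"
  by (simp add: jac_def)

lemma jac_varX: "jac f varX = - partial_y f" and jac_varY: "jac f varY = partial_x f"
  by (simp_all add: jac_def)

lemma derivation_chain_rule:
  fixes D :: "'k::field_char_0 poly poly \<Rightarrow> 'k poly poly"
  assumes "derivation D" and D_cst: "\<And>c. D (cst c) = 0"
  shows "D (subst2 p g) = subst2 (partial_x p) g * D (fst g) + subst2 (partial_y p) g * D (snd g)"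
proof -
  interpret derivation D by (rule assms(1))
  show ?thesis
  proof (induction p rule: poly2_induct)
    case (const c)
    show ?case using D_cst[of c] by simp
  next
    case (add p q)
    then show ?case
      by (simp add: subst2_add D_add partial_x_add partial_y_add algebra_simps)
  next
    case (mult p q)
    then show ?case
      by (simp add: subst2_add subst2_mult D_mult partial_x_mult partial_y_mult algebra_simps)
  qed (simp_all add: subst2_varX subst2_varY subst2_1)
qed

lemma is_unit_poly2: "is_unit (p :: 'k::field poly poly) \<longleftrightarrow> (\<exists>c. c \<noteq> 0 \<and> p = cst c)"
  by (auto simp: is_unit_poly_iff is_unit_pCons_iff dvd_field_iff)

text \<open>The Jacobian determinants of an automorphism and of its inverse multiply to \<open>1\<close> by the
  chain rule, and the units of the polynomial ring are the constants.\<close>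

lemma jac_Aut_const:
  fixes g :: "'k::field_char_0 endo"
  assumes "g \<in> carrier Aut_A2"
  shows "\<exists>c. c \<noteq> 0 \<and> jac (fst g) (snd g) = cst c"
proof -
  obtain h where h: "endo_comp h g = (varX, varY)" using assms by (auto simp: carrier_Aut_iff)
  obtain a b where ab: "h = (a, b)" by fastforce
  obtain f e where fe: "g = (f, e)" by fastforce
  have ax: "subst2 a g = varX" and ay: "subst2 b g = varY" using h by (simp_all add: endo_comp_def ab)
  have D: "derivation (partial_x :: 'k poly poly \<Rightarrow> _)" "derivation (partial_y :: 'k poly poly \<Rightarrow> _)"
    by unfold_locales (simp_all add: partial_x_add partial_y_add partial_x_mult partial_y_mult)
  note chain = derivation_chain_rule[OF D(1), of _ g] derivation_chain_rule[OF D(2), of _ g]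
  define ax' where "ax' = subst2 (partial_x a) g"
  define ay' where "ay' = subst2 (partial_y a) g"
  define bx' where "bx' = subst2 (partial_x b) g"
  define by' where "by' = subst2 (partial_y b) g"
  have 1: "ax' * partial_x f + ay' * partial_x e = 1"
    using chain(1)[of a] unfolding ax by (simp add: fe ax'_def ay'_def)
  have 2: "bx' * partial_x f + by' * partial_x e = 0"
    using chain(1)[of b] unfolding ay by (simp add: fe bx'_def by'_def)
  have 3: "ax' * partial_y f + ay' * partial_y e = 0"
    using chain(2)[of a] unfolding ax by (simp add: fe ax'_def ay'_def)
  have 4: "bx' * partial_y f + by' * partial_y e = 1"
    using chain(2)[of b] unfolding ay by (simp add: fe bx'_def by'_def)
  have "(ax' * by' - ay' * bx') * jac f e
     = (ax' * partial_x f + ay' * partial_x e) * (bx' * partial_y f + by' * partial_y e)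
       - (ax' * partial_y f + ay' * partial_y e) * (bx' * partial_x f + by' * partial_x e)"
    by (simp add: jac_def algebra_simps)
  then have "(ax' * by' - ay' * bx') * jac f e = 1" by (simp add: 1 2 3 4)
  then have "is_unit (jac f e)" by (metis dvd_triv_right)
  then show ?thesis by (simp add: is_unit_poly2 fe)
qed

text \<open>In the coordinates \<open>(f, h)\<close> the derivation \<open>jac f\<close> is a multiple of the second partial
  derivative.\<close>

lemma jac_Aut_locally_nilpotent:
  fixes f h :: "'k::field_char_0 poly poly"
  assumes g: "(f, h) \<in> carrier Aut_A2"
  shows "locally_nilpotent_derivation (jac f)"
proof -
  interpret derivation "jac f" by (rule jac_derivation)
  obtain c where c: "jac f h = cst c" using jac_Aut_const[OF g] by auto
  obtain g' where g': "endo_comp g' (f, h) = (varX, varY)" using g by (auto simp: carrier_Aut_iff)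
  have step: "jac f (subst2 P (f, h)) = subst2 (cst c * partial_y P) (f, h)" for P
  proof -
    have "jac f (subst2 P (f, h)) = subst2 (partial_y P) (f, h) * cst c"
      using derivation_chain_rule[OF jac_derivation, of f P "(f, h)"] c by simp
    then show ?thesis by (simp only: subst2_mult subst2_cst mult.commute)
  qed
  have "\<exists>n. (jac f ^^ n) (subst2 P (f, h)) = 0" for P
  proof (induction "degree P" arbitrary: P rule: less_induct)
    case less
    show ?case
    proof (cases "degree P = 0")
      case True
      then have "partial_y P = 0" by (simp add: partial_y_def pderiv_eq_0_iff)
      then show ?thesis using step[of P] by (intro exI[of _ 1]) simp
    next
      case False
      have "degree (cst c * partial_y P) \<le> degree (partial_y P)"
        using degree_mult_le[of "cst c" "partial_y P"] by simp
      also have "\<dots> < degree P" using False by (simp add: partial_y_def degree_pderiv)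
      finally obtain n where "(jac f ^^ n) (subst2 (cst c * partial_y P) (f, h)) = 0"
        using less by blast
      then have "(jac f ^^ Suc n) (subst2 P (f, h)) = 0" by (simp only: iter_Suc step)
      then show ?thesis by blast
    qed
  qed
  moreover have "q = subst2 (subst2 q g') (f, h)" for q
    by (simp add: subst2_subst2 g' subst2_id)
  ultimately have "\<exists>n. (jac f ^^ n) q = 0" for q by metis
  then show ?thesis by unfold_locales
qed

section \<open>Weighted leading forms\<close>

definition weight_le :: "nat \<Rightarrow> nat \<Rightarrow> int \<Rightarrow> 'k::comm_ring_1 poly poly \<Rightarrow> bool" where
  "weight_le a b M p \<longleftrightarrow> (\<forall>i j. cf p i j \<noteq> 0 \<longrightarrow> int (a * i + b * j) \<le> M)"

definition weight_part :: "nat \<Rightarrow> nat \<Rightarrow> int \<Rightarrow> 'k::comm_ring_1 poly poly \<Rightarrow> 'k poly poly" where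
  "weight_part a b M p =
     (\<Sum>(i, j)\<in>{(i, j). cf p i j \<noteq> 0}. if int (a * i + b * j) = M then cst (cf p i j) * varX ^ i * varY ^ j else 0)"

lemma cf_monomial: "cf (cst c * varX ^ i' * varY ^ j') i j = (if (i, j) = (i', j') then c else 0)"
  unfolding mult.assoc cf_cst_mult cf_Xpow_mult cf_Ypow by auto

lemma cf_weight_part: "cf (weight_part a b M p) i j = (if int (a * i + b * j) = M then cf p i j else 0)"
proof -
  let ?T = "{(i, j). cf p i j \<noteq> 0}"
  have "cf (weight_part a b M p) i j
      = (\<Sum>z\<in>?T. if (i, j) = z then (if int (a * i + b * j) = M then cf p i j else 0) else 0)"
    unfolding weight_part_def coeff_sum
  proof (rule sum.cong[OF HOL.refl])
    fix z assume "z \<in> ?T"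
    obtain i' j' where z: "z = (i', j')" by fastforce
    show "cf (case z of (i, j) \<Rightarrow> if int (a * i + b * j) = M then cst (cf p i j) * varX ^ i * varY ^ j else 0) i j
        = (if (i, j) = z then (if int (a * i + b * j) = M then cf p i j else 0) else 0)"
      using cf_monomial[of "cf p i' j'" i' j' j i] unfolding z by auto
  qed
  also have "\<dots> = (if int (a * i + b * j) = M then cf p i j else 0)"
    using finite_support2[of p] by (simp add: sum.delta')
  finally show ?thesis .
qed

lemma weight_part_diff: "weight_part a b M (p - q) = weight_part a b M p - weight_part a b M q"
  by (rule poly2_eqI) (simp add: cf_weight_part)

lemma weight_part_0 [simp]: "weight_part a b M 0 = 0"
  by (rule poly2_eqI) (simp add: cf_weight_part)

lemma weight_le_diff: "weight_le a b M p \<Longrightarrow> weight_le a b M q \<Longrightarrow> weight_le a b M (p - q)"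
  unfolding weight_le_def by (metis coeff_diff diff_zero)

lemma weight_mult:
  assumes p: "weight_le a b M p" and q: "weight_le a b N q"
  shows "weight_le a b (M + N) (p * q)"
    and "weight_part a b (M + N) (p * q) = weight_part a b M p * weight_part a b N q"
proof -
  have le: "int (a * i + b * j) \<le> M + N"
    if "cf p i' j' * cf q (i - i') (j - j') \<noteq> 0" "i' \<le> i" "j' \<le> j" for i j i' j'
  proof -
    have "cf p i' j' \<noteq> 0" "cf q (i - i') (j - j') \<noteq> 0" using that(1) by auto
    then have "int (a * i' + b * j') \<le> M" "int (a * (i - i') + b * (j - j')) \<le> N"
      using p q unfolding weight_le_def by blast+
    moreover have "a * i + b * j = (a * i' + b * j') + (a * (i - i') + b * (j - j'))"
      using that(2,3) by (auto simp: algebra_simps dest!: le_Suc_ex)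
    ultimately show ?thesis by linarith
  qed
  show "weight_le a b (M + N) (p * q)"
    unfolding weight_le_def
  proof (intro allI impI)
    fix i j assume nz: "cf (p * q) i j \<noteq> 0"
    show "int (a * i + b * j) \<le> M + N"
    proof (rule ccontr)
      assume "\<not> ?thesis"
      then have "(\<Sum>a\<le>i. cf p a b * cf q (i - a) (j - b)) = 0" if "b \<le> j" for b
        using le that by (intro sum.neutral) (metis atMost_iff)
      then show False using nz unfolding cf_mult by simp
    qed
  qed
  show "weight_part a b (M + N) (p * q) = weight_part a b M p * weight_part a b N q"
  proof (rule poly2_eqI)
    fix i j
    have termwise: "cf (weight_part a b M p) i' j' * cf (weight_part a b N q) (i - i') (j - j')
        = (if int (a * i + b * j) = M + N then cf p i' j' * cf q (i - i') (j - j') else 0)"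
      if ij: "i' \<le> i" "j' \<le> j" for i' j'
    proof (cases "cf p i' j' = 0 \<or> cf q (i - i') (j - j') = 0")
      case False
      then have "int (a * i' + b * j') \<le> M" "int (a * (i - i') + b * (j - j')) \<le> N"
        using p q unfolding weight_le_def by blast+
      moreover have "a * i + b * j = (a * i' + b * j') + (a * (i - i') + b * (j - j'))"
        using ij by (auto simp: algebra_simps dest!: le_Suc_ex)
      ultimately have "int (a * i + b * j) = M + N \<longleftrightarrow>
          int (a * i' + b * j') = M \<and> int (a * (i - i') + b * (j - j')) = N"
        by linarith
      then show ?thesis by (simp add: cf_weight_part)
    qed (auto simp: cf_weight_part)
    have "cf (weight_part a b M p * weight_part a b N q) i j
        = (\<Sum>j'\<le>j. \<Sum>i'\<le>i. if int (a * i + b * j) = M + N then cf p i' j' * cf q (i - i') (j - j') else 0)"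
      unfolding cf_mult by (intro sum.cong HOL.refl termwise) auto
    also have "\<dots> = cf (weight_part a b (M + N) (p * q)) i j"
      unfolding cf_weight_part cf_mult by simp
    finally show "cf (weight_part a b (M + N) (p * q)) i j = cf (weight_part a b M p * weight_part a b N q) i j"
      by simp
  qed
qed

lemma weight_partial:
  fixes p :: "'k::field_char_0 poly poly"
  assumes "weight_le a b M p"
  shows "weight_le a b (M - int a) (partial_x p)" "weight_le a b (M - int b) (partial_y p)"
    and "weight_part a b (M - int a) (partial_x p) = partial_x (weight_part a b M p)"
    and "weight_part a b (M - int b) (partial_y p) = partial_y (weight_part a b M p)"
proof -
  show "weight_le a b (M - int a) (partial_x p)"
    unfolding weight_le_def
  proof (intro allI impI)
    fix i j assume "cf (partial_x p) i j \<noteq> 0"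
    then have "cf p (Suc i) j \<noteq> 0" by (auto simp: cf_partial_x)
    then have "int (a * Suc i + b * j) \<le> M" using assms unfolding weight_le_def by blast
    then show "int (a * i + b * j) \<le> M - int a" by (simp add: algebra_simps)
  qed
  show "weight_le a b (M - int b) (partial_y p)"
    unfolding weight_le_def
  proof (intro allI impI)
    fix i j assume "cf (partial_y p) i j \<noteq> 0"
    then have "cf p i (Suc j) \<noteq> 0" by (auto simp: cf_partial_y)
    then have "int (a * i + b * Suc j) \<le> M" using assms unfolding weight_le_def by blast
    then show "int (a * i + b * j) \<le> M - int b" by (simp add: algebra_simps)
  qed
  show "weight_part a b (M - int a) (partial_x p) = partial_x (weight_part a b M p)"
    by (rule poly2_eqI) (simp add: cf_weight_part cf_partial_x algebra_simps)
  show "weight_part a b (M - int b) (partial_y p) = partial_y (weight_part a b M p)"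
    by (rule poly2_eqI) (simp add: cf_weight_part cf_partial_y algebra_simps)
qed

lemma weight_jac:
  fixes f q :: "'k::field_char_0 poly poly"
  assumes f: "weight_le a b N f" and q: "weight_le a b M q"
  shows "weight_le a b (M + (N - int a - int b)) (jac f q)"
    and "weight_part a b (M + (N - int a - int b)) (jac f q) = jac (weight_part a b N f) (weight_part a b M q)"
proof -
  note pf = weight_partial[OF f] and pq = weight_partial[OF q]
  note m1 = weight_mult[OF pf(1) pq(2)] and m2 = weight_mult[OF pf(2) pq(1)]
  have e: "N - int a + (M - int b) = M + (N - int a - int b)" "N - int b + (M - int a) = M + (N - int a - int b)"
    by simp_all
  show "weight_le a b (M + (N - int a - int b)) (jac f q)"
    unfolding jac_def using m1(1) m2(1) unfolding e by (rule weight_le_diff)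
  show "weight_part a b (M + (N - int a - int b)) (jac f q) = jac (weight_part a b N f) (weight_part a b M q)"
    unfolding jac_def weight_part_diff using m1(2) m2(2) unfolding e by (simp add: pf pq)
qed

text \<open>If \<open>q\<close> is weighted homogeneous, then \<open>jac f\<^sub>N\<close> applied \<open>n\<close> times to \<open>q\<close>, where \<open>f\<^sub>N\<close> is the
  leading form of \<open>f\<close>, is a homogeneous part of \<open>jac f\<close> applied \<open>n\<close> times to \<open>q\<close>. So the leading
  form inherits local nilpotency.\<close>

lemma leading_form_locally_nilpotent:
  fixes f :: "'k::field_char_0 poly poly"
  assumes f: "weight_le a b N f" and lnd: "locally_nilpotent_derivation (jac f)"
  shows "locally_nilpotent_derivation (jac (weight_part a b N f))"
proof -
  interpret f: locally_nilpotent_derivation "jac f" by (rule lnd)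
  interpret F: derivation "jac (weight_part a b N f)" by (rule jac_derivation)
  have nil: "\<exists>n. (jac (weight_part a b N f) ^^ n) q = 0"
    if q: "weight_le a b M q" "weight_part a b M q = q" for q M
  proof -
    have "weight_le a b (M + int n * (N - int a - int b)) ((jac f ^^ n) q) \<and>
        weight_part a b (M + int n * (N - int a - int b)) ((jac f ^^ n) q)
          = (jac (weight_part a b N f) ^^ n) q" for n
    proof (induction n)
      case (Suc n)
      have e: "M + int n * (N - int a - int b) + (N - int a - int b) = M + int (Suc n) * (N - int a - int b)"
        by (simp add: algebra_simps)
      show ?case using weight_jac[OF f Suc[THEN conjunct1]] Suc[THEN conjunct2] unfolding e by simp
    qed (use q in simp)
    moreover obtain n where "(jac f ^^ n) q = 0" using f.locally_nilpotent by blast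
    ultimately show ?thesis by (metis weight_part_0)
  qed
  have "\<exists>n. (jac (weight_part a b N f) ^^ n) q = 0" for q
  proof (induction q rule: poly2_induct)
    case (const c)
    show ?case by (rule exI[of _ 1]) simp
  next
    case X
    show ?case by (rule nil[of "int a"]) (auto simp: weight_le_def cf_varX cf_weight_part intro!: poly2_eqI split: if_splits)
  next
    case Y
    show ?case by (rule nil[of "int b"]) (auto simp: weight_le_def cf_varY cf_weight_part intro!: poly2_eqI split: if_splits)
  next
    case (add p q)
    then show ?case using F.nilpotent_add by blast
  next
    case (mult p q)
    then show ?case using F.nilpotent_mult by blast
  qed
  then show ?thesis by unfold_locales
qed


section \<open>Homogeneous forms with locally nilpotent Jacobian derivation\<close>

definition homogenization :: "nat \<Rightarrow> 'k::comm_ring_1 poly \<Rightarrow> 'k poly poly \<Rightarrow> 'k poly poly \<Rightarrow> 'k poly poly" where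
  "homogenization n P U V = (\<Sum>l\<le>n. cst (coeff P l) * U ^ l * V ^ (n - l))"

lemma homogenization_linear_factor:
  assumes "degree P \<le> n"
  shows "homogenization (Suc n) ([:- x, 1:] * P) U V = (U - cst x * V) * homogenization n P U V"
proof -
  have 1: "homogenization (Suc n) (pCons 0 P) U V = U * homogenization n P U V"
    unfolding homogenization_def sum.atMost_Suc_shift by (simp add: sum_distrib_left mult_ac del: mult_pCons_left mult_pCons_right)
  have "coeff P (Suc n) = 0" using assms by (simp add: coeff_eq_0)
  then have "homogenization (Suc n) P U V = (\<Sum>l\<le>n. cst (coeff P l) * U ^ l * V ^ (Suc n - l))"
    unfolding homogenization_def by simp
  also have "\<dots> = (\<Sum>l\<le>n. V * (cst (coeff P l) * U ^ l * V ^ (n - l)))"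
    by (intro sum.cong HOL.refl) (simp add: Suc_diff_le mult_ac del: mult_pCons_left mult_pCons_right)
  finally have 2: "homogenization (Suc n) P U V = V * homogenization n P U V"
    by (simp add: homogenization_def sum_distrib_left)
  have "[:- x, 1:] * P = pCons 0 P - smult x P" by simp
  moreover have "homogenization (Suc n) (pCons 0 P - smult x P) U V
      = homogenization (Suc n) (pCons 0 P) U V - cst x * homogenization (Suc n) P U V"
  proof -
    have "cst (coeff (pCons 0 P - smult x P) l) = cst (coeff (pCons 0 P) l) - cst x * cst (coeff P l)" for l
      by simp
    then show ?thesis
      unfolding homogenization_def
      by (simp only: sum_distrib_left sum_subtractf[symmetric] left_diff_distrib mult.assoc)
  qed
  ultimately show ?thesis by (simp only: 1 2) (simp only: left_diff_distrib mult.assoc)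
qed

text \<open>Over an algebraically closed field this factors binary forms into linear ones.\<close>

lemma homogenization_product:
  fixes A :: "'k::field multiset"
  shows "homogenization (size A) (smult c (\<Prod>x\<in>#A. [:- x, 1:])) U V = cst c * (\<Prod>x\<in>#A. U - cst x * V)"
proof (induction A)
  case empty
  show ?case by (simp add: homogenization_def del: mult_pCons_left)
next
  case (add x A)
  have "degree (\<Prod>x\<in>#B. [:- x, 1:]) \<le> size B" for B :: "'k multiset"
  proof (induction B)
    case (add y B)
    then show ?case using degree_mult_le[of "[:- y, 1:]" "\<Prod>x\<in>#B. [:- x, 1:]"]
      by (simp del: mult_pCons_left)
  qed simp
  then have "degree (smult c (\<Prod>x\<in>#A. [:- x, 1:])) \<le> size A"
    by (meson degree_smult_le le_trans)
  from homogenization_linear_factor[OF this, of x U V] add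
  show ?case by (simp add: mult_ac del: mult_pCons_left mult_pCons_right)
qed

text \<open>A weighted homogeneous form factors into powers of \<open>x\<close>, of \<open>y\<close> and of binomials \<open>x\<^sup>q - c y\<^sup>p\<close>. It lies in
  the kernel of its Jacobian derivation, which is factorially closed and does not contain two
  independent elements; so only one kind of factor occurs. For a power of a binomial the degree
  function \<open>\<nu>\<close> of the derivation satisfies \<open>\<nu>(x) = 1 + (p - 1) \<nu>(y)\<close> and \<open>\<nu>(y) = 1 + (q - 1) \<nu>(x)\<close>,
  which is impossible if both exponents exceed \<open>1\<close>.\<close>

theorem locally_nilpotent_homogeneous_form:
  fixes F :: "'k::{alg_closed_field, field_char_0} poly poly"
  assumes pq: "p > 0" "q > 0" "coprime p q"
    and hom: "\<And>i j. cf F i j \<noteq> 0 \<Longrightarrow> p * i + q * j = N" and F: "F \<noteq> 0" and N: "N > 0"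
    and lnd: "locally_nilpotent_derivation (jac F)"
  shows "(\<exists>c s. F = cst c * varX ^ s) \<or> (\<exists>c r. F = cst c * varY ^ r) \<or>
    (\<exists>c a K. c \<noteq> 0 \<and> a \<noteq> 0 \<and> K > 0 \<and> F = cst c * (varX ^ q - cst a * varY ^ p) ^ K \<and> (p = 1 \<or> q = 1))"
proof -
  interpret D: locally_nilpotent_derivation "jac F" by (rule lnd)
  note [simp del] = mult_pCons_left mult_pCons_right
  define U where "U = (varX :: 'k poly poly) ^ q"
  define V where "V = (varY :: 'k poly poly) ^ p"
  have X0: "varX \<noteq> (0 :: 'k poly poly)" and Y0: "varY \<noteq> (0 :: 'k poly poly)"
    by (simp_all add: varX_def varY_def)
  define i0 where "i0 = (LEAST i. \<exists>j. cf F i j \<noteq> 0)"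
  have "\<exists>i j. cf F i j \<noteq> 0" using F poly2_eqI[of F 0] by auto
  then have "\<exists>j. cf F i0 j \<noteq> 0" unfolding i0_def by (rule LeastI_ex)
  then obtain j0 where j0: "cf F i0 j0 \<noteq> 0" ..
  have line: "\<exists>l. i = i0 + q * l \<and> j0 = j + p * l" if ij: "cf F i j \<noteq> 0" for i j
  proof -
    have "i0 \<le> i" unfolding i0_def using ij by (intro Least_le) blast
    have e: "p * i + q * j = p * i0 + q * j0" using hom[OF ij] hom[OF j0] by simp
    then have e': "p * (i - i0) + q * j = q * j0" using \<open>i0 \<le> i\<close> by (simp add: diff_mult_distrib2)
    then have "q dvd p * (i - i0)" by (metis dvd_add_times_triv_right_iff dvd_triv_left mult.commute)
    then have "q dvd i - i0" using pq(3) by (simp add: coprime_commute coprime_dvd_mult_right_iff)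
    then obtain l where l: "i - i0 = q * l" by blast
    then have "q * (p * l + j) = q * j0" using e' by (simp add: algebra_simps)
    then have "j0 = j + p * l" using pq(2) by simp
    then show ?thesis using l \<open>i0 \<le> i\<close> by (intro exI[of _ l]) simp
  qed
  \<comment> \<open>The coefficients along the line of weight \<open>N\<close>, read as a polynomial in one variable.\<close>
  define P where "P = (\<Sum>l\<le>j0 div p. monom (cf F (i0 + q * l) (j0 - p * l)) l)"
  have coeff_P: "coeff P l = (if l \<le> j0 div p then cf F (i0 + q * l) (j0 - p * l) else 0)" for l
    unfolding P_def by (simp add: coeff_sum sum.delta)
  have P0: "coeff P 0 \<noteq> 0" using j0 by (simp add: coeff_P)
  then have "P \<noteq> 0" by auto
  define K where "K = degree P"
  have K: "p * K \<le> j0"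
  proof -
    have "coeff P K \<noteq> 0" using \<open>P \<noteq> 0\<close> by (simp add: K_def)
    then have "K \<le> j0 div p" by (auto simp: coeff_P split: if_splits)
    then show ?thesis using pq(1) by (simp add: less_eq_div_iff_mult_less_eq mult.commute)
  qed
  define r where "r = j0 - p * K"
  have supp: "bij_betw (\<lambda>l. (i0 + q * l, j0 - p * l)) {l. coeff P l \<noteq> 0} {(i, j). cf F i j \<noteq> 0}"
  proof (rule bij_betwI')
    fix l l' show "((i0 + q * l, j0 - p * l) = (i0 + q * l', j0 - p * l')) = (l = l')" using pq by auto
  next
    fix l assume "l \<in> {l. coeff P l \<noteq> 0}"
    then show "(i0 + q * l, j0 - p * l) \<in> {(i, j). cf F i j \<noteq> 0}" by (auto simp: coeff_P split: if_splits)
  next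
    fix z assume "z \<in> {(i, j). cf F i j \<noteq> 0}"
    then obtain i j where z: "z = (i, j)" "cf F i j \<noteq> 0" by auto
    then obtain l where l: "i = i0 + q * l" "j0 = j + p * l" using line by blast
    then have "l \<le> j0 div p" using pq(1) by (simp add: less_eq_div_iff_mult_less_eq mult.commute)
    then have "coeff P l \<noteq> 0" using l z by (simp add: coeff_P)
    then show "\<exists>l\<in>{l. coeff P l \<noteq> 0}. z = (i0 + q * l, j0 - p * l)" using z l by (intro bexI[of _ l]) auto
  qed
  have "F = (\<Sum>l\<in>{l. coeff P l \<noteq> 0}. cst (cf F (i0 + q * l) (j0 - p * l)) * varX ^ (i0 + q * l) * varY ^ (j0 - p * l))"
    by (subst poly2_as_sum[of F], subst sum.reindex_bij_betw[OF supp, symmetric]) simp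
  also have "\<dots> = (\<Sum>l\<in>{l. coeff P l \<noteq> 0}. varX ^ i0 * varY ^ r * (cst (coeff P l) * U ^ l * V ^ (K - l)))"
  proof (rule sum.cong[OF HOL.refl])
    fix l assume l: "l \<in> {l. coeff P l \<noteq> 0}"
    then have "l \<le> K" by (simp add: K_def le_degree)
    then have "j0 - p * l = r + p * (K - l)" using K by (simp add: r_def diff_mult_distrib2)
    moreover have "coeff P l = cf F (i0 + q * l) (j0 - p * l)" using l by (simp add: coeff_P split: if_splits)
    ultimately show "cst (cf F (i0 + q * l) (j0 - p * l)) * varX ^ (i0 + q * l) * varY ^ (j0 - p * l)
        = varX ^ i0 * varY ^ r * (cst (coeff P l) * U ^ l * V ^ (K - l))"
      by (simp add: U_def V_def power_add mult_ac flip: power_mult)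
  qed
  also have "\<dots> = varX ^ i0 * varY ^ r * homogenization K P U V"
    unfolding homogenization_def sum_distrib_left
    by (rule sum.mono_neutral_left) (auto simp: K_def le_degree)
  finally have F1: "F = varX ^ i0 * varY ^ r * homogenization K P U V" .
  obtain A where A: "size A = K" "P = smult (lead_coeff P) (\<Prod>x\<in>#A. [:- x, 1:])"
    using alg_closed_imp_factorization[OF \<open>P \<noteq> 0\<close>] unfolding K_def by auto
  define c where "c = lead_coeff P"
  have A2: "P = smult c (\<Prod>x\<in>#A. [:- x, 1:])" unfolding c_def by (rule A(2))
  have "homogenization K P U V = cst c * (\<Prod>x\<in>#A. U - cst x * V)"
    by (subst A2, subst A(1)[symmetric], rule homogenization_product)
  with F1 have F2: "F = varX ^ i0 * (varY ^ r * (cst c * (\<Prod>x\<in>#A. U - cst x * V)))"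
    by (simp add: mult_ac)
  have nz: "x \<noteq> 0" if "x \<in># A" for x
  proof
    assume "x = 0"
    obtain B where "A = add_mset 0 B" using multi_member_split[OF \<open>x \<in># A\<close>] \<open>x = 0\<close> by blast
    then have "smult c (\<Prod>x\<in>#A. [:- x, 1:]) = smult c ([:0, 1:] * (\<Prod>x\<in>#B. [:- x, 1:]))" by simp
    then have "coeff P 0 = coeff (smult c ([:0, 1:] * (\<Prod>x\<in>#B. [:- x, 1:]))) 0" using A2 by metis
    then have "coeff P 0 = 0" by (simp add: coeff_mult_0)
    then show False using P0 by simp
  qed
  \<comment> \<open>All factors of \<open>F\<close> lie in the kernel of \<open>jac F\<close>, and two independent ones among them would
    force the derivation to vanish.\<close>
  have DF: "jac F F = 0" by simp
  have not_both: "\<not> (jac F varX = 0 \<and> jac F varY = 0)"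
  proof
    assume "jac F varX = 0 \<and> jac F varY = 0"
    then have xy: "partial_y F = 0" "partial_x F = 0" by (simp_all add: jac_varX jac_varY)
    have "cf F i j = 0" if "i > 0 \<or> j > 0" for i j
    proof -
      have "cf F (Suc i') j = 0" for i' j
        using xy(2) cf_partial_x[of F j i'] by (simp del: of_nat_Suc)
      moreover have "cf F i (Suc j') = 0" for i j'
        using xy(1) cf_partial_y[of F j' i] by (simp del: of_nat_Suc)
      ultimately show ?thesis using that by (cases i; cases j) auto
    qed
    then have "i0 = 0" "j0 = 0" using j0 by (metis gr0I)+
    then show False using hom[OF j0] N by simp
  qed
  have ker_X: "jac F varX = 0" if "i0 > 0"
    using D.kernel_factorially_closed(1) DF F F2 X0 that by (metis D.kernel_power)
  have ker2: "jac F (varY ^ r * (cst c * (\<Prod>x\<in>#A. U - cst x * V))) = 0"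
    using D.kernel_factorially_closed(2) DF F F2 by metis
  have nz2: "varY ^ r * (cst c * (\<Prod>x\<in>#A. U - cst x * V)) \<noteq> 0"
    using F F2 by auto
  have ker_Y: "jac F varY = 0" if "r > 0"
    using D.kernel_factorially_closed(1)[OF ker2 nz2] Y0 that by (metis D.kernel_power)
  have ker3: "jac F (cst c * (\<Prod>x\<in>#A. U - cst x * V)) = 0"
    using D.kernel_factorially_closed(2)[OF ker2 nz2] .
  have ker4: "jac F (\<Prod>x\<in>#A. U - cst x * V) = 0"
    using D.kernel_factorially_closed(2)[OF ker3] nz2 by auto
  have ker_A: "jac F (U - cst x * V) = 0" if "x \<in># A" for x
  proof -
    obtain B where "A = add_mset x B" using multi_member_split[OF \<open>x \<in># A\<close>] by blast
    then show ?thesis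
      using ker4 nz2 D.kernel_factorially_closed(1)[of "U - cst x * V" "\<Prod>x\<in>#B. U - cst x * V"] by auto
  qed
  have cst_ker: "jac F (cst x * Q) = 0 \<longleftrightarrow> x = 0 \<or> jac F Q = 0" for x Q
    by (simp add: D.D_mult)
  have UX: "jac F U = 0 \<longleftrightarrow> jac F varX = 0" and VY: "jac F V = 0 \<longleftrightarrow> jac F varY = 0"
  proof -
    have "jac F (Q ^ n) = 0" if "jac F Q = 0" for Q n using that by (cases n) (simp_all add: D.D_power del: power_Suc)
    then show "jac F U = 0 \<longleftrightarrow> jac F varX = 0" "jac F V = 0 \<longleftrightarrow> jac F varY = 0"
      using D.kernel_power[of varX q] D.kernel_power[of varY p] X0 Y0 pq unfolding U_def V_def by blast+
  qed
  have A_XY: "jac F varX \<noteq> 0 \<and> jac F varY \<noteq> 0" if "x \<in># A" for x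
    using ker_A[OF that] not_both nz[OF that] UX VY cst_ker[of x V] unfolding D.D_diff by auto
  show ?thesis
  proof (cases "A = {#}")
    case True
    then have "F = cst c * varX ^ i0 * varY ^ r" using F2 by (simp add: mult_ac)
    moreover have "i0 = 0 \<or> r = 0" using ker_X ker_Y not_both by blast
    ultimately have "F = cst c * varY ^ r \<or> F = cst c * varX ^ i0" by auto
    then show ?thesis by blast
  next
    case False
    then obtain a where a: "a \<in># A" by blast
    have "x = a" if x: "x \<in># A" for x
    proof (rule ccontr)
      assume "x \<noteq> a"
      have "jac F (cst (a - x) * V) = jac F ((U - cst x * V) - (U - cst a * V))"
      proof -
        have "cst (a - x) = cst a - cst x" by simp
        then show ?thesis by (simp only: left_diff_distrib) simp
      qed
      also have "\<dots> = 0" unfolding D.D_diff[of "U - cst x * V"] using ker_A[OF x] ker_A[OF a] by simp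
      finally have "jac F V = 0" using \<open>x \<noteq> a\<close> cst_ker by auto
      then show False using VY A_XY[OF a] by simp
    qed
    then have "A = replicate_mset K a" using A(1)
      by (metis set_mset_subset_singletonD singletonI subsetI)
    moreover have "i0 = 0" "r = 0" using ker_X ker_Y A_XY[OF a] by blast+
    ultimately have F3: "F = cst c * (U - cst a * V) ^ K" using F2 by simp
    have "c \<noteq> 0" using F F2 by auto
    have "a \<noteq> 0" by (rule nz[OF a])
    have "K > 0" using A(1) False by (simp add: nonempty_has_size)
    define W where "W = U - cst a * V"
    have "W \<noteq> 0" using F3 F \<open>K > 0\<close> by (auto simp: W_def)
    have DW: "jac F W = 0" using ker_A[OF a] by (simp add: W_def)
    interpret dx: derivation "partial_x :: 'k poly poly \<Rightarrow> _"
      by unfold_locales (simp_all add: partial_x_add partial_x_mult)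
    interpret dy: derivation "partial_y :: 'k poly poly \<Rightarrow> _"
      by unfold_locales (simp_all add: partial_y_add partial_y_mult)
    obtain K' p' q' where K': "K = Suc K'" "p = Suc p'" "q = Suc q'"
      using \<open>K > 0\<close> pq by (metis Suc_pred')
    define G where "G = cst c * of_nat K * W ^ K'"
    have "G \<noteq> 0" using \<open>c \<noteq> 0\<close> \<open>K > 0\<close> \<open>W \<noteq> 0\<close> by (simp add: G_def)
    have of_nat_ker: "jac F (of_nat n) = 0" for n
      by (induction n) (simp_all add: D.D_add)
    have "jac F (W ^ K') = 0"
      using DW by (induction K') (simp_all add: D.D_mult)
    then have "jac F G = 0"
      unfolding G_def by (simp add: D.D_mult of_nat_ker)
    have "partial_x V = 0" unfolding V_def K' dx.D_power by simp
    have "partial_y U = 0" unfolding U_def K' dy.D_power by simp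
    have "partial_x F = G * partial_x W" "partial_y F = G * partial_y W"
      unfolding F3 G_def W_def[symmetric] K' by (simp_all add: dx.D_mult dx.D_power dy.D_mult dy.D_power mult_ac del: power_Suc of_nat_Suc)
    moreover have "partial_x W = of_nat q * varX ^ q'"
      unfolding W_def dx.D_diff dx.D_mult \<open>partial_x V = 0\<close> unfolding U_def K' dx.D_power by (simp del: power_Suc of_nat_Suc)
    moreover have "partial_y W = - (cst a * of_nat p) * varY ^ p'"
      unfolding W_def dy.D_diff dy.D_mult \<open>partial_y U = 0\<close> unfolding V_def K' dy.D_power by (simp add: mult.assoc del: power_Suc of_nat_Suc)
    ultimately have DX: "jac F varX = (G * cst a * of_nat p) * varY ^ p'" and DY: "jac F varY = (G * of_nat q) * varX ^ q'"
      by (simp_all add: jac_varX jac_varY mult_ac)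
    have "D.nil_degree 0 (G * cst a * of_nat p)" "D.nil_degree 0 (G * of_nat q)"
      using \<open>G \<noteq> 0\<close> \<open>a \<noteq> 0\<close> pq \<open>jac F G = 0\<close> by (simp_all add: D.nil_degree_0 D.D_mult of_nat_ker)
    note G_nil = this
    obtain m where m: "D.nil_degree m varX" using D.nil_degree_ex[OF X0] by blast
    obtain n where n: "D.nil_degree n varY" using D.nil_degree_ex[OF Y0] by blast
    have "D.nil_degree (p' * n) (jac F varX)" "D.nil_degree (q' * m) (jac F varY)"
      unfolding DX DY using D.nil_degree_mult[OF G_nil(1) D.nil_degree_power[OF n]]
        D.nil_degree_mult[OF G_nil(2) D.nil_degree_power[OF m]] by simp_all
    then have mn: "m = Suc (p' * n)" "n = Suc (q' * m)"
      using m n D.nil_degree_unique D.nil_degree_Suc by blast+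
    have "p' = 0 \<or> q' = 0"
    proof (rule ccontr)
      assume "\<not> (p' = 0 \<or> q' = 0)"
      then have "n \<le> p' * n" "m \<le> q' * m" by auto
      then show False using mn by linarith
    qed
    then have "p = 1 \<or> q = 1" using K' by auto
    then show ?thesis using F3 \<open>c \<noteq> 0\<close> \<open>a \<noteq> 0\<close> \<open>K > 0\<close> unfolding U_def V_def by blast
  qed
qed

section \<open>The elementary subgroups\<close>

definition shear_x :: "'k::comm_ring_1 poly \<Rightarrow> 'k endo" where
  "shear_x f = (varX + varY ^ 2 * subst1 f (varY ^ 3), varY)"

definition shear_y :: "'k::comm_ring_1 poly \<Rightarrow> 'k endo" where
  "shear_y f = (varX, varY + varX ^ 2 * subst1 f (varX ^ 3))"

lemma subst1_uminus: "subst1 (- f) P = - subst1 f P"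
  using subst1_add[of f "- f" P] by (simp add: eq_neg_iff_add_eq_0 add.commute)

lemma fst_shear_x_comp: "fst (endo_comp (shear_x f) g) = fst g + snd g ^ 2 * subst1 f (snd g ^ 3)"
  and snd_shear_x_comp: "snd (endo_comp (shear_x f) g) = snd g"
  by (simp_all add: endo_comp_def shear_x_def subst2_simps)

lemma fst_shear_y_comp: "fst (endo_comp (shear_y f) g) = fst g"
  and snd_shear_y_comp: "snd (endo_comp (shear_y f) g) = snd g + fst g ^ 2 * subst1 f (fst g ^ 3)"
  by (simp_all add: endo_comp_def shear_y_def subst2_simps)

lemma shear_x_add: "endo_comp (shear_x f) (shear_x g) = shear_x (f + g)"
  by (rule prod_eqI) (simp_all add: fst_shear_x_comp snd_shear_x_comp,
      simp_all add: shear_x_def subst1_add algebra_simps)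

lemma shear_y_add: "endo_comp (shear_y f) (shear_y g) = shear_y (f + g)"
  by (rule prod_eqI) (simp_all add: fst_shear_y_comp snd_shear_y_comp,
      simp_all add: shear_y_def subst1_add algebra_simps)

lemma shear_0 [simp]: "shear_x 0 = (varX, varY)" "shear_y 0 = (varX, varY)"
  by (simp_all add: shear_x_def shear_y_def)

lemma shear_in_Aut: "shear_x f \<in> carrier Aut_A2" "shear_y f \<in> carrier Aut_A2"
  using carrier_AutI[of "shear_x f" "shear_x (- f)"] carrier_AutI[of "shear_y f" "shear_y (- f)"]
  by (simp_all add: shear_x_add shear_y_add)

lemma inv_shear: "inv\<^bsub>Aut_A2\<^esub> (shear_x f) = shear_x (- f)" "inv\<^bsub>Aut_A2\<^esub> (shear_y f) = shear_y (- f)"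
  by (rule inv_Aut_eqI; simp add: shear_x_add shear_y_add)+

lemma swap_shear: "endo_comp (varY, varX) (endo_comp (shear_x f) (varY, varX)) = shear_y f"
  by (simp add: endo_comp_def shear_x_def shear_y_def subst2_simps)

lemma cf_subst1_Y3: "cf (subst1 f (varY ^ 3)) i j = (if i = 0 \<and> 3 dvd j then coeff f (j div 3) else 0)"
proof (induction f arbitrary: j)
  case (pCons a f)
  have "cf (varY ^ 3 * subst1 f (varY ^ 3)) i j
      = (if j < 3 then 0 else if i = 0 \<and> 3 dvd j - 3 then coeff f ((j - 3) div 3) else 0)"
    by (simp add: cf_Ypow_mult pCons(2))
  moreover have "3 dvd j - 3 \<longleftrightarrow> 3 dvd j" "(j - 3) div 3 = j div 3 - 1" "j div 3 \<noteq> 0" if "\<not> j < 3"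
    using that by presburger+
  moreover have "j = 0" if "3 dvd j" "j < 3" using that by presburger
  ultimately show ?case
    unfolding subst1_pCons coeff_add cf_cst by (auto simp: coeff_pCons split: nat.splits)
qed simp

lemma cf_shear_x:
  "cf (fst (shear_x f)) i j
    = (if (i, j) = (1, 0) then 1 else if i = 0 \<and> j mod 3 = 2 then coeff f (j div 3) else 0)"
proof -
  have "3 dvd j - 2 \<longleftrightarrow> j mod 3 = 2" "j mod 3 = 2 \<longrightarrow> (j - 2) div 3 = j div 3" if "\<not> j < 2"
    using that by presburger+
  moreover have "j mod 3 \<noteq> 2" if "j < 2" using that by presburger
  ultimately show ?thesis
    unfolding shear_x_def fst_conv coeff_add cf_varX cf_Ypow_mult cf_subst1_Y3 by auto
qed

lemma cf_shear_y:
  "cf (snd (shear_y f)) i j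
    = (if (i, j) = (0, 1) then 1 else if j = 0 \<and> i mod 3 = 2 then coeff f (i div 3) else 0)"
proof -
  have "snd (shear_y f) = subst2 (fst (shear_x f)) (varY, varX)"
    by (simp add: shear_x_def shear_y_def subst2_simps)
  then show ?thesis by (simp add: cf_swap cf_shear_x)
qed

lemma shear_inj: "shear_x f = shear_x g \<longleftrightarrow> f = g" "shear_y f = shear_y g \<longleftrightarrow> f = g"
proof -
  have c: "coeff f k = cf (fst (shear_x f)) 0 (3 * k + 2)" "coeff f k = cf (snd (shear_y f)) (3 * k + 2) 0"
    for f :: "'a poly" and k
  proof -
    have "(3 * k + 2) mod 3 = 2" "(3 * k + 2) div 3 = k" by presburger+
    then show "coeff f k = cf (fst (shear_x f)) 0 (3 * k + 2)" "coeff f k = cf (snd (shear_y f)) (3 * k + 2) 0"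
      unfolding cf_shear_x cf_shear_y by simp_all
  qed
  have "f = g" if "shear_x f = shear_x g"
    by (rule poly_eqI) (metis c(1)[of f] c(1)[of g] that)
  moreover have "f = g" if "shear_y f = shear_y g"
    by (rule poly_eqI) (metis c(2)[of f] c(2)[of g] that)
  ultimately show "shear_x f = shear_x g \<longleftrightarrow> f = g" "shear_y f = shear_y g \<longleftrightarrow> f = g" by auto
qed

lemma shear_monom:
  assumes "p mod 3 = 2"
  shows "shear_x (monom a (p div 3)) = (varX + cst a * varY ^ p, varY)"
proof (rule prod_eqI)
  show "fst (shear_x (monom a (p div 3))) = fst (varX + cst a * varY ^ p, varY)"
  proof (rule poly2_eqI)
    fix i j :: nat
    have "j mod 3 = 2 \<and> p div 3 = j div 3 \<longleftrightarrow> j = p" using assms by (metis div_mult_mod_eq)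
    then have "(if i = 0 \<and> j mod 3 = 2 then coeff (monom a (p div 3)) (j div 3) else 0)
        = a * (if i = 0 \<and> j = p then 1 else 0)"
      unfolding coeff_monom by (cases "i = 0"; cases "j = p") simp_all
    moreover have "p \<noteq> 0" using assms by auto
    ultimately show "cf (fst (shear_x (monom a (p div 3)))) i j = cf (fst (varX + cst a * varY ^ p, varY)) i j"
      unfolding cf_shear_x fst_conv coeff_add cf_varX cf_cst_mult cf_Ypow by (cases "(i, j) = (1, 0)") simp_all
  qed
qed (simp add: shear_x_def)


section \<open>Automorphisms commuting with the cube roots of unity\<close>

definition graded :: "nat \<Rightarrow> 'k::comm_ring_1 poly poly \<Rightarrow> bool" where
  "graded r p \<longleftrightarrow> (\<forall>i j. cf p i j \<noteq> 0 \<longrightarrow> (i + 2 * j) mod 3 = r)"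

definition equivariant_Aut :: "'k::comm_ring_1 endo set" where
  "equivariant_Aut = {g \<in> carrier Aut_A2. graded 1 (fst g) \<and> graded 2 (snd g) \<and>
     cf (fst g) 1 0 = 1 \<and> cf (snd g) 0 1 = 1}"

lemma primitive_cube_root:
  obtains \<zeta> :: "'k::{alg_closed_field, field_char_0}" where "\<zeta> ^ 3 = 1" "\<zeta> \<noteq> 1" "\<zeta> ^ 2 \<noteq> 1"
proof -
  have "degree [:1, 1, 1 :: 'k:] > 0" by simp
  then obtain \<zeta> :: 'k where "poly [:1, 1, 1:] \<zeta> = 0" using alg_closed_imp_poly_has_root by blast
  then have z: "1 + \<zeta> + \<zeta> ^ 2 = 0" by (simp add: algebra_simps power2_eq_square)
  have "\<zeta> ^ 3 - 1 = (\<zeta> - 1) * (1 + \<zeta> + \<zeta> ^ 2)" by (simp add: algebra_simps power2_eq_square power3_eq_cube)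
  then have 3: "\<zeta> ^ 3 = 1" using z by simp
  have 1: "\<zeta> \<noteq> 1" using z by auto
  have "\<zeta> ^ 2 \<noteq> 1"
  proof
    assume "\<zeta> ^ 2 = 1"
    then have "\<zeta> = 1" using 3 by (simp add: power3_eq_cube power2_eq_square)
    then show False using 1 by simp
  qed
  then show ?thesis using that 1 3 by blast
qed

lemma power_mod_3: "(\<zeta> :: 'k::comm_ring_1) ^ 3 = 1 \<Longrightarrow> \<zeta> ^ n = \<zeta> ^ (n mod 3)"
  by (metis mult.commute mod_mult_div_eq power_add power_mult power_one mult_1)

text \<open>The group of cube roots of unity is cyclic of order three, so a primitive root detects the weight
  \<open>i + 2 j\<close> of every monomial modulo \<open>3\<close>.\<close>

lemma graded_iff_semi_invariant:
  fixes p :: "'k::{alg_closed_field, field_char_0} poly poly"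
  assumes "r < 3"
  shows "graded r p \<longleftrightarrow> (\<forall>\<zeta>. \<zeta> ^ 3 = 1 \<longrightarrow> subst2 p (scale2 \<zeta> varX, scale2 (\<zeta> ^ 2) varY) = scale2 (\<zeta> ^ r) p)"
    (is "?L \<longleftrightarrow> ?R")
proof
  have cf: "cf (subst2 p (scale2 \<zeta> varX, scale2 (\<zeta> ^ 2) varY)) i j = \<zeta> ^ (i + 2 * j) * cf p i j" for \<zeta> i j
    by (simp add: cf_subst2_scale power_add power_mult)
  {
    assume ?L
    show ?R
    proof (intro allI impI poly2_eqI)
      fix \<zeta> :: 'k and i j assume z: "\<zeta> ^ 3 = 1"
      show "cf (subst2 p (scale2 \<zeta> varX, scale2 (\<zeta> ^ 2) varY)) i j = cf (scale2 (\<zeta> ^ r) p) i j"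
        using \<open>?L\<close> power_mod_3[OF z, of "i + 2 * j"]
        unfolding cf by (cases "cf p i j = 0") (auto simp: scale2_def graded_def)
    qed
  next
    assume ?R
    obtain \<zeta> :: 'k where z: "\<zeta> ^ 3 = 1" "\<zeta> \<noteq> 1" "\<zeta> ^ 2 \<noteq> 1" by (rule primitive_cube_root)
    show ?L
      unfolding graded_def
    proof (intro allI impI)
      fix i j assume nz: "cf p i j \<noteq> 0"
      have "\<zeta> ^ (i + 2 * j) * cf p i j = \<zeta> ^ r * cf p i j"
        using \<open>?R\<close> z(1) cf[of \<zeta> j i] by (auto simp: scale2_def)
      then have e: "\<zeta> ^ ((i + 2 * j) mod 3) = \<zeta> ^ r" using nz power_mod_3[OF z(1), of "i + 2 * j"] by simp
      define m where "m = (i + 2 * j) mod 3"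
      have "m < 3" by (simp add: m_def)
      have "\<zeta> \<noteq> 0" using z(1) by auto
      have "\<zeta> ^ 2 \<noteq> \<zeta>" using \<open>\<zeta> \<noteq> 0\<close> z(2) by (simp add: power2_eq_square)
      moreover have "m = 0 \<or> m = 1 \<or> m = 2" "r = 0 \<or> r = 1 \<or> r = 2" using \<open>m < 3\<close> assms by auto
      ultimately have "m = r" using e z(2,3) unfolding m_def[symmetric] by (elim disjE) auto
      then show "(i + 2 * j) mod 3 = r" by (simp add: m_def)
    qed
  }
qed

lemma scale2_eq: "scale2 c p = cst c * p"
  by (simp add: scale2_def)

lemma cf_00_subst2:
  assumes "cf (fst g) 0 0 = 0" "cf (snd g) 0 0 = 0"
  shows "cf (subst2 p g) 0 0 = cf p 0 0"
  by (induction p rule: poly2_induct)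
    (use assms in \<open>simp_all add: subst2_simps coeff_mult_0 cf_varX cf_varY del: mult_pCons_left\<close>)

lemma linear_part_subst2:
  fixes p :: "'k::field_char_0 poly poly"
  assumes g: "cf (fst g) 0 0 = 0" "cf (snd g) 0 0 = 0"
  shows "cf (subst2 p g) 1 0 = cf p 1 0 * cf (fst g) 1 0 + cf p 0 1 * cf (snd g) 1 0"
    and "cf (subst2 p g) 0 1 = cf p 1 0 * cf (fst g) 0 1 + cf p 0 1 * cf (snd g) 0 1"
proof -
  have D: "derivation (partial_x :: 'k poly poly \<Rightarrow> _)" "derivation (partial_y :: 'k poly poly \<Rightarrow> _)"
    by unfold_locales (simp_all add: partial_x_add partial_y_add partial_x_mult partial_y_mult)
  have x: "cf q 1 0 = cf (partial_x q) 0 0" and y: "cf q 0 1 = cf (partial_y q) 0 0" for q :: "'k poly poly"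
    by (simp_all add: cf_partial_x cf_partial_y)
  show "cf (subst2 p g) 1 0 = cf p 1 0 * cf (fst g) 1 0 + cf p 0 1 * cf (snd g) 1 0"
    and "cf (subst2 p g) 0 1 = cf p 1 0 * cf (fst g) 0 1 + cf p 0 1 * cf (snd g) 0 1"
    unfolding x y derivation_chain_rule[OF D(1) partial_cst(1)] derivation_chain_rule[OF D(2) partial_cst(2)]
    by (simp_all add: coeff_mult_0 cf_00_subst2[OF g])
qed

lemma gradedD: "graded r p \<Longrightarrow> (i + 2 * j) mod 3 \<noteq> r \<Longrightarrow> cf p i j = 0"
  unfolding graded_def by blast

lemma equivariant_Aut_comp:
  fixes g h :: "'k::{alg_closed_field, field_char_0} endo"
  assumes g: "g \<in> equivariant_Aut" and h: "h \<in> equivariant_Aut"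
  shows "endo_comp g h \<in> equivariant_Aut"
proof -
  have gg: "g \<in> carrier Aut_A2" "graded 1 (fst g)" "graded 2 (snd g)" "cf (fst g) 1 0 = 1" "cf (snd g) 0 1 = 1"
    using g by (auto simp: equivariant_Aut_def)
  have hh: "h \<in> carrier Aut_A2" "graded 1 (fst h)" "graded 2 (snd h)" "cf (fst h) 1 0 = 1" "cf (snd h) 0 1 = 1"
    using h by (auto simp: equivariant_Aut_def)
  have zero: "cf (fst h) 0 0 = 0" "cf (snd h) 0 0 = 0" "cf (fst h) 0 1 = 0" "cf (snd h) 1 0 = 0"
    using gradedD[OF hh(2), of 0 0] gradedD[OF hh(3), of 0 0] gradedD[OF hh(2), of 0 1] gradedD[OF hh(3), of 1 0]
    by simp_all
  have "subst2 (subst2 p h) (scale2 \<zeta> varX, scale2 (\<zeta> ^ 2) varY)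
      = scale2 (\<zeta> ^ r) (subst2 p h)" if "graded r p" "r < 3" "\<zeta> ^ 3 = 1" for p r \<zeta>
  proof -
    let ?s = "(scale2 \<zeta> varX, scale2 (\<zeta> ^ 2) varY)"
    have "endo_comp h ?s = (scale2 \<zeta> (fst h), scale2 (\<zeta> ^ 2) (snd h))"
      using hh(2,3) that(3) graded_iff_semi_invariant[of 1 "fst h"] graded_iff_semi_invariant[of 2 "snd h"]
      by (simp add: endo_comp_def)
    also have "\<dots> = endo_comp ?s h" by (simp add: endo_comp_def scale2_eq subst2_simps del: mult_pCons_left)
    finally have "subst2 (subst2 p h) ?s = subst2 (subst2 p ?s) h" by (simp add: subst2_subst2)
    also have "subst2 p ?s = scale2 (\<zeta> ^ r) p"
      using that graded_iff_semi_invariant[of r p] by blast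
    also have "subst2 (scale2 (\<zeta> ^ r) p) h = scale2 (\<zeta> ^ r) (subst2 p h)"
      by (simp add: scale2_eq subst2_simps del: mult_pCons_left)
    finally show ?thesis .
  qed
  then have "graded 1 (subst2 (fst g) h)" "graded 2 (subst2 (snd g) h)"
    using gg graded_iff_semi_invariant[of 1 "subst2 (fst g) h"] graded_iff_semi_invariant[of 2 "subst2 (snd g) h"]
    by auto
  moreover have "endo_comp g h \<in> carrier Aut_A2"
    using Aut.m_closed[OF gg(1) hh(1)] by simp
  moreover have "cf (snd g) 1 0 = 0" "cf (fst g) 0 1 = 0"
    using gradedD[OF gg(3), of 1 0] gradedD[OF gg(2), of 0 1] by simp_all
  ultimately show ?thesis
    using linear_part_subst2[OF zero(1,2)] gg(4,5) hh(4,5) zero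
    by (simp add: equivariant_Aut_def endo_comp_def)
qed

lemma shear_equivariant: "shear_x f \<in> equivariant_Aut" "shear_y f \<in> equivariant_Aut"
proof -
  have "graded 1 (fst (shear_x f))"
    unfolding graded_def
  proof (intro allI impI)
    fix i j assume "cf (fst (shear_x f)) i j \<noteq> 0"
    then have "(i = 1 \<and> j = 0) \<or> (i = 0 \<and> j mod 3 = 2)" by (auto simp: cf_shear_x split: if_splits)
    then show "(i + 2 * j) mod 3 = 1" by (elim disjE conjE; simp; presburger?)
  qed
  moreover have "graded 2 (snd (shear_x f))" "graded 1 (fst (shear_y f))"
    by (auto simp: graded_def shear_x_def shear_y_def cf_varX cf_varY split: if_splits)
  moreover have "graded 2 (snd (shear_y f))"
    unfolding graded_def
  proof (intro allI impI)
    fix i j assume "cf (snd (shear_y f)) i j \<noteq> 0"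
    then have "(i = 0 \<and> j = 1) \<or> (j = 0 \<and> i mod 3 = 2)" by (auto simp: cf_shear_y split: if_splits)
    then show "(i + 2 * j) mod 3 = 2" by (elim disjE conjE; simp)
  qed
  moreover have "cf (fst (shear_x f)) 1 0 = 1" "cf (snd (shear_y f)) 0 1 = 1"
    by (simp_all add: cf_shear_x cf_shear_y)
  moreover have "cf (snd (shear_x f)) 0 1 = 1" "cf (fst (shear_y f)) 1 0 = 1"
    by (simp_all add: shear_x_def shear_y_def cf_varX cf_varY)
  ultimately show "shear_x f \<in> equivariant_Aut" "shear_y f \<in> equivariant_Aut"
    by (simp_all add: equivariant_Aut_def shear_in_Aut)
qed


section \<open>Degree reduction\<close>

lemma cf_binomial:
  assumes "p > 0"
  shows "cf ((varX - cst a * varY ^ p) ^ K) K 0 = 1"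
    and "cf ((varX - cst a * varY ^ p) ^ Suc K) K p = - (a * of_nat (Suc K))"
proof -
  have step: "cf ((varX - cst a * varY ^ p) * P) i j
      = (if i = 0 then 0 else cf P (i - 1) j) - a * (if j < p then 0 else cf P i (j - p))" for P i j
    unfolding left_diff_distrib coeff_diff mult.assoc cf_cst_mult cf_X_mult cf_Ypow_mult ..
  show 1: "cf ((varX - cst a * varY ^ p) ^ K) K 0 = 1" for K
    using assms by (induction K) (simp_all add: cf_1 step del: mult_pCons_left)
  show "cf ((varX - cst a * varY ^ p) ^ Suc K) K p = - (a * of_nat (Suc K))"
  proof (induction K)
    case 0
    show ?case unfolding power_Suc step using assms by (simp add: cf_1)
  next
    case (Suc K)
    let ?W = "varX - cst a * varY ^ p"
    have "cf (?W ^ Suc (Suc K)) (Suc K) p = cf (?W ^ Suc K) K p - a * cf (?W ^ Suc K) (Suc K) 0"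
      unfolding power_Suc[of _ "Suc K"] step by simp
    also have "\<dots> = - (a * of_nat (Suc K)) - a * 1"
      by (simp only: Suc 1)
    also have "\<dots> = - (a * of_nat (Suc (Suc K)))"
      by (simp add: algebra_simps)
    finally show ?case .
  qed
qed

text \<open>Consider the edge of the Newton polygon of a coordinate \<open>f\<close> that starts at its highest
  power of \<open>y\<close>. The form along this edge is a power of \<open>x - a y^p\<close>, and the substitution of
  \<open>x + a y^p\<close> for \<open>x\<close> turns it into a power of \<open>x\<close>.\<close>

lemma steepest_edge_reduction:
  fixes f h :: "'k::{alg_closed_field, field_char_0} poly poly"
  assumes g: "(f, h) \<in> carrier Aut_A2" and n: "n \<ge> 2" and top: "cf f 0 n \<noteq> 0"
    and below: "\<And>i j. cf f i j \<noteq> 0 \<Longrightarrow> i > 0 \<Longrightarrow> i + j < n" "\<And>j. cf f 0 j \<noteq> 0 \<Longrightarrow> j \<le> n"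
  shows "\<exists>p a K. p \<ge> 2 \<and> cf f (Suc K) 0 \<noteq> 0 \<and> cf f K p \<noteq> 0 \<and>
    total_degree (subst2 f (varX + cst a * varY ^ p, varY)) < n"
proof -
  define M where "M = {(i, j). cf f i j \<noteq> 0 \<and> i > 0}"
  have "finite M" unfolding M_def by (rule finite_subset[OF _ finite_support2[of f]]) auto
  have "M \<noteq> {}"
  proof
    assume "M = {}"
    then have "partial_x f = 0" unfolding M_def by (intro poly2_eqI) (auto simp: cf_partial_x)
    then obtain c where "c \<noteq> 0" "- (partial_y f * partial_x h) = cst c"
      using jac_Aut_const[OF g] by (auto simp: jac_def)
    then have "partial_y f dvd cst c" by (metis dvd_minus_iff dvd_triv_left)
    moreover have "is_unit (cst c)" using \<open>c \<noteq> 0\<close> is_unit_poly2 by blast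
    ultimately have "is_unit (partial_y f)" using dvd_unit_imp_unit by blast
    then obtain d where "partial_y f = cst d" using is_unit_poly2 by blast
    then have "cf (partial_y f) 0 (n - 1) = 0" using n cf_cst[of d "n - 1" 0] by simp
    then show False using top n cf_partial_y[of f "n - 1" 0] by (simp del: of_nat_Suc)
  qed
  define slope where "slope = (\<lambda>(i, j). of_nat (n - j) / of_nat i :: rat)"
  have "Min (slope ` M) \<in> slope ` M" using \<open>finite M\<close> \<open>M \<noteq> {}\<close> by simp
  then obtain i0 j0 where ij0: "(i0, j0) \<in> M" "slope (i0, j0) = Min (slope ` M)" by auto
  have min: "slope (i0, j0) \<le> slope (i, j)" if "(i, j) \<in> M" for i j
    using \<open>finite M\<close> that unfolding ij0(2) by (intro Min_le) auto
  have i0: "i0 > 0" "cf f i0 j0 \<noteq> 0" "i0 + j0 < n" using ij0(1) below(1) by (auto simp: M_def)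
  define d where "d = gcd (n - j0) i0"
  define p where "p = (n - j0) div d"
  define q where "q = i0 div d"
  have "d > 0" using i0(1) by (simp add: d_def)
  have pd: "p * d = n - j0" and qd: "q * d = i0" by (simp_all add: p_def q_def d_def)
  have cop: "coprime p q" unfolding p_def q_def d_def using i0(1) by (intro div_gcd_coprime) auto
  have "q > 0" using qd i0(1) by (auto intro: gr0I)
  have "p > q" using pd qd i0(3) \<open>d > 0\<close> by (metis less_diff_conv mult_less_cancel2)
  then have "p > 0" by simp
  have wle: "p * i + q * j \<le> q * n" if "cf f i j \<noteq> 0" for i j
  proof (cases "i = 0")
    case True
    then show ?thesis using below(2)[of j] that by simp
  next
    case False
    then have "(i, j) \<in> M" "j \<le> n" using that below(1)[of j i] by (auto simp: M_def)
    from min[OF this(1)] have "(of_nat (n - j0) :: rat) * of_nat i \<le> of_nat (n - j) * of_nat i0"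
      using False i0(1) by (simp add: slope_def field_simps)
    then have "(n - j0) * i \<le> (n - j) * i0" by (simp only: of_nat_mult[symmetric] of_nat_le_iff)
    then have "d * (p * i) \<le> d * (q * (n - j))" unfolding pd[symmetric] qd[symmetric] by (simp add: mult_ac)
    then have "p * i \<le> q * (n - j)" using \<open>d > 0\<close> by simp
    moreover have "q * j \<le> q * n" using \<open>j \<le> n\<close> by simp
    moreover have "q * (n - j) = q * n - q * j" by (rule diff_mult_distrib2)
    ultimately show ?thesis by linarith
  qed
  have W: "weight_le p q (int (q * n)) f"
    unfolding weight_le_def using wle by (auto simp only: of_nat_le_iff)
  define F where "F = weight_part p q (int (q * n)) f"
  have F_cf: "cf F i j = (if p * i + q * j = q * n then cf f i j else 0)" for i j
    by (simp only: F_def cf_weight_part of_nat_eq_iff)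
  have F_hom: "p * i + q * j = q * n" if "cf F i j \<noteq> 0" for i j
    using that by (simp add: F_cf split: if_splits)
  have F_top: "cf F 0 n \<noteq> 0" using top by (simp add: F_cf)
  have "p * i0 + q * j0 = q * n"
  proof -
    have "d * (p * i0) = d * (q * (n - j0))"
      using pd qd by (metis mult.assoc mult.commute)
    then have "p * i0 = q * (n - j0)" using \<open>d > 0\<close> by simp
    then show ?thesis using i0(3) by (simp add: diff_mult_distrib2)
  qed
  then have F_ij: "cf F i0 j0 \<noteq> 0" using i0(2) by (simp add: F_cf)
  have "F \<noteq> 0" using F_top by auto
  have "q * n > 0" using \<open>q > 0\<close> n by simp
  from locally_nilpotent_homogeneous_form[OF \<open>p > 0\<close> \<open>q > 0\<close> cop F_hom \<open>F \<noteq> 0\<close> this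
      leading_form_locally_nilpotent[OF W jac_Aut_locally_nilpotent[OF g], folded F_def]]
  have "(\<exists>c s. F = cst c * varX ^ s) \<or> (\<exists>c r. F = cst c * varY ^ r) \<or>
    (\<exists>c a K. c \<noteq> 0 \<and> a \<noteq> 0 \<and> K > 0 \<and> F = cst c * (varX ^ q - cst a * varY ^ p) ^ K \<and> (p = 1 \<or> q = 1))"
    by blast
  then obtain c a K where F: "F = cst c * (varX ^ q - cst a * varY ^ p) ^ K"
    and cak: "c \<noteq> 0" "a \<noteq> 0" "K > 0" "p = 1 \<or> q = 1"
  proof (elim disjE exE conjE)
    fix c s assume "F = cst c * varX ^ s"
    then show ?thesis using F_top n by (simp add: cf_cst_mult cf_Xpow del: mult_pCons_left split: if_splits)
  next
    fix c r assume "F = cst c * varY ^ r"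
    then show ?thesis using F_ij i0(1) by (simp add: cf_cst_mult cf_Ypow del: mult_pCons_left split: if_splits)
  qed blast+
  have "q = 1" using cak(4) \<open>p > q\<close> \<open>q > 0\<close> by auto
  then have "p \<ge> 2" using \<open>p > q\<close> by simp
  obtain k where K: "K = Suc k" using cak(3) by (metis Suc_pred')
  have F': "F = cst c * (varX - cst a * varY ^ p) ^ Suc k" using F \<open>q = 1\<close> K by simp
  have F1: "cf F (Suc k) 0 \<noteq> 0"
    unfolding F' cf_cst_mult cf_binomial(1)[OF \<open>p > 0\<close>] using cak by simp
  have F2: "cf F k p \<noteq> 0"
    unfolding F' cf_cst_mult cf_binomial(2)[OF \<open>p > 0\<close>] using cak by (simp del: of_nat_Suc)
  have "p * Suc k = n" using F_hom[OF F1] \<open>q = 1\<close> by simp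
  moreover have "2 * Suc k \<le> p * Suc k" using \<open>p \<ge> 2\<close> by (rule mult_le_mono1)
  ultimately have "2 * Suc k \<le> n" by (simp only:)
  moreover have "Suc k < 2 * Suc k" by simp
  ultimately have "Suc k < n" by (rule less_le_trans[rotated])
  let ?e = "(varX + cst a * varY ^ p, varY)"
  have "subst2 F ?e = cst c * varX ^ Suc k"
    unfolding F' subst2_mult subst2_power subst2_diff subst2_cst subst2_varX subst2_varY by simp
  moreover have "total_degree (cst c * varX ^ Suc k) \<le> n - 1"
    using total_degree_mult[of "cst c" "varX ^ Suc k"] total_degree_power[of "varX :: 'k poly poly" "Suc k"]
      \<open>Suc k < n\<close> by (simp add: total_degree_cst del: mult_pCons_left power_Suc)
  moreover have "total_degree (subst2 (f - F) ?e) \<le> n - 1"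
  proof (rule total_degree_subst2_weighted[where a = p and b = 1])
    have "total_degree (cst a * varY ^ p) \<le> p"
      using total_degree_mult[of "cst a" "varY ^ p"] total_degree_power[of "varY :: 'k poly poly" p]
      by (simp add: total_degree_cst del: mult_pCons_left)
    then show "total_degree (fst ?e) \<le> p"
      using total_degree_add[of varX "cst a * varY ^ p"] \<open>p \<ge> 2\<close> by (simp del: mult_pCons_left)
    fix i j assume "cf (f - F) i j \<noteq> 0"
    then have "cf f i j \<noteq> 0" "p * i + j \<noteq> n"
      using \<open>q = 1\<close> by (auto simp: F_cf split: if_splits)
    then show "p * i + 1 * j \<le> n - 1" using wle[where i = i and j = j] \<open>q = 1\<close> by simp
  qed simp
  moreover have "subst2 f ?e = subst2 F ?e + subst2 (f - F) ?e" by (simp flip: subst2_add)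
  ultimately have "total_degree (subst2 f ?e) \<le> n - 1"
    using total_degree_add[of "subst2 F ?e" "subst2 (f - F) ?e"] by simp
  then have "total_degree (subst2 f ?e) < n" using n by simp
  moreover have "cf f (Suc k) 0 \<noteq> 0" "cf f k p \<noteq> 0"
    using F1 F2 F_cf by (metis, metis)
  ultimately show ?thesis using \<open>p \<ge> 2\<close> by blast
qed

text \<open>The top homogeneous form of the first component is a power of \<open>x\<close> or of \<open>y\<close>. In the second case a
  shear along the steepest edge lowers the degree, and the weights modulo \<open>3\<close> of the monomials on
  this edge force its exponent to be \<open>2\<close> modulo \<open>3\<close>. The first case is symmetric.\<close>

lemma equivariant_degree_reduction:
  fixes g :: "'k::{alg_closed_field, field_char_0} endo"
  assumes g: "g \<in> equivariant_Aut" and n: "total_degree (fst g) \<ge> 2"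
  shows "\<exists>e. e \<in> range shear_x \<union> range shear_y \<and> total_degree (fst (endo_comp g e)) < total_degree (fst g)"
proof -
  obtain f h where fh: "g = (f, h)" by fastforce
  have gA: "(f, h) \<in> carrier Aut_A2" and gr: "graded 1 f" using g by (auto simp: equivariant_Aut_def fh)
  define n where "n = total_degree f"
  have n2: "n \<ge> 2" using n by (simp add: n_def fh)
  have W: "weight_le 1 1 (int n) f" unfolding weight_le_def n_def by (auto dest!: total_degreeD)
  define F where "F = weight_part 1 1 (int n) f"
  obtain i1 j1 where ij1: "cf f i1 j1 \<noteq> 0" "i1 + j1 = n"
    using total_degree_attained[of f] n2 unfolding n_def by auto
  have F_cf: "cf F i j = (if i + j = n then cf f i j else 0)" for i j
    by (simp add: F_def cf_weight_part flip: of_nat_add)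
  have F_hom: "1 * i + 1 * j = n" if "cf F i j \<noteq> 0" for i j using that by (auto simp: F_cf split: if_splits)
  have "F \<noteq> 0" using ij1 F_cf[where i=i1 and j=j1] by auto
  have "n > 0" using n2 by simp
  \<comment> \<open>The torus of cube roots of unity acts on the top form by a character, which excludes powers of
    \<open>x - a y\<close>.\<close>
  have "(\<exists>c. F = cst c * varX ^ n) \<or> (\<exists>c. F = cst c * varY ^ n)"
  proof -
    have "locally_nilpotent_derivation (jac F)"
      unfolding F_def by (rule leading_form_locally_nilpotent[OF W jac_Aut_locally_nilpotent[OF gA]])
    from locally_nilpotent_homogeneous_form[where p = 1 and q = 1 and N = n and F = F, OF zero_less_one zero_less_one coprime_1_left F_hom \<open>F \<noteq> 0\<close> \<open>n > 0\<close> this]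
    have "(\<exists>c s. F = cst c * varX ^ s) \<or> (\<exists>c r. F = cst c * varY ^ r) \<or>
      (\<exists>c a K. c \<noteq> 0 \<and> a \<noteq> 0 \<and> K > 0 \<and> F = cst c * (varX ^ 1 - cst a * varY ^ 1) ^ K)"
      by blast
    then show ?thesis
  proof (elim disjE exE conjE)
    fix c s assume F: "F = cst c * varX ^ s"
    then have "c \<noteq> 0" using \<open>F \<noteq> 0\<close> by auto
    then have "cf F s 0 \<noteq> 0" unfolding F cf_cst_mult cf_Xpow by simp
    then have "s = n" using F_hom[where i = s and j = 0] by simp
    then show ?thesis using F by blast
  next
    fix c r assume F: "F = cst c * varY ^ r"
    then have "c \<noteq> 0" using \<open>F \<noteq> 0\<close> by auto
    then have "cf F 0 r \<noteq> 0" unfolding F cf_cst_mult cf_Ypow by simp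
    then have "r = n" using F_hom[where i = 0 and j = r] by simp
    then show ?thesis using F by blast
  next
    fix c a K assume F: "F = cst c * (varX ^ 1 - cst a * varY ^ 1) ^ K" and cak: "c \<noteq> 0" "a \<noteq> 0" "K > 0"
    obtain k where K: "K = Suc k" using cak(3) by (metis Suc_pred')
    have F': "F = cst c * (varX - cst a * varY ^ 1) ^ Suc k" using F K by simp
    have F1: "cf F (Suc k) 0 \<noteq> 0"
      unfolding F' cf_cst_mult cf_binomial(1)[OF zero_less_one] using cak by simp
    have F2: "cf F k 1 \<noteq> 0"
      unfolding F' cf_cst_mult cf_binomial(2)[OF zero_less_one] using cak by (simp del: of_nat_Suc)
    have "cf f (Suc k) 0 \<noteq> 0" "cf f k 1 \<noteq> 0" using F1 F2 F_cf by (metis, metis)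
    then have "(Suc k + 2 * 0) mod 3 = 1" "(k + 2 * 1) mod 3 = 1" using gr unfolding graded_def by blast+
    then have False by presburger
    then show ?thesis ..
  qed
  qed
  then show ?thesis
  proof (elim disjE exE)
    fix c assume F: "F = cst c * varY ^ n"
    have "c \<noteq> 0" using F \<open>F \<noteq> 0\<close> by auto
    then have top: "cf f 0 n \<noteq> 0" using F_cf[where i=0 and j=n] unfolding F cf_cst_mult cf_Ypow by simp
    have below: "i + j < n" if nz: "cf f i j \<noteq> 0" and "i > 0" for i j
    proof (rule ccontr)
      assume "\<not> i + j < n"
      then have "i + j = n" using total_degreeD[OF nz] unfolding n_def by simp
      moreover have "cf F i j = 0" unfolding F cf_cst_mult cf_Ypow using \<open>i > 0\<close> by simp
      ultimately show False using nz F_cf[where i=i and j=j] by simp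
    qed
    have below0: "cf f 0 j \<noteq> 0 \<Longrightarrow> j \<le> n" for j using total_degreeD[of f j 0] unfolding n_def by simp
    obtain p a K where p: "p \<ge> 2" "cf f (Suc K) 0 \<noteq> 0" "cf f K p \<noteq> 0"
      "total_degree (subst2 f (varX + cst a * varY ^ p, varY)) < n"
      using steepest_edge_reduction[OF gA n2 top below below0] by blast
    have "(Suc K + 2 * 0) mod 3 = 1" "(K + 2 * p) mod 3 = 1" using p(2,3) gr unfolding graded_def by blast+
    then have "p mod 3 = 2" by presburger
    then have "total_degree (fst (endo_comp g (shear_x (monom a (p div 3))))) < total_degree (fst g)"
      using p(4) by (simp add: shear_monom endo_comp_def fh n_def)
    then show ?thesis by blast
  next
    fix c assume F: "F = cst c * varX ^ n"
    have "c \<noteq> 0" using F \<open>F \<noteq> 0\<close> by auto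
    then have top: "cf f n 0 \<noteq> 0" using F_cf[where i=n and j=0] unfolding F cf_cst_mult cf_Xpow by simp
    have below: "i + j < n" if nz: "cf f i j \<noteq> 0" and "j > 0" for i j
    proof (rule ccontr)
      assume "\<not> i + j < n"
      then have "i + j = n" using total_degreeD[OF nz] unfolding n_def by simp
      moreover have "cf F i j = 0" unfolding F cf_cst_mult cf_Xpow using \<open>j > 0\<close> by simp
      ultimately show False using nz F_cf[where i=i and j=j] by simp
    qed
    let ?t = "(varY, varX) :: 'k endo"
    let ?f = "subst2 f ?t"
    have gt: "(?f, subst2 h ?t) \<in> carrier Aut_A2"
      using Aut.m_closed[OF gA swap_in_Aut] by (simp add: endo_comp_def)
    have "\<exists>p a K. p \<ge> 2 \<and> cf ?f (Suc K) 0 \<noteq> 0 \<and> cf ?f K p \<noteq> 0 \<and>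
        total_degree (subst2 ?f (varX + cst a * varY ^ p, varY)) < n"
    proof (rule steepest_edge_reduction[OF gt n2])
      show "cf ?f 0 n \<noteq> 0" using top by (simp add: cf_swap)
      show "i + j < n" if "cf ?f i j \<noteq> 0" "i > 0" for i j
        using below[where i = j and j = i] that by (simp add: cf_swap add.commute)
      show "j \<le> n" if "cf ?f 0 j \<noteq> 0" for j
        using total_degreeD[of f 0 j] that unfolding n_def by (simp add: cf_swap)
    qed
    then obtain p a K where p: "p \<ge> 2" "cf f 0 (Suc K) \<noteq> 0" "cf f p K \<noteq> 0"
      "total_degree (subst2 ?f (varX + cst a * varY ^ p, varY)) < n"
      unfolding cf_swap by blast
    have "(0 + 2 * Suc K) mod 3 = 1" "(p + 2 * K) mod 3 = 1" using p(2,3) gr unfolding graded_def by blast+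
    then have p3: "p mod 3 = 2" by presburger
    define s where "s = monom a (p div 3)"
    have "fst (endo_comp g (shear_y s)) = subst2 f (endo_comp (endo_comp ?t (shear_x s)) ?t)"
      unfolding swap_shear[symmetric] by (simp add: endo_comp_assoc fh endo_comp_def[of "(f, h)"])
    also have "\<dots> = subst2 (subst2 ?f (shear_x s)) ?t" by (simp add: subst2_subst2)
    finally have "total_degree (fst (endo_comp g (shear_y s))) < total_degree (fst g)"
      using p(4) by (simp add: total_degree_swap s_def shear_monom[OF p3] fh n_def)
    then show ?thesis by blast
  qed
qed

text \<open>The first component is \<open>x\<close>, so that constancy of the Jacobian makes the second one linear in \<open>y\<close>.\<close>

lemma equivariant_degree_1:
  fixes g :: "'k::{alg_closed_field, field_char_0} endo"
  assumes g: "g \<in> equivariant_Aut" and n: "total_degree (fst g) \<le> 1"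
  shows "g \<in> range shear_y"
proof -
  obtain f h where fh: "g = (f, h)" by fastforce
  have gA: "(f, h) \<in> carrier Aut_A2" and gr: "graded 1 f" "graded 2 h"
    and lin: "cf f 1 0 = 1" "cf h 0 1 = 1" using g by (auto simp: equivariant_Aut_def fh)
  have "cf f i j = cf varX i j" for i j
  proof (cases "i + j \<le> 1")
    case True
    then consider "i = 0" "j = 0" | "i = 1" "j = 0" | "i = 0" "j = 1" by linarith
    then show ?thesis
      using lin gradedD[OF gr(1), of 0 0] gradedD[OF gr(1), of 0 1] by cases (simp_all add: cf_varX)
  next
    case False
    then show ?thesis using n cf_eq_0_if_degree[of f i j] by (auto simp: fh cf_varX)
  qed
  then have f: "f = varX" by (rule poly2_eqI)
  obtain c where "jac f h = cst c" using jac_Aut_const[OF gA] by auto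
  then have c: "partial_y h = cst c" by (simp add: f jac_def)
  have h: "cf h i j = 0" if "j > 0" "(i, j) \<noteq> (0, 1)" for i j
  proof -
    obtain j' where j: "j = Suc j'" using \<open>j > 0\<close> by (metis Suc_pred')
    then have "cf (partial_y h) i j' = 0" unfolding c cf_cst using that by auto
    then show ?thesis unfolding j cf_partial_y by (simp del: of_nat_Suc)
  qed
  define s where "s = (\<Sum>k\<le>degree (coeff h 0). monom (cf h (3 * k + 2) 0) k)"
  have "k \<le> degree (coeff h 0)" if "cf h (3 * k + 2) 0 \<noteq> 0" for k
    using le_degree[OF that] by simp
  then have s: "coeff s k = cf h (3 * k + 2) 0" for k
    unfolding s_def by (auto simp: coeff_sum)
  have "cf h i j = cf (snd (shear_y s)) i j" for i j
  proof (cases "j = 0 \<and> i mod 3 = 2")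
    case True
    then have "3 * (i div 3) + 2 = i" by presburger
    then show ?thesis using True by (simp add: cf_shear_y s)
  next
    case False
    have "cf h i 0 = 0" if "i mod 3 \<noteq> 2" using gradedD[OF gr(2), of i 0] that by simp
    then show ?thesis using False h[of j i] lin by (cases "j = 0") (auto simp: cf_shear_y)
  qed
  then have "g = shear_y s"
    unfolding fh by (intro prod_eqI poly2_eqI) (simp_all add: f shear_y_def)
  then show ?thesis by blast
qed

text \<open>The analogue of Jung's theorem for the equivariant group: degree reduction of the first component
  by shears ends with the first component \<open>x\<close>.\<close>

theorem equivariant_Aut_generated:
  "(equivariant_Aut :: 'k::{alg_closed_field, field_char_0} endo set) = generate Aut_A2 (range shear_x \<union> range shear_y)"
proof (intro subset_antisym subsetI)
  fix g :: "'k endo" assume "g \<in> equivariant_Aut"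
  then show "g \<in> generate Aut_A2 (range shear_x \<union> range shear_y)"
  proof (induction "total_degree (fst g)" arbitrary: g rule: less_induct)
    case less
    show ?case
    proof (cases "total_degree (fst g) \<ge> 2")
      case True
      obtain e where e: "e \<in> range shear_x \<union> range shear_y"
        "total_degree (fst (endo_comp g e)) < total_degree (fst g)"
        using equivariant_degree_reduction[OF less(2) True] by blast
      have "e \<in> equivariant_Aut" using e(1) shear_equivariant by auto
      then have "endo_comp g e \<in> generate Aut_A2 (range shear_x \<union> range shear_y)"
        using less(1)[OF e(2)] equivariant_Aut_comp[OF less(2)] by blast
      moreover have "inv\<^bsub>Aut_A2\<^esub> e \<in> generate Aut_A2 (range shear_x \<union> range shear_y)"
        using e(1) by (rule generate.inv)
      ultimately have "endo_comp (endo_comp g e) (inv\<^bsub>Aut_A2\<^esub> e) \<in> generate Aut_A2 (range shear_x \<union> range shear_y)"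
        using generate.eng by fastforce
      moreover have "endo_comp e (inv\<^bsub>Aut_A2\<^esub> e) = (varX, varY)"
        using Aut.r_inv[of e] \<open>e \<in> equivariant_Aut\<close> by (auto simp: equivariant_Aut_def)
      ultimately show ?thesis by (simp add: endo_comp_assoc)
    next
      case False
      then have "g \<in> range shear_y" by (intro equivariant_degree_1 less(2)) simp
      then show ?thesis by (intro generate.incl) blast
    qed
  qed
next
  fix g :: "'k endo" assume "g \<in> generate Aut_A2 (range shear_x \<union> range shear_y)"
  then show "g \<in> equivariant_Aut"
  proof (induction rule: generate.induct)
    case one
    show ?case using shear_equivariant(1)[of 0] by simp
  next
    case (inv h)
    then show ?case using shear_equivariant by (auto simp: inv_shear)
  next
    case (eng g h)
    then show ?case using equivariant_Aut_comp by simp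
  qed (use shear_equivariant in auto)
qed

section \<open>Recognizing free groups and free products\<close>

definition word_value :: "('g, 'm) monoid_scheme \<Rightarrow> ('l \<Rightarrow> 'g) \<Rightarrow> 'l list \<Rightarrow> 'g" where
  "word_value G \<phi> w = foldr (\<lambda>l g. \<phi> l \<otimes>\<^bsub>G\<^esub> g) w \<one>\<^bsub>G\<^esub>"

lemma word_value_simps [simp]:
  "word_value G \<phi> [] = \<one>\<^bsub>G\<^esub>" "word_value G \<phi> (l # w) = \<phi> l \<otimes>\<^bsub>G\<^esub> word_value G \<phi> w"
  by (simp_all add: word_value_def)

lemma (in monoid) word_value_closed: "\<phi> ` L \<subseteq> carrier G \<Longrightarrow> w \<in> lists L \<Longrightarrow> word_value G \<phi> w \<in> carrier G"
  by (induction w) auto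

lemma (in monoid) word_value_append:
  assumes "\<phi> ` L \<subseteq> carrier G" "v \<in> lists L" "w \<in> lists L"
  shows "word_value G \<phi> (v @ w) = word_value G \<phi> v \<otimes> word_value G \<phi> w"
  using assms(2)
proof (induction v)
  case Nil
  then show ?case using word_value_closed[OF assms(1,3)] by simp
next
  case (Cons l v)
  then show ?case
    using word_value_closed[OF assms(1,3)] word_value_closed[OF assms(1), of v] assms(1) by (auto simp: m_assoc)
qed

lemma word_congruence_lists: "(v, w) \<in> word_congruence L R \<Longrightarrow> v \<in> lists L \<and> w \<in> lists L"
  by (induction rule: word_congruence.induct) auto

lemma equiv_word_congruence: "equiv (lists L) (word_congruence L R)"
proof (rule equivI)
  show "word_congruence L R \<subseteq> lists L \<times> lists L"
    by (rule subrelI, rule SigmaI) (blast dest: word_congruence_lists)+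
  show "refl_on (lists L) (word_congruence L R)"
    by (rule refl_onI) (rule word_congruence.refl)
  show "Relation.sym (word_congruence L R)" by (rule symI) (rule word_congruence.sym)
  show "Relation.trans (word_congruence L R)" by (rule transI) (rule word_congruence.trans)
qed

lemma (in monoid) word_value_cong:
  assumes letters: "\<phi> ` L \<subseteq> carrier G"
    and rels: "\<And>v w. (v, w) \<in> R \<Longrightarrow> v \<in> lists L \<Longrightarrow> w \<in> lists L \<Longrightarrow> word_value G \<phi> v = word_value G \<phi> w"
    and "(v, w) \<in> word_congruence L R"
  shows "word_value G \<phi> v = word_value G \<phi> w"
  using assms(3)
proof (induction rule: word_congruence.induct)
  case (append v w v' w')
  then show ?case
    using word_value_append[OF letters] word_congruence_lists[OF append(1)] word_congruence_lists[OF append(2)] by simp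
qed (use rels in auto)

text \<open>If every letter has an inverse letter, then every word has an inverse word. So injectivity of the
  induced map can be tested on the kernel, although the presentation is one of monoids.\<close>

lemma presented_monoid_iso:
  assumes "group G" and letters: "\<phi> ` L \<subseteq> carrier G"
    and rels: "\<And>v w. (v, w) \<in> R \<Longrightarrow> v \<in> lists L \<Longrightarrow> w \<in> lists L \<Longrightarrow> word_value G \<phi> v = word_value G \<phi> w"
    and surj: "carrier G \<subseteq> word_value G \<phi> ` lists L"
    and inverse_letter: "\<And>l. l \<in> L \<Longrightarrow>
      \<exists>l'\<in>L. ([l, l'], []) \<in> word_congruence L R \<and> ([l', l], []) \<in> word_congruence L R"
    and kernel: "\<And>w. w \<in> lists L \<Longrightarrow> word_value G \<phi> w = \<one>\<^bsub>G\<^esub> \<Longrightarrow> (w, []) \<in> word_congruence L R"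
  shows "induced_map G \<phi> \<in> iso (presented_monoid L R) G"
proof -
  interpret G: group G by (rule assms(1))
  let ?C = "word_congruence L R" and ?ev = "word_value G \<phi>"
  note app = G.word_value_append[OF letters] and closed = G.word_value_closed[OF letters]
  have ev_cong: "?ev v = ?ev w" if "(v, w) \<in> ?C" for v w
    by (rule G.word_value_cong[OF letters rels that])
  have inverse_word: "\<exists>w'\<in>lists L. (w @ w', []) \<in> ?C \<and> (w' @ w, []) \<in> ?C" if "w \<in> lists L" for w
    using that
  proof (induction w)
    case Nil
    show ?case by (intro bexI[of _ "[]"]) (auto intro: word_congruence.refl)
  next
    case (Cons l w)
    then obtain w' where w': "w' \<in> lists L" "(w @ w', []) \<in> ?C" "(w' @ w, []) \<in> ?C" by auto
    obtain l' where l': "l' \<in> L" "([l, l'], []) \<in> ?C" "([l', l], []) \<in> ?C"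
      using inverse_letter[of l] Cons by auto
    have r: "(x, x) \<in> ?C" if "x \<in> lists L" for x using that by (rule word_congruence.refl)
    have "([l] @ ((w @ w') @ [l']), [l] @ ([] @ [l'])) \<in> ?C"
      by (intro word_congruence.append w'(2) r) (use Cons l' in auto)
    then have 1: "((l # w) @ (w' @ [l']), []) \<in> ?C"
      using word_congruence.trans[OF _ l'(2)] by simp
    have "(w' @ ([l', l] @ w), w' @ ([] @ w)) \<in> ?C"
      by (intro word_congruence.append l'(3) r) (use Cons w' in auto)
    then have 2: "((w' @ [l']) @ (l # w), []) \<in> ?C"
      using word_congruence.trans[OF _ w'(3)] by simp
    show ?case using 1 2 w'(1) l'(1) by (intro bexI[of _ "w' @ [l']"]) auto
  qed
  have injective: "(v, w) \<in> ?C" if v: "v \<in> lists L" and w: "w \<in> lists L" and e: "?ev v = ?ev w" for v w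
  proof -
    obtain w' where w': "w' \<in> lists L" "(w @ w', []) \<in> ?C" "(w' @ w, []) \<in> ?C" using inverse_word[OF w] by blast
    have "?ev (v @ w') = ?ev (w @ w')" using app v w w'(1) e by simp
    also have "\<dots> = \<one>\<^bsub>G\<^esub>" using ev_cong[OF w'(2)] by simp
    finally have "(v @ w', []) \<in> ?C" using v w' by (intro kernel) auto
    then have "((v @ w') @ w, [] @ w) \<in> ?C" by (intro word_congruence.append word_congruence.refl w)
    moreover have "(v @ (w' @ w), v @ []) \<in> ?C" by (intro word_congruence.append word_congruence.refl v w')
    ultimately show ?thesis using word_congruence.trans[OF word_congruence.sym] by fastforce
  qed
  have carrier: "carrier (presented_monoid L R) = (\<lambda>w. ?C `` {w}) ` lists L"
    by (auto simp: presented_monoid_def quotient_def)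
  have induced: "induced_map G \<phi> (?C `` {w}) = ?ev w" if "w \<in> lists L" for w
  proof -
    have "?ev ` (?C `` {w}) = {?ev w}"
      using ev_cong word_congruence.refl[OF that] by (fastforce simp: image_iff)
    then show ?thesis unfolding induced_map_def word_value_def[symmetric] by simp
  qed
  have class_eq: "?C `` {v} = ?C `` {w} \<longleftrightarrow> ?ev v = ?ev w" if "v \<in> lists L" "w \<in> lists L" for v w
    using equiv_class_eq_iff[OF equiv_word_congruence, of v w L R] injective ev_cong that
      eq_equiv_class_iff[OF equiv_word_congruence that, of R] by blast
  have mult: "?C `` {v} \<otimes>\<^bsub>presented_monoid L R\<^esub> ?C `` {w} = ?C `` {v @ w}"
    if v: "v \<in> lists L" and w: "w \<in> lists L" for v w
  proof -
    have "?C `` {v' @ w'} = ?C `` {v @ w}" if "(v, v') \<in> ?C" "(w, w') \<in> ?C" for v' w'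
      using word_congruence.append[OF that] equiv_class_eq[OF equiv_word_congruence] by metis
    then have "(\<Union>v'\<in>?C `` {v}. \<Union>w'\<in>?C `` {w}. ?C `` {v' @ w'}) = (\<Union>v'\<in>?C `` {v}. \<Union>w'\<in>?C `` {w}. ?C `` {v @ w})"
      by (intro SUP_cong HOL.refl) auto
    also have "\<dots> = ?C `` {v @ w}"
      using word_congruence.refl[OF v] word_congruence.refl[OF w] by blast
    finally show ?thesis by (simp add: presented_monoid_def)
  qed
  show ?thesis
    unfolding iso_def
  proof (intro CollectI conjI homI)
    fix A assume "A \<in> carrier (presented_monoid L R)"
    then obtain w where "w \<in> lists L" "A = ?C `` {w}" unfolding carrier by blast
    then show "induced_map G \<phi> A \<in> carrier G" by (simp only: induced closed)
  next
    fix A B assume "A \<in> carrier (presented_monoid L R)" "B \<in> carrier (presented_monoid L R)"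
    then obtain v w where vw: "v \<in> lists L" "w \<in> lists L" "A = ?C `` {v}" "B = ?C `` {w}"
      unfolding carrier by blast
    then have "v @ w \<in> lists L" by simp
    then show "induced_map G \<phi> (A \<otimes>\<^bsub>presented_monoid L R\<^esub> B) = induced_map G \<phi> A \<otimes>\<^bsub>G\<^esub> induced_map G \<phi> B"
      unfolding vw(3,4) mult[OF vw(1,2)] by (simp only: induced vw(1,2) app)
  next
    show "bij_betw (induced_map G \<phi>) (carrier (presented_monoid L R)) (carrier G)"
      unfolding bij_betw_def
    proof (rule conjI[OF inj_onI subset_antisym])
      fix A B assume AB: "A \<in> carrier (presented_monoid L R)" "B \<in> carrier (presented_monoid L R)"
        "induced_map G \<phi> A = induced_map G \<phi> B"
      then obtain v w where vw: "v \<in> lists L" "w \<in> lists L" "A = ?C `` {v}" "B = ?C `` {w}"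
        unfolding carrier by blast
      have "?ev v = ?ev w" using AB(3) by (simp only: vw induced)
      then show "A = B" by (simp only: vw class_eq)
    next
      show "induced_map G \<phi> ` carrier (presented_monoid L R) \<subseteq> carrier G"
        unfolding carrier using induced closed by (simp add: image_subset_iff del: in_lists_conv_set)
      show "carrier G \<subseteq> induced_map G \<phi> ` carrier (presented_monoid L R)"
      proof
        fix g assume "g \<in> carrier G"
        then obtain w where w: "w \<in> lists L" "g = ?ev w" using surj by blast
        then have "g = induced_map G \<phi> (?C `` {w})" by (simp only: induced)
        then show "g \<in> induced_map G \<phi> ` carrier (presented_monoid L R)"
          unfolding carrier using w(1) by blast
      qed
    qed
  qed
qed

abbreviation freely_reduced :: "('i \<times> bool) list \<Rightarrow> bool" where
  "freely_reduced \<equiv> successively (\<lambda>a b. \<not> (fst a = fst b \<and> snd a \<noteq> snd b))"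

text \<open>Cancelling adjacent inverse letters brings every word into reduced form.\<close>

lemma freely_generatedI:
  assumes "group G" and x: "x ` I \<subseteq> carrier G" and gen: "carrier G = generate G (x ` I)"
    and reduced: "\<And>w. w \<in> lists (I \<times> UNIV) \<Longrightarrow> freely_reduced w \<Longrightarrow> w \<noteq> [] \<Longrightarrow>
      word_value G (\<lambda>(i, b). if b then x i else inv\<^bsub>G\<^esub> (x i)) w \<noteq> \<one>\<^bsub>G\<^esub>"
  shows "freely_generated G I x"
proof -
  interpret G: group G by (rule assms(1))
  let ?L = "I \<times> (UNIV :: bool set)" and ?R = "{([(i, b), (i, \<not> b)], []) | i b. i \<in> I}"
  let ?\<phi> = "\<lambda>(i, b). if b then x i else inv\<^bsub>G\<^esub> (x i)"
  let ?C = "word_congruence ?L ?R"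
  have letters: "?\<phi> ` ?L \<subseteq> carrier G" using x by auto
  have rels: "word_value G ?\<phi> v = word_value G ?\<phi> w" if "(v, w) \<in> ?R" for v w
  proof -
    from that obtain i b where ib: "i \<in> I" "v = [(i, b), (i, \<not> b)]" "w = []" by blast
    then have "x i \<in> carrier G" using x by blast
    then show ?thesis unfolding ib by (cases b) simp_all
  qed
  have cancel: "([(i, b), (i, \<not> b)], []) \<in> ?C" if "i \<in> I" for i b
    using that by (intro word_congruence.rel) auto
  have reduce: "\<exists>w'. (w, w') \<in> ?C \<and> freely_reduced w'" if "w \<in> lists ?L" for w
    using that
  proof (induction w)
    case Nil
    show ?case by (intro exI[of _ "[]"]) (auto intro: word_congruence.refl)
  next
    case (Cons l w)
    then obtain w' where w': "(w, w') \<in> ?C" "freely_reduced w'" by auto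
    obtain i b where l: "l = (i, b)" "i \<in> I" using Cons by auto
    have lw: "(l # w, l # w') \<in> ?C"
      using word_congruence.append[OF word_congruence.refl w'(1), of "[l]"] Cons by auto
    show ?case
    proof (cases "\<exists>w''. w' = (i, \<not> b) # w''")
      case True
      then obtain w'' where w'': "w' = (i, \<not> b) # w''" ..
      have "w'' \<in> lists ?L" using word_congruence_lists[OF w'(1)] w'' by auto
      then have "(l # w', w'') \<in> ?C"
        using word_congruence.append[OF cancel[OF l(2), of b] word_congruence.refl, of w''] l w'' by simp
      moreover have "freely_reduced w''" using w'(2) unfolding w'' by (auto simp: successively_Cons)
      ultimately show ?thesis using word_congruence.trans[OF lw] by blast
    next
      case False
      have "freely_reduced (l # w')"
        using w'(2) False l by (cases w') (auto simp: successively_Cons)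
      then show ?thesis using lw by blast
    qed
  qed
  have "induced_map G ?\<phi> \<in> iso (presented_monoid ?L ?R) G"
  proof (rule presented_monoid_iso[OF assms(1) letters])
    show "word_value G ?\<phi> v = word_value G ?\<phi> w" if "(v, w) \<in> ?R" "v \<in> lists ?L" "w \<in> lists ?L" for v w
      using that by (intro rels)
  next
    show "carrier G \<subseteq> word_value G ?\<phi> ` lists ?L"
    proof
      fix g assume "g \<in> carrier G"
      then have "g \<in> generate G (x ` I)" using gen by simp
      then show "g \<in> word_value G ?\<phi> ` lists ?L"
      proof (induction rule: generate.induct)
        case one
        show ?case by (rule image_eqI[of _ _ "[]"]) auto
      next
        case (incl h)
        then obtain i where "i \<in> I" "h = x i" by auto
        then show ?case using x by (intro image_eqI[of _ _ "[(i, True)]"]) auto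
      next
        case (inv h)
        then obtain i where "i \<in> I" "h = x i" by auto
        then show ?case using x by (intro image_eqI[of _ _ "[(i, False)]"]) auto
      next
        case (eng g h)
        then obtain v w where vw: "v \<in> lists ?L" "w \<in> lists ?L" "g = word_value G ?\<phi> v" "h = word_value G ?\<phi> w" by auto
        then show ?case using G.word_value_append[OF letters vw(1,2)] by (intro image_eqI[of _ _ "v @ w"]) auto
      qed
    qed
  next
    fix l assume "l \<in> ?L"
    then obtain i b where l: "l = (i, b)" "i \<in> I" by auto
    then show "\<exists>l'\<in>?L. ([l, l'], []) \<in> ?C \<and> ([l', l], []) \<in> ?C"
      using cancel[of i b] cancel[of i "\<not> b"] by (intro bexI[of _ "(i, \<not> b)"]) auto
  next
    fix w assume w: "w \<in> lists ?L" "word_value G ?\<phi> w = \<one>\<^bsub>G\<^esub>"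
    obtain w' where w': "(w, w') \<in> ?C" "freely_reduced w'" using reduce[OF w(1)] by blast
    have "word_value G ?\<phi> w' = \<one>\<^bsub>G\<^esub>" using G.word_value_cong[OF letters rels w'(1)] w(2) by simp
    moreover have "w' \<in> lists ?L" using word_congruence_lists[OF w'(1)] by blast
    ultimately have "w' = []" using reduced[of w'] w'(2) by blast
    then show "(w, []) \<in> ?C" using w'(1) by simp
  qed
  then show ?thesis unfolding freely_generated_def free_group_def using x by simp
qed

text \<open>The alternating words without trivial letters: the normal forms in a free product.\<close>

definition alternating :: "('g, 'm) monoid_scheme \<Rightarrow> 'g set \<Rightarrow> 'g set \<Rightarrow> ('g + 'g) list \<Rightarrow> bool" where
  "alternating G A B w \<longleftrightarrow> w \<in> lists ((A - {\<one>\<^bsub>G\<^esub>}) <+> (B - {\<one>\<^bsub>G\<^esub>})) \<and>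
     successively (\<lambda>a b. isl a \<noteq> isl b) w"

abbreviation sum_value :: "('g, 'm) monoid_scheme \<Rightarrow> ('g + 'g) list \<Rightarrow> 'g" where
  "sum_value G \<equiv> word_value G (case_sum (\<lambda>a. a) (\<lambda>b. b))"

lemma (in group) sum_value_append:
  assumes "A \<subseteq> carrier G" "B \<subseteq> carrier G" "v \<in> lists (A <+> B)" "w \<in> lists (A <+> B)"
  shows "sum_value G (v @ w) = sum_value G v \<otimes> sum_value G w"
  using assms by (intro word_value_append[of _ "A <+> B"]) auto

lemma (in group) sum_value_closed:
  assumes "A \<subseteq> carrier G" "B \<subseteq> carrier G" "w \<in> lists (A <+> B)"
  shows "sum_value G w \<in> carrier G"
  using assms by (intro word_value_closed[of _ "A <+> B"]) auto

lemma alternating_lists: "alternating G A B w \<Longrightarrow> w \<in> lists (A <+> B)"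
  by (auto simp: alternating_def)

definition free_product_relations :: "('g, 'm) monoid_scheme \<Rightarrow> 'g set \<Rightarrow> 'g set \<Rightarrow> (('g + 'g) list \<times> ('g + 'g) list) set" where
  "free_product_relations G A B =
     {([Inl \<one>\<^bsub>G\<^esub>], []), ([Inr \<one>\<^bsub>G\<^esub>], [])} \<union>
     {([Inl a, Inl b], [Inl (a \<otimes>\<^bsub>G\<^esub> b)]) | a b. a \<in> A \<and> b \<in> A} \<union>
     {([Inr a, Inr b], [Inr (a \<otimes>\<^bsub>G\<^esub> b)]) | a b. a \<in> B \<and> b \<in> B}"

text \<open>Prepending a letter to a normal form, one either extends it or merges the letter with the first
  one, which may then cancel. The length never grows.\<close>

lemma alternating_word_congruent:
  assumes "group G" and A: "subgroup A G" and B: "subgroup B G" and w: "w \<in> lists (A <+> B)"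
  shows "\<exists>w'. (w, w') \<in> word_congruence (A <+> B) (free_product_relations G A B) \<and>
    alternating G A B w' \<and> length w' \<le> length w"
proof -
  interpret G: group G by (rule assms(1))
  interpret A: subgroup A G by (rule A)
  interpret B: subgroup B G by (rule B)
  let ?L = "A <+> B" and ?C = "word_congruence (A <+> B) (free_product_relations G A B)"
  have one: "([Inl \<one>\<^bsub>G\<^esub>], []) \<in> ?C" "([Inr \<one>\<^bsub>G\<^esub>], []) \<in> ?C"
    by (rule word_congruence.rel; force simp: free_product_relations_def)+
  have join: "([Inl a, Inl b], [Inl (a \<otimes>\<^bsub>G\<^esub> b)]) \<in> ?C" if "a \<in> A" "b \<in> A" for a b
    using that by (intro word_congruence.rel) (auto simp: free_product_relations_def)
  have join': "([Inr a, Inr b], [Inr (a \<otimes>\<^bsub>G\<^esub> b)]) \<in> ?C" if "a \<in> B" "b \<in> B" for a b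
    using that by (intro word_congruence.rel) (auto simp: free_product_relations_def)
  show ?thesis
    using w
  proof (induction w)
    case Nil
    show ?case by (intro exI[of _ "[]"]) (auto simp: alternating_def intro: word_congruence.refl)
  next
    case (Cons l w)
    then obtain w' where w': "(w, w') \<in> ?C" "alternating G A B w'" and len: "length w' \<le> length w" by auto
    have w'L: "w' \<in> lists ?L" using word_congruence_lists[OF w'(1)] by blast
    have lw: "(l # w, l # w') \<in> ?C"
      using word_congruence.append[OF word_congruence.refl w'(1), of "[l]"] Cons by auto
    have l: "l \<in> ?L" using Cons by auto
    have ml: "(l # w', w') \<in> ?C" if "l = Inl \<one>\<^bsub>G\<^esub> \<or> l = Inr \<one>\<^bsub>G\<^esub>"
      using that word_congruence.append[OF one(1) word_congruence.refl[OF w'L]]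
        word_congruence.append[OF one(2) word_congruence.refl[OF w'L]] by auto
    consider (trivial) "l = Inl \<one>\<^bsub>G\<^esub> \<or> l = Inr \<one>\<^bsub>G\<^esub>"
      | (new) "l \<noteq> Inl \<one>\<^bsub>G\<^esub>" "l \<noteq> Inr \<one>\<^bsub>G\<^esub>" "w' = [] \<or> isl l \<noteq> isl (hd w')"
      | (merge) l' w'' where "w' = l' # w''" "isl l = isl l'"
      by (cases w') auto
    then show ?case
    proof cases
      case trivial
      then show ?thesis using ml word_congruence.trans[OF lw] w'(2) len by (intro exI[of _ w']) auto
    next
      case new
      then have "alternating G A B (l # w')"
        using w'(2) l by (auto simp: alternating_def successively_Cons)
      then show ?thesis using lw len by (intro exI[of _ "l # w'"]) auto
    next
      case merge
      have l': "l' \<in> ?L" and w''L: "w'' \<in> lists ?L" using w'L merge by auto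
      obtain m where m: "([l, l'], [m]) \<in> ?C" "isl m = isl l'" "m \<in> ?L"
      proof (cases l)
        case (Inl a)
        then obtain b where "l' = Inl b" using merge(2) by (cases l') auto
        then show ?thesis using that[of "Inl (a \<otimes>\<^bsub>G\<^esub> b)"] join[of a b] Inl l l' by auto
      next
        case (Inr a)
        then obtain b where "l' = Inr b" using merge(2) by (cases l') auto
        then show ?thesis using that[of "Inr (a \<otimes>\<^bsub>G\<^esub> b)"] join'[of a b] Inr l l' by auto
      qed
      have "(l # w', m # w'') \<in> ?C"
        using word_congruence.append[OF m(1) word_congruence.refl[OF w''L]] merge by simp
      then have lw': "(l # w, m # w'') \<in> ?C" by (rule word_congruence.trans[OF lw])
      have alt: "alternating G A B w''" using w'(2) merge by (auto simp: alternating_def successively_Cons)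
      show ?thesis
      proof (cases "m = Inl \<one>\<^bsub>G\<^esub> \<or> m = Inr \<one>\<^bsub>G\<^esub>")
        case True
        then have "(m # w'', w'') \<in> ?C"
          using word_congruence.append[OF one(1) word_congruence.refl[OF w''L]]
            word_congruence.append[OF one(2) word_congruence.refl[OF w''L]] by auto
        then show ?thesis using word_congruence.trans[OF lw'] alt len merge by (intro exI[of _ "w''"]) auto
      next
        case False
        have "w'' = [] \<or> isl m \<noteq> isl (hd w'')"
          using w'(2) merge m(2) by (auto simp: alternating_def successively_Cons)
        then have "alternating G A B (m # w'')"
          using False alt m(3) by (auto simp: alternating_def successively_Cons)
        then show ?thesis using lw' len merge by (intro exI[of _ "m # w''"]) auto
      qed
    qed
  qed
qed

lemma sum_value_cong:
  assumes "group G" and A: "subgroup A G" and B: "subgroup B G"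
    and "(v, w) \<in> word_congruence (A <+> B) (free_product_relations G A B)"
  shows "sum_value G v = sum_value G w"
proof -
  interpret G: group G by (rule assms(1))
  interpret A: subgroup A G by (rule A)
  interpret B: subgroup B G by (rule B)
  show ?thesis
    by (rule G.word_value_cong[OF _ _ assms(4)]) (auto simp: free_product_relations_def)
qed

lemma generate_eq_sum_values:
  assumes "group G" and A: "subgroup A G" and B: "subgroup B G"
  shows "generate G (A \<union> B) = sum_value G ` lists (A <+> B)"
proof -
  interpret G: group G by (rule assms(1))
  interpret A: subgroup A G by (rule A)
  interpret B: subgroup B G by (rule B)
  show ?thesis
  proof (intro subset_antisym subsetI)
    fix g assume "g \<in> generate G (A \<union> B)"
    then show "g \<in> sum_value G ` lists (A <+> B)"
    proof (induction rule: generate.induct)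
      case one
      show ?case by (rule image_eqI[of _ _ "[]"]) auto
    next
      case (incl h)
      then show ?case
      proof
        assume "h \<in> A" then show ?case by (intro image_eqI[of _ _ "[Inl h]"]) auto
      next
        assume "h \<in> B" then show ?case by (intro image_eqI[of _ _ "[Inr h]"]) auto
      qed
    next
      case (inv h)
      then show ?case
      proof
        assume "h \<in> A" then show ?case by (intro image_eqI[of _ _ "[Inl (inv\<^bsub>G\<^esub> h)]"]) auto
      next
        assume "h \<in> B" then show ?case by (intro image_eqI[of _ _ "[Inr (inv\<^bsub>G\<^esub> h)]"]) auto
      qed
    next
      case (eng g h)
      then obtain v w where vw: "v \<in> lists (A <+> B)" "w \<in> lists (A <+> B)" "g = sum_value G v" "h = sum_value G w" by auto
      then show ?case using G.sum_value_append[OF A.subset B.subset vw(1,2)] by (intro image_eqI[of _ _ "v @ w"]) auto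
    qed
  next
    fix g assume "g \<in> sum_value G ` lists (A <+> B)"
    then obtain w where w: "w \<in> lists (A <+> B)" "g = sum_value G w" by auto
    have "sum_value G w \<in> generate G (A \<union> B)" using w(1)
      by (induction w) (auto intro!: generate.one generate.eng intro: generate.incl)
    then show "g \<in> generate G (A \<union> B)" using w(2) by simp
  qed
qed
lemma is_free_product_ofI:
  assumes "group G" and A: "subgroup A G" and B: "subgroup B G"
    and gen: "carrier G = generate G (A \<union> B)"
    and nontrivial: "\<And>w. alternating G A B w \<Longrightarrow> w \<noteq> [] \<Longrightarrow> sum_value G w \<noteq> \<one>\<^bsub>G\<^esub>"
  shows "is_free_product_of G A B"
proof -
  interpret G: group G by (rule assms(1))
  interpret A: subgroup A G by (rule A)
  interpret B: subgroup B G by (rule B)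
  let ?L = "A <+> B" and ?\<phi> = "case_sum (\<lambda>a. a) (\<lambda>b. b) :: 'a + 'a \<Rightarrow> 'a"
  let ?R = "free_product_relations G A B"
  let ?C = "word_congruence ?L ?R"
  have letters: "?\<phi> ` ?L \<subseteq> carrier G" by auto
  have one: "([Inl \<one>\<^bsub>G\<^esub>], []) \<in> ?C" "([Inr \<one>\<^bsub>G\<^esub>], []) \<in> ?C"
    by (rule word_congruence.rel; force simp: free_product_relations_def)+
  have join: "([Inl a, Inl b], [Inl (a \<otimes>\<^bsub>G\<^esub> b)]) \<in> ?C" if "a \<in> A" "b \<in> A" for a b
    using that by (intro word_congruence.rel) (auto simp: free_product_relations_def)
  have join': "([Inr a, Inr b], [Inr (a \<otimes>\<^bsub>G\<^esub> b)]) \<in> ?C" if "a \<in> B" "b \<in> B" for a b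
    using that by (intro word_congruence.rel) (auto simp: free_product_relations_def)
  have "induced_map G ?\<phi> \<in> iso (presented_monoid ?L ?R) G"
  proof (rule presented_monoid_iso[OF assms(1) letters])
    show "sum_value G v = sum_value G w" if "(v, w) \<in> ?R" "v \<in> lists ?L" "w \<in> lists ?L" for v w
      using that by (intro sum_value_cong[OF assms(1) A B] word_congruence.rel)
    show "carrier G \<subseteq> sum_value G ` lists ?L"
      using gen generate_eq_sum_values[OF assms(1) A B] by simp
  next
    fix l assume "l \<in> ?L"
    then show "\<exists>l'\<in>?L. ([l, l'], []) \<in> ?C \<and> ([l', l], []) \<in> ?C"
    proof (rule PlusE)
      fix a assume a: "a \<in> A" "l = Inl a"
      then show ?thesis
        using word_congruence.trans[OF join[of a "inv\<^bsub>G\<^esub> a"]] word_congruence.trans[OF join[of "inv\<^bsub>G\<^esub> a" a]] one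
        by (intro bexI[of _ "Inl (inv\<^bsub>G\<^esub> a)"]) auto
    next
      fix a assume a: "a \<in> B" "l = Inr a"
      then show ?thesis
        using word_congruence.trans[OF join'[of a "inv\<^bsub>G\<^esub> a"]] word_congruence.trans[OF join'[of "inv\<^bsub>G\<^esub> a" a]] one
        by (intro bexI[of _ "Inr (inv\<^bsub>G\<^esub> a)"]) auto
    qed
  next
    fix w assume w: "w \<in> lists ?L" "word_value G ?\<phi> w = \<one>\<^bsub>G\<^esub>"
    obtain w' where w': "(w, w') \<in> ?C" "alternating G A B w'" using alternating_word_congruent[OF assms(1) A B w(1)] by blast
    have "sum_value G w' = \<one>\<^bsub>G\<^esub>" using sum_value_cong[OF assms(1) A B w'(1)] w(2) by simp
    then have "w' = []" using nontrivial[OF w'(2)] by blast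
    then show "(w, []) \<in> ?C" using w'(1) by simp
  qed
  then show ?thesis
    unfolding is_free_product_of_def free_product_def using A B by (simp add: free_product_relations_def)
qed

section \<open>Degree growth along words\<close>

text \<open>Restriction of a polynomial to the diagonal. Its degree is easier to follow through
  compositions than the total degree, and it bounds the total degree from below.\<close>

definition diag :: "'k::comm_ring_1 poly poly \<Rightarrow> 'k poly" where
  "diag p = poly p [:0, 1:]"

lemma diag_simps [simp]:
  "diag (p + q) = diag p + diag q" "diag (p * q) = diag p * diag q" "diag (p ^ n) = diag p ^ n"
  "diag varX = [:0, 1:]" "diag varY = [:0, 1:]" "diag (cst c) = [:c:]" "diag 0 = 0"
  by (simp_all add: diag_def varX_def varY_def)

lemma diag_sum: "diag (sum f A) = (\<Sum>a\<in>A. diag (f a))"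
  by (induction A rule: infinite_finite_induct) simp_all

lemma diag_subst1: "diag (subst1 f P) = pcompose f (diag P)"
  by (induction f) (simp_all add: subst1_pCons pcompose_pCons del: mult_pCons_left)

lemma degree_diag_le: "degree (diag (p :: 'k::field poly poly)) \<le> total_degree p"
proof -
  have "diag p = (\<Sum>(i, j)\<in>{(i, j). cf p i j \<noteq> 0}. monom (cf p i j) (i + j))"
    by (subst poly2_as_sum[of p], unfold diag_sum)
      (rule sum.cong[OF HOL.refl], clarify, unfold diag_simps, simp add: monom_altdef power_add)
  also have "degree \<dots> \<le> total_degree p"
  proof (rule degree_sum_le[OF finite_support2], clarify)
    fix i j assume "cf p i j \<noteq> 0"
    then show "degree (monom (cf p i j) (i + j)) \<le> total_degree p"
      using total_degreeD[of p j i] degree_monom_le[of "cf p i j" "i + j"] by simp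
  qed
  finally show ?thesis .
qed

abbreviation deg_fst :: "'k::comm_ring_1 endo \<Rightarrow> nat" where "deg_fst g \<equiv> degree (diag (fst g))"
abbreviation deg_snd :: "'k::comm_ring_1 endo \<Rightarrow> nat" where "deg_snd g \<equiv> degree (diag (snd g))"

lemma degree_shear_growth:
  fixes P Q f :: "'k::field poly"
  assumes "f \<noteq> 0" "degree P \<le> degree Q" "degree Q \<ge> 1"
  shows "2 * degree Q \<le> degree (P + Q ^ 2 * pcompose f (Q ^ 3))"
proof -
  have "Q \<noteq> 0" using assms(3) by auto
  have "degree (pcompose f (Q ^ 3)) = degree f * (3 * degree Q)"
    using \<open>Q \<noteq> 0\<close> by (simp add: degree_pcompose degree_power_eq)
  moreover have "pcompose f (Q ^ 3) \<noteq> 0"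
    using assms \<open>Q \<noteq> 0\<close> by (subst pcompose_eq_0_iff) (auto simp: degree_power_eq)
  ultimately have d: "degree (Q ^ 2 * pcompose f (Q ^ 3)) = 2 * degree Q + degree f * (3 * degree Q)"
    using \<open>Q \<noteq> 0\<close> by (simp add: degree_mult_eq degree_power_eq)
  then have "degree P < degree (Q ^ 2 * pcompose f (Q ^ 3))" using assms(2,3) by linarith
  from degree_add_eq_right[OF this] d show ?thesis by simp
qed

lemma diag_shear:
  "diag (fst (endo_comp (shear_x f) g)) = diag (fst g) + diag (snd g) ^ 2 * pcompose f (diag (snd g) ^ 3)"
  "diag (snd (endo_comp (shear_x f) g)) = diag (snd g)"
  "diag (snd (endo_comp (shear_y f) g)) = diag (snd g) + diag (fst g) ^ 2 * pcompose f (diag (fst g) ^ 3)"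
  "diag (fst (endo_comp (shear_y f) g)) = diag (fst g)"
  by (simp_all add: fst_shear_x_comp snd_shear_x_comp fst_shear_y_comp snd_shear_y_comp diag_subst1)

lemma subgroup_shear_x: "subgroup (range shear_x) (Aut_A2 :: 'k::comm_ring_1 endo monoid)"
proof (rule Aut.subgroupI)
  show "a \<in> range shear_x \<Longrightarrow> inv\<^bsub>Aut_A2\<^esub> a \<in> range shear_x" for a :: "'k endo" by (auto simp: inv_shear)
  show "a \<in> range shear_x \<Longrightarrow> b \<in> range shear_x \<Longrightarrow> a \<otimes>\<^bsub>Aut_A2\<^esub> b \<in> range shear_x" for a b :: "'k endo"
    by (auto simp: shear_x_add)
qed (use shear_in_Aut in auto)

lemma subgroup_shear_y: "subgroup (range shear_y) (Aut_A2 :: 'k::comm_ring_1 endo monoid)"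
proof (rule Aut.subgroupI)
  show "a \<in> range shear_y \<Longrightarrow> inv\<^bsub>Aut_A2\<^esub> a \<in> range shear_y" for a :: "'k endo" by (auto simp: inv_shear)
  show "a \<in> range shear_y \<Longrightarrow> b \<in> range shear_y \<Longrightarrow> a \<otimes>\<^bsub>Aut_A2\<^esub> b \<in> range shear_y" for a b :: "'k endo"
    by (auto simp: shear_y_add)
qed (use shear_in_Aut in auto)

abbreviation shear_word :: "('k::comm_ring_1 endo + 'k endo) list \<Rightarrow> bool" where
  "shear_word \<equiv> alternating Aut_A2 (range shear_x) (range shear_y)"

text \<open>A nontrivial shear at least doubles the larger of the two degrees and stores it in the component
  that was the smaller one, ready for a shear in the other direction.\<close>

lemma shear_word_growth:
  fixes w :: "('k::field endo + 'k endo) list"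
  assumes "shear_word w" "w \<noteq> []"
  shows "if isl (hd w)
    then deg_snd (sum_value Aut_A2 w) \<ge> 1 \<and> deg_snd (sum_value Aut_A2 w) < deg_fst (sum_value Aut_A2 w) \<and>
      2 ^ length w \<le> deg_fst (sum_value Aut_A2 w)
    else deg_fst (sum_value Aut_A2 w) \<ge> 1 \<and> deg_fst (sum_value Aut_A2 w) < deg_snd (sum_value Aut_A2 w) \<and>
      2 ^ length w \<le> deg_snd (sum_value Aut_A2 w)"
  using assms
proof (induction w)
  case (Cons l w)
  have w: "shear_word w" using Cons.prems(1) by (auto simp: alternating_def successively_Cons)
  have alt: "w = [] \<or> isl l \<noteq> isl (hd w)"
    using Cons.prems(1) by (auto simp: alternating_def successively_Cons)
  let ?g = "sum_value Aut_A2 w"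
  show ?case
  proof (cases l)
    case (Inl a)
    then have "a \<in> range shear_x" "a \<noteq> (varX, varY)" using Cons.prems(1) by (auto simp: alternating_def)
    then obtain f where f: "a = shear_x f" "f \<noteq> 0" by force
    have h: "deg_fst ?g \<le> deg_snd ?g \<and> deg_snd ?g \<ge> 1 \<and> 2 ^ length w \<le> deg_snd ?g"
      using Cons.IH[OF w] alt Inl by (cases "w = []") auto
    have "2 * deg_snd ?g \<le> deg_fst (sum_value Aut_A2 (l # w))"
      using degree_shear_growth[OF f(2), of "diag (fst ?g)" "diag (snd ?g)"] h by (simp add: Inl f(1) diag_shear)
    moreover have "deg_snd (sum_value Aut_A2 (l # w)) = deg_snd ?g" by (simp add: Inl f(1) diag_shear)
    ultimately show ?thesis using h Inl by auto
  next
    case (Inr a)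
    then have "a \<in> range shear_y" "a \<noteq> (varX, varY)" using Cons.prems(1) by (auto simp: alternating_def)
    then obtain f where f: "a = shear_y f" "f \<noteq> 0" by force
    have h: "deg_snd ?g \<le> deg_fst ?g \<and> deg_fst ?g \<ge> 1 \<and> 2 ^ length w \<le> deg_fst ?g"
      using Cons.IH[OF w] alt Inr by (cases "w = []") auto
    have "2 * deg_fst ?g \<le> deg_snd (sum_value Aut_A2 (l # w))"
      using degree_shear_growth[OF f(2), of "diag (snd ?g)" "diag (fst ?g)"] h by (simp add: Inr f(1) diag_shear)
    moreover have "deg_fst (sum_value Aut_A2 (l # w)) = deg_fst ?g" by (simp add: Inr f(1) diag_shear)
    ultimately show ?thesis using h Inr by auto
  qed
qed simp

lemma shear_word_nontrivial:
  fixes w :: "('k::field endo + 'k endo) list"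
  assumes "shear_word w" "w \<noteq> []"
  shows "sum_value Aut_A2 w \<noteq> (varX, varY)"
proof
  assume "sum_value Aut_A2 w = (varX, varY)"
  then show False using shear_word_growth[OF assms] by (simp split: if_splits)
qed

lemma shear_word_degree:
  fixes w :: "('k::field endo + 'k endo) list"
  assumes "shear_word w"
  shows "length w < endo_degree (sum_value Aut_A2 w) \<or> w = []"
proof (cases "w = []")
  case False
  have "length w < 2 ^ length w" by (rule less_exp)
  also have "2 ^ length w \<le> max (deg_fst (sum_value Aut_A2 w)) (deg_snd (sum_value Aut_A2 w))"
    using shear_word_growth[OF assms False] by (auto simp: le_max_iff_disj split: if_splits)
  also have "\<dots> \<le> endo_degree (sum_value Aut_A2 w)"
    unfolding endo_degree_def by (intro max.mono degree_diag_le)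
  finally show ?thesis ..
qed simp


section \<open>The free group generated by the two quadratic shears\<close>

definition sign_letter :: "bool \<times> bool \<Rightarrow> 'k::comm_ring_1 endo" where
  "sign_letter l = (if fst l then shear_x else shear_y) [:if snd l then 1 else - 1:]"

text \<open>The leading coefficient counts how often the first letter of the word is repeated, so in
  characteristic zero no cancellation can occur.\<close>

definition leading_power :: "'k::comm_ring_1 \<Rightarrow> nat \<Rightarrow> 'k poly \<Rightarrow> 'k poly \<Rightarrow> bool" where
  "leading_power s n P Q \<longleftrightarrow> degree Q \<ge> 1 \<and> degree P \<le> 2 * degree Q \<and>
     coeff P (2 * degree Q) = s * of_nat n * lead_coeff Q ^ 2"

lemma leading_power_step:
  fixes P Q :: "'k::field poly"
  assumes "leading_power s n P Q"
  shows "leading_power s (Suc n) (P + Q ^ 2 * [:s:]) Q"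
proof -
  have "coeff (Q ^ 2) (2 * degree Q) = lead_coeff Q ^ 2"
    using coeff_mult_degree_sum[of Q Q] by (simp add: power2_eq_square mult_2)
  moreover have "degree (Q ^ 2) \<le> 2 * degree Q" using degree_power_le[of Q 2] by (simp add: mult.commute)
  then have "degree (Q ^ 2 * [:s:]) \<le> 2 * degree Q" using degree_mult_le[of "Q ^ 2" "[:s:]"] by simp
  ultimately show ?thesis
    using assms degree_add_le[of P "2 * degree Q" "Q ^ 2 * [:s:]"] unfolding leading_power_def
    by (simp add: algebra_simps)
qed

lemma free_word_growth:
  fixes w :: "(bool \<times> bool) list"
  assumes "freely_reduced w" "w \<noteq> []"
  defines "g \<equiv> word_value Aut_A2 sign_letter w :: 'k::field_char_0 endo"
  shows "\<exists>n>0. if fst (hd w) then leading_power (if snd (hd w) then 1 else - 1) n (diag (fst g)) (diag (snd g))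
    else leading_power (if snd (hd w) then 1 else - 1) n (diag (snd g)) (diag (fst g))"
  using assms(1,2) unfolding g_def
proof (induction w)
  case (Cons l w)
  obtain b s where l: "l = (b, s)" by fastforce
  define e where "e = (if s then 1 else - 1 :: 'k)"
  have w: "freely_reduced w" using Cons.prems(1) by (auto simp: successively_Cons)
  have adj: "w = [] \<or> fst (hd w) \<noteq> b \<or> hd w = (b, s)"
    using Cons.prems(1) l by (cases w) (auto simp: successively_Cons prod_eq_iff)
  let ?g = "word_value Aut_A2 sign_letter w :: 'k endo"
  let ?P = "diag ((if b then fst else snd) ?g)" and ?Q = "diag ((if b then snd else fst) ?g)"
  have "\<exists>n. leading_power e n ?P ?Q"
  proof (cases "w = []")
    case True
    then show ?thesis by (intro exI[of _ 0]) (auto simp: leading_power_def coeff_pCons split: nat.splits)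
  next
    case False
    obtain n where n: "n > 0" "if fst (hd w) then leading_power (if snd (hd w) then 1 else - 1) n (diag (fst ?g)) (diag (snd ?g))
      else leading_power (if snd (hd w) then 1 else - 1) n (diag (snd ?g)) (diag (fst ?g))"
      using Cons.IH[OF w False] by blast
    show ?thesis
    proof (cases "fst (hd w) = b")
      case True
      then have "hd w = (b, s)" using adj False by auto
      then show ?thesis using n(2) by (intro exI[of _ n]) (simp add: e_def split: if_splits)
    next
      case False
      define t where "t = (if snd (hd w) then 1 else - 1 :: 'k)"
      have lp: "leading_power t n ?Q ?P" using n(2) False by (auto simp: t_def split: if_splits)
      have "?P \<noteq> 0" using lp by (auto simp: leading_power_def)
      then have "coeff ?Q (2 * degree ?P) \<noteq> 0" using lp n(1) by (auto simp: leading_power_def t_def)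
      then have "2 * degree ?P \<le> degree ?Q" by (rule le_degree)
      moreover have "degree ?P \<ge> 1" using lp by (simp add: leading_power_def)
      ultimately have "degree ?P < 2 * degree ?Q" "degree ?Q \<ge> 1" by linarith+
      then show ?thesis by (intro exI[of _ 0]) (simp add: leading_power_def coeff_eq_0)
    qed
  qed
  then obtain n where "leading_power e n ?P ?Q" ..
  from leading_power_step[OF this] have step: "leading_power e (Suc n) (?P + ?Q ^ 2 * [:e:]) ?Q" .
  let ?h = "word_value Aut_A2 sign_letter (l # w) :: 'k endo"
  have "diag ((if b then fst else snd) ?h) = ?P + ?Q ^ 2 * [:e:]" "diag ((if b then snd else fst) ?h) = ?Q"
    unfolding e_def by (auto simp: l sign_letter_def diag_shear)
  with step show ?case by (intro exI[of _ "Suc n"]) (auto simp: l e_def)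
qed simp

lemma free_word_nontrivial:
  assumes "freely_reduced w" "w \<noteq> []"
  shows "word_value Aut_A2 sign_letter w \<noteq> ((varX, varY) :: 'k::field_char_0 endo)"
proof
  assume "word_value Aut_A2 sign_letter w = ((varX, varY) :: 'k endo)"
  then obtain n e where "n > 0" "leading_power e n [:0, 1 :: 'k:] [:0, 1:]" "e \<noteq> 0"
    using free_word_growth[OF assms, where 'k = 'k] by (auto split: if_splits)
  then show False by (auto simp: leading_power_def coeff_pCons split: nat.splits)
qed

lemma shears_freely_generate:
  defines "F \<equiv> generate Aut_A2 {shear_x 1, shear_y 1 :: 'k::field_char_0 endo}"
  shows "freely_generated (Aut_A2\<lparr>carrier := F\<rparr>) UNIV (\<lambda>b. if b then shear_x 1 else shear_y 1)"
proof -
  have sub: "subgroup F Aut_A2"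
    unfolding F_def by (rule Aut.generate_is_subgroup) (use shear_in_Aut in auto)
  have in_F: "shear_x 1 \<in> F" "shear_y 1 \<in> F" unfolding F_def by (auto intro: generate.incl)
  let ?x = "\<lambda>b. if b then shear_x 1 else shear_y 1 :: 'k endo"
  have range: "range ?x = {shear_x 1, shear_y 1}" by (auto simp: image_iff split: if_splits)
  have letters: "(\<lambda>(i, b). if b then ?x i else inv\<^bsub>Aut_A2\<lparr>carrier := F\<rparr>\<^esub> (?x i)) = sign_letter"
    using Aut.m_inv_consistent[OF sub in_F(1)] Aut.m_inv_consistent[OF sub in_F(2)]
    by (auto simp: fun_eq_iff sign_letter_def inv_shear one_pCons)
  show ?thesis
  proof (rule freely_generatedI)
    show "group (Aut_A2\<lparr>carrier := F\<rparr>)" by (rule Aut.subgroup_imp_group[OF sub])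
    show "range ?x \<subseteq> carrier (Aut_A2\<lparr>carrier := F\<rparr>)" using in_F by auto
    show "carrier (Aut_A2\<lparr>carrier := F\<rparr>) = generate (Aut_A2\<lparr>carrier := F\<rparr>) (range ?x)"
      unfolding range using Aut.generate_consistent[OF _ sub, of "{shear_x 1, shear_y 1}"] in_F by (simp add: F_def)
    fix w :: "(bool \<times> bool) list" assume "freely_reduced w" "w \<noteq> []"
    then show "word_value (Aut_A2\<lparr>carrier := F\<rparr>) (\<lambda>(i, b). if b then ?x i else inv\<^bsub>Aut_A2\<lparr>carrier := F\<rparr>\<^esub> (?x i)) w
        \<noteq> \<one>\<^bsub>Aut_A2\<lparr>carrier := F\<rparr>\<^esub>"
      using free_word_nontrivial[of w, where 'k = 'k] unfolding letters by (simp add: word_value_def)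
  qed
qed

text \<open>Powers of the composition of the two shears have unbounded degree, so the powers of its
  comorphism move \<open>x\<close> out of every finite dimensional space.\<close>

lemma not_locally_finite_shear_product:
  "\<not> locally_finite (endo_comp (shear_x 1) (shear_y 1) :: 'k::field endo)"
proof
  let ?g = "endo_comp (shear_x 1) (shear_y 1) :: 'k endo"
  interpret V: vector_space "scale2 :: 'k \<Rightarrow> _" by (rule vector_space_scale2)
  assume "locally_finite ?g"
  then obtain B where B: "finite B" "varX \<in> V.span B" "(\<lambda>q. subst2 q ?g) ` V.span B \<subseteq> V.span B"
    unfolding locally_finite_def by blast
  define N where "N = Max (insert 0 ((\<lambda>b. degree (diag b)) ` B))"
  have "V.span B \<subseteq> {p. degree (diag p) \<le> N}"
  proof (rule V.span_minimal)
    show "B \<subseteq> {p. degree (diag p) \<le> N}" using B(1) by (auto simp: N_def)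
    show "V.subspace {p. degree (diag p) \<le> N}"
      unfolding V.subspace_def by (auto simp: scale2_eq degree_add_le simp del: mult_pCons_left intro: le_trans[OF degree_mult_le])
  qed
  moreover define W :: "nat \<Rightarrow> ('k endo + 'k endo) list" where
    "W n = concat (replicate n [Inl (shear_x 1), Inr (shear_y 1)])" for n
  have val: "sum_value Aut_A2 (W n) = ?g [^]\<^bsub>Aut_A2\<^esub> n" for n
  proof (induction n)
    case (Suc n)
    have "?g \<in> carrier Aut_A2" using Aut.m_closed[OF shear_in_Aut(1) shear_in_Aut(2)] by simp
    from Aut.nat_pow_Suc2[OF this] show ?case using Suc by (simp add: W_def endo_comp_assoc)
  qed (simp add: W_def)
  have "fst (?g [^]\<^bsub>Aut_A2\<^esub> n) \<in> V.span B" for n :: nat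
  proof (induction n)
    case (Suc n)
    then have "subst2 (fst (?g [^]\<^bsub>Aut_A2\<^esub> n)) ?g \<in> V.span B" using B(3) by blast
    then show ?case by (simp add: endo_comp_def[of "?g [^]\<^bsub>Aut_A2\<^esub> n"])
  qed (use B(2) in simp)
  ultimately have bound: "deg_fst (sum_value Aut_A2 (W n)) \<le> N" for n by (auto simp: val)
  have ne: "shear_x 1 \<noteq> ((varX, varY) :: 'k endo)" "shear_y 1 \<noteq> ((varX, varY) :: 'k endo)"
    using shear_inj[of "1 :: 'k poly" 0] by simp_all
  have W: "shear_word (W n) \<and> (n > 0 \<longrightarrow> W n \<noteq> [] \<and> isl (hd (W n))) \<and> length (W n) = 2 * n" for n
  proof (induction n)
    case (Suc n)
    have "W (Suc n) = Inl (shear_x 1) # Inr (shear_y 1) # W n" by (simp add: W_def)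
    moreover have "W n = [] \<or> isl (hd (W n))" using Suc by (cases n) (auto simp: W_def)
    ultimately show ?case using Suc ne by (auto simp: alternating_def successively_Cons)
  qed (simp add: W_def alternating_def)
  have "2 ^ length (W (Suc N)) \<le> deg_fst (sum_value Aut_A2 (W (Suc N)))"
    using shear_word_growth[of "W (Suc N)"] W[of "Suc N"] by simp
  moreover have "length (W (Suc N)) < 2 ^ length (W (Suc N))" by (rule less_exp)
  ultimately show False using bound[of "Suc N"] W[of "Suc N"] by simp
qed

section \<open>Families of polynomials\<close>

text \<open>Polynomials that depend on a parameter through scalars from a given algebra \<open>S\<close> of functions.
  Generating them inductively makes it immediate that substitution preserves families, that their
  coefficients lie in \<open>S\<close>, and that their degrees are bounded. The parameter will be a point of the
  affine line or an element of a group of automorphisms.\<close>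

inductive_set families :: "('t \<Rightarrow> 'k::comm_ring_1) set \<Rightarrow> ('t \<Rightarrow> 'k poly poly) set" for S where
  families_const: "(\<lambda>_. p) \<in> families S"
| families_scalar: "s \<in> S \<Longrightarrow> (\<lambda>t. cst (s t)) \<in> families S"
| families_add: "\<phi> \<in> families S \<Longrightarrow> \<psi> \<in> families S \<Longrightarrow> (\<lambda>t. \<phi> t + \<psi> t) \<in> families S"
| families_mult: "\<phi> \<in> families S \<Longrightarrow> \<psi> \<in> families S \<Longrightarrow> (\<lambda>t. \<phi> t * \<psi> t) \<in> families S"

definition scalar_algebra :: "('t \<Rightarrow> 'k::comm_ring_1) set \<Rightarrow> bool" where
  "scalar_algebra S \<longleftrightarrow> (\<forall>c. (\<lambda>_. c) \<in> S) \<and>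
     (\<forall>s\<in>S. \<forall>s'\<in>S. (\<lambda>t. s t + s' t) \<in> S \<and> (\<lambda>t. s t * s' t) \<in> S)"

lemma scalar_algebraD:
  assumes "scalar_algebra S"
  shows "(\<lambda>_. c) \<in> S" "s \<in> S \<Longrightarrow> s' \<in> S \<Longrightarrow> (\<lambda>t. s t + s' t) \<in> S"
    "s \<in> S \<Longrightarrow> s' \<in> S \<Longrightarrow> (\<lambda>t. s t * s' t) \<in> S"
  using assms by (simp_all add: scalar_algebra_def)

lemma scalar_algebra_sum:
  assumes "scalar_algebra S" "\<And>a. a \<in> A \<Longrightarrow> (\<lambda>t. f a t) \<in> S"
  shows "(\<lambda>t. \<Sum>a\<in>A. f a t) \<in> S"
  using assms(2)
proof (induction A rule: infinite_finite_induct)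
  case (insert a A)
  have "(\<lambda>t. \<Sum>a\<in>A. f a t) \<in> S" by (rule insert(3)) (use insert(4) in blast)
  moreover have "(\<lambda>t. f a t) \<in> S" using insert(4) by blast
  ultimately have "(\<lambda>t. f a t + (\<Sum>a\<in>A. f a t)) \<in> S"
    using assms(1) unfolding scalar_algebra_def by fast
  then show ?case using insert by simp
qed (use assms(1) in \<open>auto simp: scalar_algebra_def\<close>)

lemma families_coeff:
  assumes S: "scalar_algebra S" and "\<phi> \<in> families S"
  shows "(\<lambda>t. cf (\<phi> t) i j) \<in> S"
  using assms(2)
proof (induction arbitrary: i j rule: families.induct)
  case (families_const p)
  then show ?case using S by (auto simp: scalar_algebra_def)
next
  case (families_scalar s)
  then show ?case
  proof (cases "i = 0 \<and> j = 0")
    case False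
    then have "(\<lambda>t. cf (cst (s t)) i j) = (\<lambda>_. 0)" by (auto simp: cf_cst fun_eq_iff)
    then show ?thesis using S by (simp add: scalar_algebra_def)
  qed (use families_scalar in \<open>simp add: cf_cst\<close>)
next
  case (families_add \<phi> \<psi>)
  have "(\<lambda>t. cf (\<phi> t) i j + cf (\<psi> t) i j) \<in> S"
    using S families_add(3)[of j i] families_add(4)[of j i] unfolding scalar_algebra_def by fast
  then show ?case by simp
next
  case (families_mult \<phi> \<psi>)
  have "(\<lambda>t. cf (\<phi> t) a b * cf (\<psi> t) c d) \<in> S" for a b c d
    using S families_mult(3)[of b a] families_mult(4)[of d c] unfolding scalar_algebra_def by fast
  then show ?case unfolding cf_mult by (intro scalar_algebra_sum[OF S])
qed

lemma families_degree: "\<phi> \<in> families S \<Longrightarrow> \<exists>d. \<forall>t. total_degree (\<phi> t) \<le> d"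
proof (induction rule: families.induct)
  case (families_add \<phi> \<psi>)
  then obtain a b where "\<forall>t. total_degree (\<phi> t) \<le> a" "\<forall>t. total_degree (\<psi> t) \<le> b" by blast
  then show ?case
    by (intro exI[of _ "max a b"] allI) (meson le_trans max.mono total_degree_add)
next
  case (families_mult \<phi> \<psi>)
  then obtain a b where "\<forall>t. total_degree (\<phi> t) \<le> a" "\<forall>t. total_degree (\<psi> t) \<le> b" by blast
  then show ?case
    by (intro exI[of _ "a + b"] allI) (meson add_mono le_trans total_degree_mult)
next
  case (families_scalar s)
  show ?case by (intro exI[of _ 0]) (simp add: total_degree_cst)
qed blast

lemma families_sum: "(\<And>a. a \<in> A \<Longrightarrow> f a \<in> families S) \<Longrightarrow> (\<lambda>t. \<Sum>a\<in>A. f a t) \<in> families S"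
proof (induction A rule: infinite_finite_induct)
  case (insert a A)
  then have "(\<lambda>t. f a t + (\<Sum>a\<in>A. f a t)) \<in> families S" by (intro families_add) auto
  then show ?case using insert by simp
qed (simp_all add: families_const)

lemma families_power: "\<phi> \<in> families S \<Longrightarrow> (\<lambda>t. \<phi> t ^ n) \<in> families S"
proof (induction n)
  case 0
  show ?case using families_const[of 1] by simp
next
  case (Suc n)
  then show ?case using families_mult[of \<phi> S "\<lambda>t. \<phi> t ^ n"] by simp
qed

lemma families_subst2:
  assumes "\<phi> \<in> families S" "(\<lambda>t. fst (\<gamma> t)) \<in> families S" "(\<lambda>t. snd (\<gamma> t)) \<in> families S"
  shows "(\<lambda>t. subst2 (\<phi> t) (\<gamma> t)) \<in> families S"
  using assms(1)
proof (induction rule: families.induct)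
  case (families_const p)
  show ?case
  proof (induction p rule: poly2_induct)
    case X
    show ?case using assms(2) by (simp add: subst2_varX)
  next
    case Y
    show ?case using assms(3) by (simp add: subst2_varY)
  next
    case (const c)
    show ?case by (simp add: families.families_const)
  qed (simp_all add: subst2_add subst2_mult families_add families_mult)
qed (simp_all add: subst2_add subst2_mult families_add families_mult families_scalar)

lemma families_comp:
  assumes "(\<lambda>t. fst (\<gamma> t)) \<in> families S" "(\<lambda>t. snd (\<gamma> t)) \<in> families S"
    "(\<lambda>t. fst (\<delta> t)) \<in> families S" "(\<lambda>t. snd (\<delta> t)) \<in> families S"
  shows "(\<lambda>t. fst (endo_comp (\<gamma> t) (\<delta> t))) \<in> families S" "(\<lambda>t. snd (endo_comp (\<gamma> t) (\<delta> t))) \<in> families S"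
  using families_subst2[of "\<lambda>t. fst (\<gamma> t)" S \<delta>] families_subst2[of "\<lambda>t. snd (\<gamma> t)" S \<delta>] assms
  by (simp_all add: endo_comp_def)


section \<open>Closed sets and limits along curves of automorphisms\<close>

definition aut_curve :: "('k::field \<Rightarrow> 'k endo) \<Rightarrow> bool" where
  "aut_curve \<gamma> \<longleftrightarrow> (\<forall>t. \<gamma> t \<in> carrier Aut_A2) \<and>
     (\<lambda>t. fst (\<gamma> t)) \<in> families (range poly) \<and> (\<lambda>t. snd (\<gamma> t)) \<in> families (range poly) \<and>
     (\<lambda>t. fst (inv\<^bsub>Aut_A2\<^esub> \<gamma> t)) \<in> families (range poly) \<and>
     (\<lambda>t. snd (inv\<^bsub>Aut_A2\<^esub> \<gamma> t)) \<in> families (range poly)"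

lemma scalar_algebra_poly: "scalar_algebra (range (poly :: 'k::comm_ring_1 poly \<Rightarrow> 'k \<Rightarrow> 'k))"
  unfolding scalar_algebra_def
proof (intro conjI allI ballI)
  show "(\<lambda>_. c) \<in> range poly" for c :: 'k by (rule image_eqI[of _ _ "[:c:]"]) auto
  fix s s' :: "'k \<Rightarrow> 'k" assume "s \<in> range poly" "s' \<in> range poly"
  then obtain p q where "s = poly p" "s' = poly q" by auto
  then have "(\<lambda>t. s t + s' t) = poly (p + q)" "(\<lambda>t. s t * s' t) = poly (p * q)"
    by (simp_all add: fun_eq_iff)
  then show "(\<lambda>t. s t + s' t) \<in> range poly" "(\<lambda>t. s t * s' t) \<in> range poly" by blast+
qed

lemma families_id: "(\<lambda>t. cst t) \<in> families (range poly)"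
  by (rule families_scalar[where s = "\<lambda>t. t"]) (rule image_eqI[of _ _ "[:0, 1:]"], auto)

lemma aut_curve_const: "g \<in> carrier Aut_A2 \<Longrightarrow> aut_curve (\<lambda>_. g)"
  by (simp add: aut_curve_def families_const)

lemma aut_curve_comp:
  assumes "aut_curve \<gamma>" "aut_curve \<delta>"
  shows "aut_curve (\<lambda>t. endo_comp (\<gamma> t) (\<delta> t))"
proof -
  have c: "\<gamma> t \<in> carrier Aut_A2" "\<delta> t \<in> carrier Aut_A2" for t using assms by (auto simp: aut_curve_def)
  have "endo_comp (\<gamma> t) (\<delta> t) \<in> carrier Aut_A2" for t using Aut.m_closed[OF c] by simp
  moreover have "inv\<^bsub>Aut_A2\<^esub> (endo_comp (\<gamma> t) (\<delta> t)) = endo_comp (inv\<^bsub>Aut_A2\<^esub> \<delta> t) (inv\<^bsub>Aut_A2\<^esub> \<gamma> t)" for t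
    using Aut.inv_mult_group[OF c] by simp
  ultimately show ?thesis
    using assms unfolding aut_curve_def by (simp add: families_comp)
qed

lemma aut_curve_inv: "aut_curve \<gamma> \<Longrightarrow> aut_curve (\<lambda>t. inv\<^bsub>Aut_A2\<^esub> \<gamma> t)"
  unfolding aut_curve_def by (auto simp: Aut.inv_inv)

text \<open>Closing a set under limits along curves stays inside every closed set that contains it.
  In contrast to the closure itself, this operation is visibly compatible with the group law.\<close>

inductive_set curve_closure :: "'k::field endo set \<Rightarrow> 'k endo set" for F where
  base: "g \<in> F \<Longrightarrow> g \<in> curve_closure F"
| limit: "aut_curve \<gamma> \<Longrightarrow> infinite E \<Longrightarrow> (\<And>t. t \<in> E \<Longrightarrow> \<gamma> t \<in> curve_closure F) \<Longrightarrow> \<gamma> t0 \<in> curve_closure F"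

lemma in_strat_Aut_ind:
  "g \<in> strat Aut_ind d \<longleftrightarrow> g \<in> carrier Aut_A2 \<and> endo_degree g \<le> d \<and> endo_degree (inv\<^bsub>Aut_A2\<^esub> g) \<le> d"
  by (simp add: Aut_ind_def)

lemma Union_strat_Aut_ind: "(\<Union>d. strat Aut_ind d) = carrier Aut_A2"
  by (auto simp: in_strat_Aut_ind) (meson max.cobounded1 max.cobounded2)

text \<open>Along a curve every regular function is a polynomial in the parameter, so if it vanishes
  infinitely often, then it vanishes identically.\<close>

lemma curve_closure_subset_closed:
  assumes C: "closedin (ind_topology Aut_ind) C" and F: "F \<subseteq> C"
  shows "curve_closure F \<subseteq> C"
proof
  fix g assume "g \<in> curve_closure F"
  then show "g \<in> C"
  proof (induction rule: curve_closure.induct)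
    case (limit \<gamma> E t0)
    have fam: "(\<lambda>t. fst (\<gamma> t)) \<in> families (range poly)" "(\<lambda>t. snd (\<gamma> t)) \<in> families (range poly)"
      "(\<lambda>t. fst (inv\<^bsub>Aut_A2\<^esub> \<gamma> t)) \<in> families (range poly)" "(\<lambda>t. snd (inv\<^bsub>Aut_A2\<^esub> \<gamma> t)) \<in> families (range poly)"
      and \<gamma>: "\<And>t. \<gamma> t \<in> carrier Aut_A2"
      using limit(1) by (auto simp: aut_curve_def)
    obtain d1 d2 d3 d4 where d: "\<And>t. total_degree (fst (\<gamma> t)) \<le> d1" "\<And>t. total_degree (snd (\<gamma> t)) \<le> d2"
      "\<And>t. total_degree (fst (inv\<^bsub>Aut_A2\<^esub> \<gamma> t)) \<le> d3" "\<And>t. total_degree (snd (inv\<^bsub>Aut_A2\<^esub> \<gamma> t)) \<le> d4"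
      using fam[THEN families_degree] by blast
    define D where "D = max (max d1 d2) (max d3 d4)"
    have strat: "\<gamma> t \<in> strat Aut_ind D" for t
      using \<gamma>[of t] d[of t] by (auto simp: in_strat_Aut_ind endo_degree_def D_def le_max_iff_disj)
    have "zariski_closed Aut_ind D (C \<inter> strat Aut_ind D)"
      using C unfolding closedin_ind_topology by (rule conjunct2[THEN spec])
    then obtain P where P: "P \<subseteq> regular_functions Aut_ind"
      "C \<inter> strat Aut_ind D = {x \<in> strat Aut_ind D. \<forall>f\<in>P. f x = 0}"
      unfolding zariski_closed_def by blast
    have reg: "(\<lambda>t. f (\<gamma> t)) \<in> range poly" if "f \<in> regular_functions Aut_ind" for f
      using that
    proof (induction rule: regular_functions.induct)
      case (coord f)
      then obtain i j where "f = (\<lambda>g. cf (fst g) i j) \<or> f = (\<lambda>g. cf (snd g) i j) \<or>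
          f = (\<lambda>g. cf (fst (inv\<^bsub>Aut_A2\<^esub> g)) i j) \<or> f = (\<lambda>g. cf (snd (inv\<^bsub>Aut_A2\<^esub> g)) i j)"
        by (auto simp: Aut_ind_def)
      then show ?case using fam[THEN families_coeff[OF scalar_algebra_poly]] by auto
    qed (rule scalar_algebraD[OF scalar_algebra_poly]; assumption?)+
    have "f (\<gamma> t0) = 0" if "f \<in> P" for f
    proof -
      from that P(1) have "f \<in> regular_functions Aut_ind" by blast
      from reg[OF this] obtain p where p: "(\<lambda>t. f (\<gamma> t)) = poly p" by auto
      have "E \<subseteq> {t. poly p t = 0}"
      proof
        fix t assume "t \<in> E"
        then have "\<gamma> t \<in> C \<inter> strat Aut_ind D" using limit(4) strat by blast
        then have "f (\<gamma> t) = 0" using P(2) that by blast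
        then show "t \<in> {t. poly p t = 0}" using fun_cong[OF p, of t] by simp
      qed
      then have "infinite {t. poly p t = 0}" using limit(2) finite_subset by blast
      then have "p = 0" using poly_roots_finite by blast
      then show ?thesis using fun_cong[OF p, of t0] by simp
    qed
    then show ?case using P(2) strat[of t0] by blast
  qed (use F in blast)
qed

text \<open>Translates and inverses of curves are curves. So the set of \<open>h\<close> with \<open>g h\<close> in the curve closure is
  itself closed under limits, first for \<open>g\<close> in the given subgroup and then for all \<open>g\<close> in its closure.\<close>

lemma curve_closure_subgroup:
  assumes "subgroup F Aut_A2"
  shows "subgroup (curve_closure F) Aut_A2"
proof -
  interpret F: subgroup F Aut_A2 by (rule assms)
  have carrier: "g \<in> carrier Aut_A2" if "g \<in> curve_closure F" for g
    using that by (induction rule: curve_closure.induct) (auto simp: aut_curve_def)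
  have left: "endo_comp g h \<in> curve_closure F" if "h \<in> curve_closure F" "g \<in> F" for g h
    using that
  proof (induction rule: curve_closure.induct)
    case (base h)
    then show ?case using F.m_closed[of g h] by (auto intro: curve_closure.base)
  next
    case (limit \<gamma> E t0)
    have "aut_curve (\<lambda>t. endo_comp g (\<gamma> t))"
      using limit by (intro aut_curve_comp aut_curve_const) auto
    from curve_closure.limit[OF this limit(2), of F t0] limit(4,5) show ?case by blast
  qed
  have mult: "endo_comp g h \<in> curve_closure F" if "g \<in> curve_closure F" "h \<in> curve_closure F" for g h
    using that
  proof (induction rule: curve_closure.induct)
    case (base g)
    then show ?case using left by blast
  next
    case (limit \<gamma> E t0)
    have "aut_curve (\<lambda>t. endo_comp (\<gamma> t) h)"
      using limit carrier by (intro aut_curve_comp aut_curve_const) auto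
    from curve_closure.limit[OF this limit(2), of F t0] limit(4,5) show ?case by blast
  qed
  have inverse: "inv\<^bsub>Aut_A2\<^esub> g \<in> curve_closure F" if "g \<in> curve_closure F" for g
    using that
  proof (induction rule: curve_closure.induct)
    case (base g)
    then show ?case by (auto intro: curve_closure.base)
  next
    case (limit \<gamma> E t0)
    from curve_closure.limit[OF aut_curve_inv[OF limit(1)] limit(2), of F t0] limit(4) show ?case by blast
  qed
  show ?thesis
    by (rule Aut.subgroupI) (use carrier mult inverse F.one_closed in \<open>auto intro: curve_closure.base\<close>)
qed

lemma curve_closure_swap:
  assumes "\<And>g. g \<in> F \<Longrightarrow> endo_comp (varY, varX) (endo_comp g (varY, varX)) \<in> F"
    and "g \<in> curve_closure F"
  shows "endo_comp (varY, varX) (endo_comp g (varY, varX)) \<in> curve_closure F"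
  using assms(2)
proof (induction rule: curve_closure.induct)
  case (base g)
  then show ?case by (intro curve_closure.base assms(1))
next
  case (limit \<gamma> E t0)
  have "aut_curve (\<lambda>t. endo_comp (varY, varX) (endo_comp (\<gamma> t) (varY, varX)))"
    using limit by (intro aut_curve_comp aut_curve_const swap_in_Aut) auto
  from curve_closure.limit[OF this limit(2), of F t0] limit(4) show ?case by blast
qed

lemma closedin_Aut_ind:
  assumes "P \<subseteq> regular_functions Aut_ind"
  shows "closedin (ind_topology Aut_ind) {g \<in> carrier Aut_A2. \<forall>f\<in>P. f g = 0}"
  unfolding closedin_ind_topology zariski_closed_def Union_strat_Aut_ind
proof (intro conjI allI exI[of _ P])
  show "{g \<in> carrier Aut_A2. \<forall>f\<in>P. f g = 0} \<inter> strat Aut_ind d = {x \<in> strat Aut_ind d. \<forall>f\<in>P. f x = 0}" for d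
    by (auto simp only: in_strat_Aut_ind)
qed (use assms in blast)+

lemma regular_coeff:
  "(\<lambda>g. cf (fst g) i j - c) \<in> regular_functions Aut_ind" "(\<lambda>g. cf (snd g) i j - c) \<in> regular_functions Aut_ind"
proof -
  have 1: "(\<lambda>g. cf (fst g) i j) \<in> regular_functions Aut_ind"
    by (rule regular_functions.coord) (unfold Aut_ind_def ind_variety.simps, blast)
  have 2: "(\<lambda>g. cf (snd g) i j) \<in> regular_functions Aut_ind"
    by (rule regular_functions.coord) (unfold Aut_ind_def ind_variety.simps, blast)
  show "(\<lambda>g. cf (fst g) i j - c) \<in> regular_functions Aut_ind" "(\<lambda>g. cf (snd g) i j - c) \<in> regular_functions Aut_ind"
    using regular_functions.add[OF 1 regular_functions.const[of "- c"]]
      regular_functions.add[OF 2 regular_functions.const[of "- c"]] by simp_all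
qed

lemma closedin_coeff_conditions:
  "closedin (ind_topology Aut_ind) {g \<in> carrier Aut_A2. (\<forall>(i, j, c)\<in>X. cf (fst g) i j = c) \<and> (\<forall>(i, j, c)\<in>Y. cf (snd g) i j = c)}"
proof -
  define P where "P = (\<lambda>(i, j, c) g. cf (fst g) i j - c) ` X \<union> (\<lambda>(i, j, c) g. cf (snd g) i j - c) ` Y"
  have "P \<subseteq> regular_functions Aut_ind" unfolding P_def using regular_coeff by auto
  moreover have "(\<forall>f\<in>P. f g = 0) \<longleftrightarrow> (\<forall>(i, j, c)\<in>X. cf (fst g) i j = c) \<and> (\<forall>(i, j, c)\<in>Y. cf (snd g) i j = c)" for g
    unfolding P_def by (simp add: ball_Un case_prod_beta)
  ultimately show ?thesis using closedin_Aut_ind[of P] by simp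
qed

lemma closedin_equivariant_Aut: "closedin (ind_topology Aut_ind) (equivariant_Aut :: 'k::field endo set)"
proof -
  let ?X = "{(i, j, 0) | i j. (i + 2 * j) mod 3 \<noteq> 1} \<union> {(1, 0, 1 :: 'k)}"
  let ?Y = "{(i, j, 0) | i j. (i + 2 * j) mod 3 \<noteq> 2} \<union> {(0, 1, 1 :: 'k)}"
  have "(\<forall>(i, j, c)\<in>{(i, j, 0) | i j. (i + 2 * j) mod 3 \<noteq> r} \<union> {(a, b, 1)}. cf p i j = c) \<longleftrightarrow>
      graded r p \<and> cf p a b = 1" for p :: "'k poly poly" and a b r
    unfolding graded_def ball_Un by auto
  then have "{g \<in> carrier Aut_A2. (\<forall>(i, j, c)\<in>?X. cf (fst g) i j = c) \<and> (\<forall>(i, j, c)\<in>?Y. cf (snd g) i j = c)} = equivariant_Aut"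
    unfolding equivariant_Aut_def by auto
  then show ?thesis using closedin_coeff_conditions[of ?X ?Y] by simp
qed

lemma closedin_shear_x: "closedin (ind_topology Aut_ind) (range (shear_x :: 'k::field poly \<Rightarrow> _))"
proof -
  let ?X = "{(i, j, 0) | i j. (i, j) \<noteq> (1, 0) \<and> \<not> (i = 0 \<and> j mod 3 = 2)} \<union> {(1, 0, 1 :: 'k)}"
  let ?Y = "{(i, j, if (i, j) = (0, 1) then 1 :: 'k else 0) | i j. True}"
  let ?Z = "{g \<in> carrier Aut_A2. ((\<forall>i j. (i, j) \<noteq> (1, 0) \<longrightarrow> \<not> (i = 0 \<and> j mod 3 = 2) \<longrightarrow> cf (fst g) i j = 0) \<and>
    cf (fst g) 1 0 = 1) \<and> (\<forall>i j. cf (snd g) i j = (if (i, j) = (0, 1) then 1 else 0))} :: 'k endo set"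
  have X: "(\<forall>(i, j, c)\<in>?X. cf p i j = c) \<longleftrightarrow>
      (\<forall>i j. (i, j) \<noteq> (1, 0) \<longrightarrow> \<not> (i = 0 \<and> j mod 3 = 2) \<longrightarrow> cf p i j = 0) \<and> cf p 1 0 = 1" for p
    unfolding ball_Un by auto
  have Y: "(\<forall>(i, j, c)\<in>?Y. cf p i j = c) \<longleftrightarrow> (\<forall>i j. cf p i j = (if (i, j) = (0, 1) then 1 else 0))" for p
    by auto
  have "?Z = range shear_x"
  proof (intro subset_antisym subsetI)
    fix g :: "'k endo" assume "g \<in> ?Z"
    then have X: "\<And>i j. (i, j) \<noteq> (1, 0) \<Longrightarrow> \<not> (i = 0 \<and> j mod 3 = 2) \<Longrightarrow> cf (fst g) i j = 0" "cf (fst g) 1 0 = 1"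
      and Y: "\<And>i j. cf (snd g) i j = (if (i, j) = (0, 1) then 1 else 0)"
      by blast+
    define f where "f = (\<Sum>k\<le>degree (fst g). monom (cf (fst g) 0 (3 * k + 2)) k)"
    have "k \<le> degree (fst g)" if "cf (fst g) 0 (3 * k + 2) \<noteq> 0" for k
    proof -
      have "coeff (fst g) (3 * k + 2) \<noteq> 0" using that by auto
      from le_degree[OF this] show ?thesis by simp
    qed
    then have f: "coeff f k = cf (fst g) 0 (3 * k + 2)" for k
      unfolding f_def by (auto simp: coeff_sum)
    have "cf (fst g) i j = cf (fst (shear_x f)) i j" for i j
    proof (cases "i = 0 \<and> j mod 3 = 2")
      case True
      then have "3 * (j div 3) + 2 = j" by presburger
      then show ?thesis using True by (simp add: cf_shear_x f)
    next
      case False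
      then show ?thesis using X(1)[of i j] X(2) unfolding cf_shear_x by (cases "(i, j) = (1, 0)") auto
    qed
    moreover have "cf (snd g) i j = cf (snd (shear_x f)) i j" for i j
      unfolding Y by (auto simp: shear_x_def cf_varY)
    ultimately have "g = shear_x f" by (intro prod_eqI poly2_eqI)
    then show "g \<in> range shear_x" by blast
  next
    fix g :: "'k endo" assume "g \<in> range shear_x"
    then obtain f where g: "g = shear_x f" by blast
    have "cf (snd (shear_x f)) i j = (if (i, j) = (0, 1) then 1 else 0)" for i j
      by (auto simp: shear_x_def cf_varY)
    moreover have "(i, j) \<noteq> (1, 0) \<longrightarrow> \<not> (i = 0 \<and> j mod 3 = 2) \<longrightarrow> cf (fst (shear_x f)) i j = 0"
      "cf (fst (shear_x f)) 1 0 = 1" for i j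
      unfolding cf_shear_x by simp_all
    ultimately show "g \<in> ?Z" unfolding g using shear_in_Aut(1)[of f] by blast
  qed
  then show ?thesis using closedin_coeff_conditions[of ?X ?Y] unfolding X Y by (simp only:)
qed


section \<open>The closure of the group generated by the quadratic shears\<close>

definition triangular :: "'k::comm_ring_1 poly \<Rightarrow> 'k endo" where
  "triangular p = (varX + subst1 p varY, varY)"

lemma triangular_comp: "endo_comp (triangular p) g = (fst g + subst1 p (snd g), snd g)"
  by (simp add: endo_comp_def triangular_def subst2_simps)

lemma triangular_add: "endo_comp (triangular p) (triangular q) = triangular (p + q)"
  by (simp add: triangular_comp) (simp add: triangular_def subst1_add add_ac)

lemma triangular_0 [simp]: "triangular 0 = (varX, varY)"
  by (simp add: triangular_def)

lemma triangular_in_Aut: "triangular p \<in> carrier Aut_A2"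
  and inv_triangular: "inv\<^bsub>Aut_A2\<^esub> (triangular p) = triangular (- p)"
  using carrier_AutI[of "triangular p" "triangular (- p)"] inv_Aut_eqI[of "triangular p" "triangular (- p)"]
  by (simp_all add: triangular_add)

lemma subst1_monom: "subst1 (monom c n) P = cst c * P ^ n"
  by (induction n) (simp_all add: monom_0 subst1_const monom_Suc subst1_pCons mult_ac del: mult_pCons_left mult_pCons_right)

lemma shear_x_monom: "shear_x (monom a k) = triangular (monom a (3 * k + 2))"
  unfolding shear_x_def triangular_def subst1_monom
  by (simp add: power_add power2_eq_square mult_ac flip: power_mult del: mult_pCons_left mult_pCons_right)

text \<open>The remainder in Taylor's formula of order one, with its value at \<open>Z = 0\<close>.\<close>

lemma difference_quotient:
  "\<exists>Q :: 'k::field poly poly. \<forall>Y Z. subst1 p (Y + Z) = subst1 p Y + Z * subst2 Q (Y, Z) \<and>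
     subst2 Q (Y, 0) = subst1 (pderiv p) Y"
proof (induction p)
  case 0
  show ?case by (rule exI[of _ 0]) simp
next
  case (pCons a p)
  then obtain Q :: "'k poly poly" where Q: "\<And>Y Z. subst1 p (Y + Z) = subst1 p Y + Z * subst2 Q (Y, Z)"
    "\<And>Y. subst2 Q (Y, 0) = subst1 (pderiv p) Y" by blast
  have "subst1 (pCons a p) (Y + Z) = subst1 (pCons a p) Y + Z * subst2 ([:p:] + (varX + varY) * Q) (Y, Z)" for Y Z
    unfolding subst1_pCons Q(1) subst2_simps subst2_const by (simp add: algebra_simps)
  moreover have "subst2 ([:p:] + (varX + varY) * Q) (Y, 0) = subst1 (pderiv (pCons a p)) Y" for Y
    unfolding subst2_simps subst2_const by (simp add: Q(2) pderiv_pCons subst1_add subst1_pCons)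
  ultimately show ?case by blast
qed

text \<open>Conjugating \<open>(x, y + e\<^sup>3 x\<^sup>2)\<close> by \<open>(x + p(y)/e, y)\<close> gives a curve that extends to \<open>e = 0\<close>,
  where its value is \<open>(x - p(y)\<^sup>2 p'(y), y)\<close>.\<close>

lemma degenerating_curve:
  fixes p :: "'k::field_char_0 poly"
  shows "\<exists>\<gamma>. aut_curve \<gamma> \<and> \<gamma> 0 = triangular (- (p ^ 2 * pderiv p)) \<and>
    (\<forall>e. e \<noteq> 0 \<longrightarrow> \<gamma> e = endo_comp (triangular (smult (- 1 / e) p)) (endo_comp (shear_y [:e ^ 3:]) (triangular (smult (1 / e) p))))"
proof -
  note [simp del] = mult_pCons_left mult_pCons_right
  obtain Q :: "'k poly poly" where Q: "\<And>Y Z. subst1 p (Y + Z) = subst1 p Y + Z * subst2 Q (Y, Z)"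
    "\<And>Y. subst2 Q (Y, 0) = subst1 (pderiv p) Y" using difference_quotient[of p] by blast
  define w where "w e = cst e * varX + subst1 p varY" for e
  define z where "z s e = cst s * cst e * w e ^ 2" for s e
  define \<gamma> where "\<gamma> s e = (varX - cst s * w e ^ 2 * subst2 Q (varY, z s e), varY + z s e)" for s e
  have conj: "\<gamma> s e = endo_comp (triangular (smult (- 1 / e) p)) (endo_comp (shear_y [:s * e ^ 3:]) (triangular (smult (1 / e) p)))"
    if "e \<noteq> 0" for s e
  proof -
    define f where "f = varX + cst (1 / e) * subst1 p varY"
    have one: "cst e * cst (1 / e) = (1 :: 'k poly poly)" using that by (simp add: one_pCons mult_pCons_left)
    have fw: "cst e * f = w e" unfolding f_def w_def distrib_left mult.assoc[symmetric] one by simp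
    have T: "triangular (smult (1 / e) p) = (f, varY)" by (simp add: triangular_def f_def subst1_smult)
    have "cst (s * e ^ 3) = cst s * cst e * (cst e) ^ 2"
      by (simp add: mult_pCons_left power2_eq_square power3_eq_cube)
    then have "f ^ 2 * cst (s * e ^ 3) = z s e"
      unfolding z_def fw[symmetric] by (simp only: power2_eq_square mult_ac)
    then have h: "endo_comp (shear_y [:s * e ^ 3:]) (triangular (smult (1 / e) p)) = (f, varY + z s e)"
      unfolding T by (intro prod_eqI) (simp_all add: fst_shear_y_comp snd_shear_y_comp subst1_const)
    have m: "cst (- 1 / e) = - cst (1 / e)" by simp
    have c: "cst (1 / e) * z s e = cst s * w e ^ 2"
    proof -
      have "cst (1 / e) * z s e = (cst e * cst (1 / e)) * (cst s * w e ^ 2)" unfolding z_def by (simp only: mult_ac)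
      then show ?thesis unfolding one by simp
    qed
    have "f + subst1 (smult (- 1 / e) p) (varY + z s e) = f - cst (1 / e) * subst1 p varY - cst (1 / e) * z s e * subst2 Q (varY, z s e)"
    proof -
      have "f + - d * (a + b * c) = f - d * a - d * b * c" for a b c d :: "'k poly poly" by (simp add: algebra_simps)
      then show ?thesis unfolding subst1_smult Q(1) m .
    qed
    also have "\<dots> = varX - cst s * w e ^ 2 * subst2 Q (varY, z s e)"
      unfolding c by (simp add: f_def)
    finally show ?thesis unfolding h triangular_comp \<gamma>_def by simp
  qed
  have at_0: "\<gamma> s 0 = triangular (smult (- s) (p ^ 2 * pderiv p))" for s
  proof -
    have "cst s * w 0 ^ 2 * subst2 Q (varY, z s 0) = subst1 (smult s (p ^ 2 * pderiv p)) varY"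
      by (simp add: z_def w_def Q(2) subst1_smult subst1_mult power2_eq_square mult_ac)
    then show ?thesis by (simp add: \<gamma>_def triangular_def subst1_uminus z_def)
  qed
  have inverse: "endo_comp (\<gamma> s e) (\<gamma> (- s) e) = (varX, varY)" for s e
  proof (cases "e = 0")
    case True
    then show ?thesis by (simp add: at_0 triangular_add)
  next
    case False
    define T where "T = triangular (smult (1 / e) p)"
    define T' where "T' = triangular (smult (- 1 / e) p)"
    have TT: "endo_comp T (endo_comp T' g) = g" "endo_comp T' T = (varX, varY)" for g
      by (simp_all add: T_def T'_def triangular_add endo_comp_assoc[symmetric])
    have SS: "endo_comp (shear_y [:s * e ^ 3:]) (endo_comp (shear_y [:- s * e ^ 3:]) g) = g" for g
      by (simp add: shear_y_add endo_comp_assoc[symmetric])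
    show ?thesis
      unfolding conj[OF False, folded T_def T'_def] by (simp only: endo_comp_assoc TT SS)
  qed
  have \<gamma>_Aut: "\<gamma> s e \<in> carrier Aut_A2" and \<gamma>_inv: "inv\<^bsub>Aut_A2\<^esub> (\<gamma> s e) = \<gamma> (- s) e" for s e
    using carrier_AutI[OF inverse, of s e] inv_Aut_eqI[OF inverse, of s e] inverse[of "- s" e] by simp_all
  have fam: "(\<lambda>e. fst (\<gamma> s e)) \<in> families (range poly)" "(\<lambda>e. snd (\<gamma> s e)) \<in> families (range poly)" for s
  proof -
    have w: "w \<in> families (range poly)"
      unfolding w_def[abs_def] by (intro families_add families_mult families_id families_const)
    then have z: "z s \<in> families (range poly)"
      unfolding z_def[abs_def] by (intro families_mult families_id families_const families_power)
    have "(\<lambda>e. subst2 Q (varY, z s e)) \<in> families (range poly)"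
      using families_subst2[of "\<lambda>_. Q" _ "\<lambda>e. (varY, z s e)"] z by (simp add: families_const)
    then have "(\<lambda>e. varX + cst (- s) * w e ^ 2 * subst2 Q (varY, z s e)) \<in> families (range poly)"
      by (intro families_add families_mult families_const families_power w)
    moreover have "cst (- s) * a * b = - (cst s * a * b)" for a b :: "'k poly poly"
    proof -
      have "cst (- s) = - cst s" by simp
      then show ?thesis by (simp only: mult_minus_left)
    qed
    ultimately show "(\<lambda>e. fst (\<gamma> s e)) \<in> families (range poly)" by (simp add: \<gamma>_def)
    show "(\<lambda>e. snd (\<gamma> s e)) \<in> families (range poly)"
      unfolding \<gamma>_def snd_conv by (intro families_add families_const z)
  qed
  have "aut_curve (\<gamma> 1)" unfolding aut_curve_def \<gamma>_inv using \<gamma>_Aut fam by auto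
  moreover have "\<gamma> 1 0 = triangular (- (p ^ 2 * pderiv p))" using at_0[of 1] by simp
  ultimately show ?thesis using conj[of _ 1] by (intro exI[of _ "\<gamma> 1"]) auto
qed

lemma infinite_of_nat: "infinite (range (of_nat :: nat \<Rightarrow> 'k::field_char_0))"
  by (rule range_inj_infinite[OF inj_of_nat])

text \<open>Let \<open>V\<close> be the set of polynomials \<open>p(y)\<close> for which \<open>(x + p(y), y)\<close> lies in the curve closure. It is a
  linear subspace, since it is closed under addition and under integral multiples, and the latter
  are dense. The degenerating curves show that \<open>V\<close> contains \<open>p\<^sup>2 p'\<close> along with \<open>p\<close>; polarizing at \<open>y\<^sup>2\<close>
  gives the derivative of \<open>y\<^sup>4 p\<close>, so \<open>V\<close> contains \<open>y\<^bsup>n+3\<^esup>\<close> along with \<open>y\<^sup>n\<close>. The shears in the other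
  direction follow by conjugation with the swap.\<close>

theorem shears_subset_curve_closure:
  defines "F \<equiv> generate Aut_A2 {shear_x 1, shear_y 1 :: 'k::field_char_0 endo}"
  shows "shear_x f \<in> curve_closure F" "shear_y f \<in> curve_closure F"
proof -
  have F: "subgroup F Aut_A2"
    unfolding F_def by (rule Aut.generate_is_subgroup) (use shear_in_Aut in auto)
  define K where "K = curve_closure F"
  interpret K: subgroup K Aut_A2 unfolding K_def by (rule curve_closure_subgroup[OF F])
  have comp: "endo_comp g h \<in> K" if "g \<in> K" "h \<in> K" for g h using K.m_closed[OF that] by simp
  have swap_F: "endo_comp (varY, varX) (endo_comp g (varY, varX)) \<in> F" if "g \<in> F" for g
    using that unfolding F_def
  proof (induction rule: generate.induct)
    case one
    show ?case using generate.one[of Aut_A2] by (simp add: endo_comp_def subst2_varX subst2_varY)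
  next
    case (incl h)
    have "endo_comp (varY, varX) (endo_comp (shear_y 1) (varY, varX)) = (shear_x 1 :: 'k endo)"
      by (simp add: endo_comp_def shear_x_def shear_y_def subst2_simps)
    then show ?case using incl swap_shear[of "1 :: 'k poly"] by (auto intro: generate.incl)
  next
    case (inv h)
    have "endo_comp (varY, varX) (endo_comp (shear_y (- 1)) (varY, varX)) = (shear_x (- 1) :: 'k endo)"
      by (simp add: endo_comp_def shear_x_def shear_y_def subst2_simps)
    then show ?case
      using inv swap_shear[of "- 1 :: 'k poly"] generate.inv[of "shear_x 1 :: 'k endo" "{shear_x 1, shear_y 1}" Aut_A2]
        generate.inv[of "shear_y 1 :: 'k endo" "{shear_x 1, shear_y 1}" Aut_A2] by (auto simp: inv_shear)
  next
    case (eng g h)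
    have tt: "endo_comp (varY, varX) (endo_comp (varY, varX) k) = k" for k :: "'k endo"
      by (simp add: endo_comp_def subst2_varX subst2_varY)
    have "endo_comp (varY, varX) (endo_comp (endo_comp g h) (varY, varX)) =
      endo_comp (endo_comp (varY, varX) (endo_comp g (varY, varX))) (endo_comp (varY, varX) (endo_comp h (varY, varX)))"
      by (simp add: endo_comp_assoc tt)
    then show ?case using generate.eng[OF eng(3,4)] by simp
  qed
  have swap_K: "endo_comp (varY, varX) (endo_comp g (varY, varX)) \<in> K" if "g \<in> K" for g
    using curve_closure_swap[OF swap_F] that unfolding K_def by blast
  have add: "triangular (p + q) \<in> K" if "triangular p \<in> K" "triangular q \<in> K" for p q
    using comp[OF that] by (simp add: triangular_add)
  have smult: "triangular (smult t p) \<in> K" if "triangular p \<in> K" for t p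
  proof -
    have "triangular (smult (of_nat n) p) \<in> K" for n
    proof (induction n)
      case 0
      then show ?case using K.one_closed by simp
    next
      case (Suc n)
      have "smult (of_nat (Suc n)) p = p + smult (of_nat n) p" by (simp add: smult_add_left)
      then show ?case using add[OF that Suc] by metis
    qed
    moreover have "aut_curve (\<lambda>t. triangular (smult t p))"
    proof -
      have "(\<lambda>t. varX + cst t * subst1 p varY) \<in> families (range poly)"
        "(\<lambda>t. varX + cst t * subst1 (- p) varY) \<in> families (range poly)"
        by (intro families_add families_mult families_id families_const)+
      moreover have "- smult t p = smult t (- p)" for t by simp
      ultimately show ?thesis
        unfolding aut_curve_def inv_triangular
        by (simp only: triangular_in_Aut) (simp add: triangular_def subst1_smult families_const del: mult_pCons_left smult_minus_right)
    qed
    ultimately show ?thesis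
      using curve_closure.limit[OF _ infinite_of_nat, of "\<lambda>t. triangular (smult t p)" F t] unfolding K_def by blast
  qed
  have uminus: "triangular (- p) \<in> K" if "triangular p \<in> K" for p
    using smult[OF that, of "- 1"] by simp
  have "shear_x 1 \<in> K" unfolding K_def F_def by (intro curve_closure.base generate.incl) auto
  then have sq: "triangular (monom 1 2) \<in> K"
    using shear_x_monom[of "1 :: 'k" 0] by (simp add: monom_0 one_pCons numeral_2_eq_2)
  have quad: "shear_y [:t:] \<in> K" for t
  proof -
    have "shear_x [:t:] = triangular (smult t (monom 1 2))"
      using shear_x_monom[of t 0] by (simp add: monom_0 smult_monom numeral_2_eq_2)
    then have "shear_x [:t:] \<in> K" using smult[OF sq, of t] by (simp only:)
    from swap_K[OF this] show ?thesis unfolding swap_shear .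
  qed
  have cube: "triangular (p ^ 2 * pderiv p) \<in> K" if "triangular p \<in> K" for p
  proof -
    obtain \<gamma> where \<gamma>: "aut_curve \<gamma>" "\<gamma> 0 = triangular (- (p ^ 2 * pderiv p))"
      "\<And>e. e \<noteq> 0 \<Longrightarrow> \<gamma> e = endo_comp (triangular (smult (- 1 / e) p)) (endo_comp (shear_y [:e ^ 3:]) (triangular (smult (1 / e) p)))"
      using degenerating_curve[of p] by blast
    have "\<gamma> e \<in> K" if e: "e \<in> UNIV - {0}" for e
    proof -
      have "endo_comp (triangular (smult (- 1 / e) p)) (endo_comp (shear_y [:e ^ 3:]) (triangular (smult (1 / e) p))) \<in> K"
        by (intro comp quad smult \<open>triangular p \<in> K\<close>)
      moreover have "e \<noteq> 0" using e by simp
      note \<gamma>(3)[OF this]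
      ultimately show ?thesis by (simp only:)
    qed
    moreover have "infinite (UNIV - {0 :: 'k})" using infinite_UNIV_char_0 by simp
    ultimately have "\<gamma> 0 \<in> K" using curve_closure.limit[OF \<gamma>(1)] unfolding K_def by blast
    then show ?thesis using uminus \<gamma>(2) by fastforce
  qed
  \<comment> \<open>Polarization of the cubic map \<open>p \<mapsto> p\<^sup>2 p'\<close> at \<open>y\<^sup>2\<close>.\<close>
  have polar: "triangular (pderiv (monom 1 4 * q)) \<in> K" if "triangular q \<in> K" for q
  proof -
    define a :: "'k poly" where "a = monom 1 2"
    define c where "c = (\<lambda>p :: 'k poly. p ^ 2 * pderiv p)"
    have aK: "triangular a \<in> K" using sq by (simp only: a_def)
    have "triangular (a + q) \<in> K" "triangular (a + - q) \<in> K"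
      by (rule add[OF aK that], rule add[OF aK uminus[OF that]])
    then have "triangular (c (a + q)) \<in> K" "triangular (c (a + - q)) \<in> K" "triangular (c q) \<in> K"
      unfolding c_def using cube that by blast+
    then have t: "triangular (smult (1 / 2) (c (a + q) + (- c (a + - q) + smult (- 2) (c q)))) \<in> K"
      by (intro smult add uminus)
    have two: "smult 2 r = r + r" for r :: "'k poly" using smult_add_left[of 1 1 r] by simp
    have "smult (- 2) r = - (r + r)" for r :: "'k poly" using two[of r] by simp
    then have "c (a + q) + (- c (a + - q) + smult (- 2) (c q)) = smult 2 (pderiv (a * a * q))"
      unfolding two unfolding c_def pderiv_add pderiv_minus pderiv_mult
      by (simp add: power2_eq_square algebra_simps)
    then have "smult (1 / 2) (c (a + q) + (- c (a + - q) + smult (- 2) (c q))) = pderiv (a * a * q)" by simp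
    moreover have "a * a = monom 1 4" by (simp add: a_def mult_monom)
    ultimately show ?thesis using t by metis
  qed
  have mono: "triangular (monom 1 (3 * k + 2)) \<in> K" for k
  proof (induction k)
    case 0
    show ?case using sq by (simp only: mult_0_right add_0)
  next
    case (Suc k)
    have "pderiv (monom 1 4 * monom 1 (3 * k + 2)) = smult (of_nat (3 * k + 6)) (monom (1 :: 'k) (3 * Suc k + 2))"
      by (simp add: mult_monom pderiv_monom smult_monom)
    then have "triangular (smult (of_nat (3 * k + 6)) (monom 1 (3 * Suc k + 2))) \<in> K" using polar[OF Suc] by simp
    from smult[OF this, of "1 / of_nat (3 * k + 6)"] show ?case
      by (simp add: smult_monom del: of_nat_add of_nat_mult)
  qed
  have x: "shear_x f \<in> K" for f
  proof -
    have "shear_x (\<Sum>k\<in>A. monom (coeff f k) k) \<in> K" if "finite A" for A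
      using that
    proof (induction A rule: finite_induct)
      case empty
      show ?case using K.one_closed by simp
    next
      case (insert k A)
      have "triangular (monom (coeff f k) (3 * k + 2)) \<in> K"
        using smult[OF mono, of "coeff f k" k] by (simp add: smult_monom)
      then have "endo_comp (shear_x (monom (coeff f k) k)) (shear_x (\<Sum>k\<in>A. monom (coeff f k) k)) \<in> K"
        using insert by (intro comp) (simp_all add: shear_x_monom)
      then show ?case using insert by (simp add: shear_x_add)
    qed
    from this[of "{..degree f}"] show ?thesis by (simp add: poly_as_sum_of_monoms)
  qed
  show "shear_x f \<in> curve_closure F" using x unfolding K_def .
  show "shear_y f \<in> curve_closure F" using swap_K[OF x, of f] unfolding K_def swap_shear .
qed

text \<open>The equivariant automorphisms form a closed set, defined by conditions on coefficients. They are
  generated by shears, which are limits of curves in the group generated by the quadratic ones.\<close>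

theorem closure_of_quadratic_shears:
  fixes F :: "'k::{alg_closed_field, field_char_0} endo set"
  defines "F \<equiv> generate Aut_A2 {shear_x 1, shear_y 1}"
  shows "(ind_topology Aut_ind closure_of F) = equivariant_Aut"
proof (intro subset_antisym)
  have F: "subgroup F Aut_A2" unfolding F_def by (rule Aut.generate_is_subgroup) (use shear_in_Aut in auto)
  have "F \<subseteq> equivariant_Aut"
    unfolding equivariant_Aut_generated F_def by (rule Aut.mono_generate) auto
  then show "(ind_topology Aut_ind closure_of F) \<subseteq> equivariant_Aut"
    using closedin_equivariant_Aut by (rule closure_of_minimal)
  have "F \<subseteq> topspace (ind_topology Aut_ind)"
    unfolding topspace_ind_topology Union_strat_Aut_ind by (rule subgroup.subset[OF F])
  then have "curve_closure F \<subseteq> (ind_topology Aut_ind closure_of F)"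
    by (intro curve_closure_subset_closed closedin_closure_of closure_of_subset)
  moreover have "equivariant_Aut \<subseteq> curve_closure F"
    unfolding equivariant_Aut_generated
    by (rule Aut.generate_subgroup_incl[OF _ curve_closure_subgroup[OF F]]) (use shears_subset_curve_closure[where 'k = 'k] in \<open>auto simp: F_def\<close>)
  ultimately show "equivariant_Aut \<subseteq> (ind_topology Aut_ind closure_of F)" by blast
qed

section \<open>Bounded subgroups\<close>

lemma shear_word_exists:
  fixes w :: "('k::field endo + 'k endo) list"
  assumes "w \<in> lists (range shear_x <+> range shear_y)"
  shows "\<exists>w'. shear_word w' \<and> sum_value Aut_A2 w' = sum_value Aut_A2 w \<and> length w' \<le> length w"
  using alternating_word_congruent[OF group_Aut_A2 subgroup_shear_x subgroup_shear_y assms]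
    sum_value_cong[OF group_Aut_A2 subgroup_shear_x subgroup_shear_y] by metis

lemma equivariant_Aut_words:
  "(equivariant_Aut :: 'k::{alg_closed_field, field_char_0} endo set) = sum_value Aut_A2 ` {w. shear_word w}"
proof -
  have "equivariant_Aut = sum_value Aut_A2 ` lists (range shear_x <+> range (shear_y :: 'k poly \<Rightarrow> _))"
    unfolding equivariant_Aut_generated by (rule generate_eq_sum_values[OF group_Aut_A2 subgroup_shear_x subgroup_shear_y])
  also have "\<dots> = sum_value Aut_A2 ` {w. shear_word w}"
  proof (intro subset_antisym subsetI)
    fix g :: "'k endo" assume "g \<in> sum_value Aut_A2 ` lists (range shear_x <+> range shear_y)"
    then obtain w where w: "w \<in> lists (range shear_x <+> range shear_y)" "g = sum_value Aut_A2 w" by blast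
    obtain w' where w': "shear_word w'" "sum_value Aut_A2 w' = sum_value Aut_A2 w"
      using shear_word_exists[OF w(1)] by blast
    show "g \<in> sum_value Aut_A2 ` {w. shear_word w}"
      by (rule image_eqI[of _ _ w']) (simp_all add: w(2) w')
  next
    fix g :: "'k endo" assume "g \<in> sum_value Aut_A2 ` {w. shear_word w}"
    then obtain w where w: "shear_word w" "g = sum_value Aut_A2 w" by blast
    then show "g \<in> sum_value Aut_A2 ` lists (range shear_x <+> range shear_y)"
      using alternating_lists[OF w(1)] by (intro image_eqI[of _ _ w])
  qed
  finally show ?thesis .
qed

lemma shear_sum_value_append:
  assumes "v \<in> lists (range shear_x <+> range shear_y)" "w \<in> lists (range shear_x <+> range shear_y)"
  shows "sum_value Aut_A2 (v @ w) = endo_comp (sum_value Aut_A2 v) (sum_value Aut_A2 w)"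
  using Aut.sum_value_append[OF _ _ assms] shear_in_Aut by auto

lemma shear_sum_value_closed:
  "w \<in> lists (range shear_x <+> range shear_y) \<Longrightarrow> sum_value Aut_A2 w \<in> carrier Aut_A2"
  by (rule Aut.sum_value_closed) (use shear_in_Aut in auto)

definition conj_by :: "'k::comm_ring_1 endo \<Rightarrow> 'k endo \<Rightarrow> 'k endo" where
  "conj_by c h = endo_comp (endo_comp c h) (inv\<^bsub>Aut_A2\<^esub> c)"

lemma inv_comp [simp]:
  assumes "c \<in> carrier Aut_A2"
  shows "endo_comp (inv\<^bsub>Aut_A2\<^esub> c) c = (varX, varY)" "endo_comp c (inv\<^bsub>Aut_A2\<^esub> c) = (varX, varY)"
    "endo_comp (inv\<^bsub>Aut_A2\<^esub> c) (endo_comp c g) = g" "endo_comp c (endo_comp (inv\<^bsub>Aut_A2\<^esub> c) g) = g"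
proof -
  show 1: "endo_comp (inv\<^bsub>Aut_A2\<^esub> c) c = (varX, varY)" "endo_comp c (inv\<^bsub>Aut_A2\<^esub> c) = (varX, varY)"
    using Aut.l_inv[OF assms] Aut.r_inv[OF assms] by simp_all
  show "endo_comp (inv\<^bsub>Aut_A2\<^esub> c) (endo_comp c g) = g" "endo_comp c (endo_comp (inv\<^bsub>Aut_A2\<^esub> c) g) = g"
    by (simp_all add: endo_comp_assoc[symmetric] 1)
qed

lemma conj_by_mult: "c \<in> carrier Aut_A2 \<Longrightarrow> conj_by c (endo_comp g h) = endo_comp (conj_by c g) (conj_by c h)"
  by (simp add: conj_by_def endo_comp_assoc)

lemma conj_by_comp:
  "b \<in> carrier Aut_A2 \<Longrightarrow> c \<in> carrier Aut_A2 \<Longrightarrow> conj_by b (conj_by c h) = conj_by (endo_comp b c) h"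
  using Aut.inv_mult_group[of b c] by (simp add: conj_by_def endo_comp_assoc)

lemma conj_by_power:
  fixes n :: nat
  assumes "c \<in> carrier Aut_A2"
  shows "conj_by c (h [^]\<^bsub>Aut_A2\<^esub> n) = conj_by c h [^]\<^bsub>Aut_A2\<^esub> n"
proof (induction n)
  case 0
  show ?case using assms by (simp add: conj_by_def)
next
  case (Suc n)
  then show ?case using conj_by_mult[OF assms] by simp
qed

text \<open>The powers of a cyclically reduced word are reduced as written, so their length and with it
  their degree grows.\<close>

lemma cyclically_reduced_power:
  fixes w :: "('k::field endo + 'k endo) list"
  assumes w: "shear_word w" "w \<noteq> []" "isl (hd w) \<noteq> isl (last w)"
  shows "n \<le> endo_degree (sum_value Aut_A2 w [^]\<^bsub>Aut_A2\<^esub> n)"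
proof -
  have wL: "w \<in> lists (range shear_x <+> range shear_y)" by (rule alternating_lists[OF w(1)])
  define W where "W n = concat (replicate n w)" for n
  have W: "shear_word (W n) \<and> length (W n) = n * length w \<and> (n > 0 \<longrightarrow> W n \<noteq> [] \<and> hd (W n) = hd w) \<and>
      sum_value Aut_A2 (W n) = sum_value Aut_A2 w [^]\<^bsub>Aut_A2\<^esub> n" for n
  proof (induction n)
    case (Suc n)
    have Wn: "W (Suc n) = w @ W n" by (simp add: W_def)
    have "W n = [] \<or> hd (W n) = hd w" using Suc by (cases n) (auto simp: W_def)
    then have "shear_word (W (Suc n))"
      using Suc w unfolding Wn by (auto simp: alternating_def successively_append_iff)
    moreover have "sum_value Aut_A2 (W (Suc n)) = sum_value Aut_A2 w [^]\<^bsub>Aut_A2\<^esub> Suc n"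
      unfolding Wn using shear_sum_value_append[OF wL alternating_lists[OF Suc[THEN conjunct1]]] Suc
        Aut.nat_pow_Suc2[OF shear_sum_value_closed[OF wL], of n] by simp
    ultimately show ?case using Suc w(2) unfolding Wn by auto
  qed (simp add: W_def alternating_def)
  show ?thesis
  proof (cases "n = 0")
    case False
    have "n \<le> n * length w" using w(2) by (cases w) auto
    also have "\<dots> < endo_degree (sum_value Aut_A2 (W n))"
      using shear_word_degree[of "W n"] W[of n] False by auto
    finally show ?thesis using W[of n] by simp
  qed simp
qed

definition bounded_degree :: "'k::comm_ring_1 endo set \<Rightarrow> bool" where
  "bounded_degree H \<longleftrightarrow> (\<exists>d. \<forall>h\<in>H. endo_degree h \<le> d)"

lemma bounded_not_cyclically_reduced:
  fixes w :: "('k::field endo + 'k endo) list"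
  assumes H: "subgroup H Aut_A2" "bounded_degree H" and h: "h \<in> H" and c: "c \<in> carrier Aut_A2"
    and w: "shear_word w" "w \<noteq> []" "isl (hd w) \<noteq> isl (last w)"
  shows "conj_by c h \<noteq> sum_value Aut_A2 w"
proof
  assume e: "conj_by c h = sum_value Aut_A2 w"
  obtain d where d: "\<And>h. h \<in> H \<Longrightarrow> endo_degree h \<le> d" using H(2) by (auto simp: bounded_degree_def)
  define D where "D = endo_degree c * d * endo_degree (inv\<^bsub>Aut_A2\<^esub> c)"
  have "h [^]\<^bsub>Aut_A2\<^esub> n \<in> H" for n :: nat
    by (induction n) (use subgroup.one_closed[OF H(1)] subgroup.m_closed[OF H(1)] h in auto)
  then have "endo_degree (conj_by c (h [^]\<^bsub>Aut_A2\<^esub> n)) \<le> D" for n :: nat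
    unfolding conj_by_def D_def
    by (meson d endo_degree_comp le_trans mult_le_mono1 mult_le_mono2)
  then have "endo_degree (sum_value Aut_A2 w [^]\<^bsub>Aut_A2\<^esub> Suc D) \<le> D"
    unfolding conj_by_power[OF c] e .
  then show False using cyclically_reduced_power[OF w, of "Suc D"] by simp
qed

lemma merge_letters:
  fixes l l' :: "'k::comm_ring_1 endo + 'k endo"
  assumes "l \<in> range shear_x <+> range shear_y" "l' \<in> range shear_x <+> range shear_y" "isl l = isl l'"
  shows "\<exists>m \<in> range shear_x <+> range shear_y. sum_value Aut_A2 [l, l'] = sum_value Aut_A2 [m]"
proof (cases l)
  case (Inl a)
  then obtain b where "l' = Inl b" using assms(3) by (cases l') auto
  then show ?thesis using Inl assms by (intro bexI[of _ "Inl (endo_comp a b)"]) (auto simp: shear_x_add)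
next
  case (Inr a)
  then obtain b where "l' = Inr b" using assms(3) by (cases l') auto
  then show ?thesis using Inr assms by (intro bexI[of _ "Inr (endo_comp a b)"]) (auto simp: shear_y_add)
qed

text \<open>A conjugate of minimal word length is cyclically reduced, and then a bounded set of powers
  forces length at most one.\<close>

lemma bounded_element_conjugate_letter:
  fixes H :: "'k::{alg_closed_field, field_char_0} endo set"
  assumes H: "subgroup H Aut_A2" "bounded_degree H" "H \<subseteq> equivariant_Aut" and h: "h \<in> H"
  shows "\<exists>c\<in>equivariant_Aut. \<exists>w. shear_word w \<and> length w \<le> 1 \<and> conj_by c h = sum_value Aut_A2 w"
proof -
  let ?L = "range shear_x <+> range (shear_y :: 'k poly \<Rightarrow> _)"
  define P where "P n \<longleftrightarrow> (\<exists>c\<in>equivariant_Aut. \<exists>w. shear_word w \<and> length w = n \<and> conj_by c h = sum_value Aut_A2 w)" for n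
  have eA: "c \<in> carrier Aut_A2" if "c \<in> equivariant_Aut" for c :: "'k endo"
    using that by (simp add: equivariant_Aut_def)
  have one: "(varX, varY) \<in> (equivariant_Aut :: 'k endo set)" using shear_equivariant(1)[of 0] by simp
  obtain w0 where "shear_word w0" "h = sum_value Aut_A2 w0"
    using h H(3) unfolding equivariant_Aut_words by blast
  moreover have "inv\<^bsub>Aut_A2\<^esub> (varX, varY) = ((varX, varY) :: 'k endo)" using Aut.inv_one by simp
  ultimately have "P (length w0)" unfolding P_def using one by (intro bexI[of _ "(varX, varY)"] exI[of _ w0]) (auto simp: conj_by_def)
  then have "P (LEAST n. P n)" by (rule LeastI)
  then obtain c w where c: "c \<in> equivariant_Aut" and w: "shear_word w" "length w = (LEAST n. P n)" "conj_by c h = sum_value Aut_A2 w"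
    unfolding P_def by blast
  have "length w \<le> 1"
  proof (rule ccontr)
    assume "\<not> length w \<le> 1"
    then obtain l v where lv: "w = l # v" "v \<noteq> []" by (cases w) auto
    then obtain m l' where ml: "w = l # m @ [l']" by (metis append_butlast_last_id)
    show False
    proof (cases "isl l = isl l'")
      case False
      then show False using bounded_not_cyclically_reduced[OF H(1,2) h eA[OF c] w(1)] w(3) ml by simp
    next
      case True
      have L: "l \<in> ?L" "l' \<in> ?L" "m \<in> lists ?L" using alternating_lists[OF w(1)] ml by auto
      obtain l'' where l'': "l'' \<in> ?L" "sum_value Aut_A2 [l', l] = sum_value Aut_A2 [l'']"
        using merge_letters[OF L(2,1)] True by auto
      define b where "b = sum_value Aut_A2 [l]"
      have b: "b \<in> equivariant_Aut" using L(1) shear_equivariant by (auto simp: b_def)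
      have "inv\<^bsub>Aut_A2\<^esub> b \<in> equivariant_Aut"
        using L(1) shear_equivariant by (auto simp: b_def inv_shear)
      then have c': "endo_comp (inv\<^bsub>Aut_A2\<^esub> b) c \<in> equivariant_Aut" using c by (rule equivariant_Aut_comp)
      have w_split: "sum_value Aut_A2 w = endo_comp b (sum_value Aut_A2 (m @ [l']))"
        unfolding ml by (simp add: b_def)
      have "conj_by (endo_comp (inv\<^bsub>Aut_A2\<^esub> b) c) h = conj_by (inv\<^bsub>Aut_A2\<^esub> b) (sum_value Aut_A2 w)"
        using conj_by_comp[of "inv\<^bsub>Aut_A2\<^esub> b" c h] eA[OF b] eA[OF c] w(3) by simp
      also have "\<dots> = endo_comp (sum_value Aut_A2 (m @ [l'])) b"
        unfolding conj_by_def w_split using eA[OF b] by simp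
      also have "\<dots> = sum_value Aut_A2 ((m @ [l']) @ [l])"
        unfolding b_def by (rule shear_sum_value_append[symmetric]) (use L in auto)
      also have "\<dots> = endo_comp (sum_value Aut_A2 m) (sum_value Aut_A2 [l', l])"
        using shear_sum_value_append[of m "[l', l]"] L by simp
      also have "\<dots> = sum_value Aut_A2 (m @ [l''])"
        unfolding l''(2) by (rule shear_sum_value_append[symmetric]) (use L l''(1) in auto)
      finally have e: "conj_by (endo_comp (inv\<^bsub>Aut_A2\<^esub> b) c) h = sum_value Aut_A2 (m @ [l''])" .
      obtain w' where w': "shear_word w'" "sum_value Aut_A2 w' = sum_value Aut_A2 (m @ [l''])" "length w' \<le> length (m @ [l''])"
        using shear_word_exists[of "m @ [l'']"] L l''(1) by auto
      have "P (length w')" unfolding P_def using c' w' e by metis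
      then have "(LEAST n. P n) \<le> length w'" by (rule Least_le)
      then show False using w'(3) w(2) ml by simp
    qed
  qed
  then show ?thesis using c w by blast
qed

lemma strip_side:
  assumes "successively (\<lambda>a b. isl a \<noteq> isl b) w"
  obtains p m q where "w = p @ m @ q" "\<forall>l\<in>set p \<union> set q. isl l = s" "m \<noteq> [] \<Longrightarrow> isl (hd m) \<noteq> s \<and> isl (last m) \<noteq> s"
proof -
  define p where "p = (if w \<noteq> [] \<and> isl (hd w) = s then [hd w] else [])"
  define v where "v = (if w \<noteq> [] \<and> isl (hd w) = s then tl w else w)"
  have w: "w = p @ v" by (simp add: p_def v_def)
  have v: "successively (\<lambda>a b. isl a \<noteq> isl b) v" "v \<noteq> [] \<Longrightarrow> isl (hd v) \<noteq> s"
  proof -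
    show "successively (\<lambda>a b. isl a \<noteq> isl b) v"
      using assms unfolding w by (simp add: successively_append_iff)
    show "isl (hd v) \<noteq> s" if "v \<noteq> []"
    proof (cases "w \<noteq> [] \<and> isl (hd w) = s")
      case True
      then obtain l w' where lw: "w = l # w'" by (cases w) auto
      then have "v = w'" using True by (simp add: v_def)
      then show ?thesis using assms True that unfolding lw by (auto simp: successively_Cons)
    next
      case False
      then have "v = w" unfolding v_def by (rule if_not_P)
      then show ?thesis using False that by blast
    qed
  qed
  define q where "q = (if v \<noteq> [] \<and> isl (last v) = s then [last v] else [])"
  define m where "m = (if v \<noteq> [] \<and> isl (last v) = s then butlast v else v)"
  have vm: "v = m @ q" by (simp add: q_def m_def)
  have "isl (hd m) \<noteq> s \<and> isl (last m) \<noteq> s" if "m \<noteq> []"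
  proof
    have "hd m = hd v" using vm that by simp
    moreover have "v \<noteq> []" using vm that by blast
    ultimately show "isl (hd m) \<noteq> s" using v(2) by metis
    show "isl (last m) \<noteq> s"
    proof (cases "v \<noteq> [] \<and> isl (last v) = s")
      case True
      then have "q = [last v]" unfolding q_def by (rule if_P)
      moreover have "isl (last m) \<noteq> isl (hd q)"
      proof -
        have "successively (\<lambda>a b. isl a \<noteq> isl b) (m @ q)" using v(1) unfolding vm[symmetric] .
        then show ?thesis using that \<open>q = [last v]\<close> by (simp add: successively_append_iff)
      qed
      ultimately show ?thesis using True by simp
    next
      case False
      then have "m = v" unfolding m_def by (rule if_not_P)
      then show ?thesis using False that by blast
    qed
  qed
  moreover have "\<forall>l\<in>set p \<union> set q. isl l = s" by (auto simp: p_def q_def)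
  ultimately show ?thesis using that w vm by blast
qed

definition side_group :: "bool \<Rightarrow> 'k::comm_ring_1 endo set" where
  "side_group s = (if s then range shear_x else range shear_y)"

lemma subgroup_side_group: "subgroup (side_group s) Aut_A2"
  by (simp add: side_group_def subgroup_shear_x subgroup_shear_y)

lemma sum_value_side:
  assumes "w \<in> lists (range shear_x <+> range shear_y)" "\<forall>l\<in>set w. isl l = s"
  shows "sum_value Aut_A2 w \<in> side_group s"
  using assms
proof (induction w)
  case Nil
  show ?case using subgroup.one_closed[OF subgroup_side_group, of s] by simp
next
  case (Cons l w)
  have 1: "case_sum (\<lambda>a. a) (\<lambda>b. b) l \<in> side_group s"
  proof -
    have "l \<in> range shear_x <+> range shear_y" by (rule Cons.hyps)
    moreover have "isl l = s" using Cons.prems by simp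
    ultimately show ?thesis unfolding side_group_def by (elim PlusE) simp_all
  qed
  have 2: "sum_value Aut_A2 w \<in> side_group s" using Cons by simp
  show ?case using subgroup.m_closed[OF subgroup_side_group 1 2] by simp
qed

text \<open>Let \<open>a\<close> be a nontrivial element of a factor. If \<open>h = b m b'\<close> where \<open>b\<close> and \<open>b'\<close> lie in that
  factor and the word \<open>m\<close> begins and ends in the other factor, then \<open>h\<close> and \<open>a h\<close> are conjugate to
  \<open>(b' b) m\<close> and \<open>(b' a b) m\<close>. One of these is a cyclically reduced word.\<close>

lemma bounded_subgroup_in_factor:
  fixes H :: "'k::{alg_closed_field, field_char_0} endo set"
  assumes H: "subgroup H Aut_A2" "bounded_degree H" "H \<subseteq> equivariant_Aut"
    and c: "c \<in> equivariant_Aut" and h1: "h1 \<in> H" "conj_by c h1 \<in> side_group s" "conj_by c h1 \<noteq> (varX, varY)"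
  shows "conj_by c ` H \<subseteq> side_group s"
proof
  let ?L = "range shear_x <+> range (shear_y :: 'k poly \<Rightarrow> _)"
  interpret S: subgroup "side_group s" Aut_A2 by (rule subgroup_side_group)
  have SA: "x \<in> carrier Aut_A2" if "x \<in> side_group s" for x using that S.subset by blast
  have eA: "x \<in> carrier Aut_A2" if "x \<in> equivariant_Aut" for x :: "'k endo"
    using that by (simp add: equivariant_Aut_def)
  have cA: "c \<in> carrier Aut_A2" using eA c .
  define a where "a = conj_by c h1"
  have a: "a \<in> side_group s" "a \<noteq> (varX, varY)" using h1 by (simp_all add: a_def)
  fix k assume "k \<in> conj_by c ` H"
  then obtain h where h: "h \<in> H" "k = conj_by c h" by blast
  have "k \<in> equivariant_Aut"
  proof -
    have "inv\<^bsub>Aut_A2\<^esub> c \<in> equivariant_Aut"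
      using c unfolding equivariant_Aut_generated
      by (rule subgroup.m_inv_closed[OF Aut.generate_is_subgroup, rotated]) (use shear_in_Aut in auto)
    moreover have "h \<in> equivariant_Aut" using h(1) H(3) by blast
    ultimately show ?thesis unfolding h(2) conj_by_def using c by (intro equivariant_Aut_comp)
  qed
  then obtain w where w: "shear_word w" "k = sum_value Aut_A2 w"
    unfolding equivariant_Aut_words by blast
  obtain p m q where pmq: "w = p @ m @ q" "\<forall>l\<in>set p \<union> set q. isl l = s"
    "m \<noteq> [] \<Longrightarrow> isl (hd m) \<noteq> s \<and> isl (last m) \<noteq> s"
    using strip_side[of w s] w(1) unfolding alternating_def by blast
  have L: "p \<in> lists ?L" "m \<in> lists ?L" "q \<in> lists ?L" using alternating_lists[OF w(1)] pmq(1) by auto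
  define b where "b = sum_value Aut_A2 p"
  define b' where "b' = sum_value Aut_A2 q"
  have b: "b \<in> side_group s" "b' \<in> side_group s"
    unfolding b_def b'_def using L pmq(2) by (auto intro!: sum_value_side)
  have k: "k = endo_comp b (endo_comp (sum_value Aut_A2 m) b')"
    unfolding w(2) pmq(1) b_def b'_def using L by (simp add: shear_sum_value_append)
  show "k \<in> side_group s"
  proof (cases "m = []")
    case True
    then show ?thesis using S.m_closed[OF b] k by simp
  next
    case False
    have m: "shear_word m" using w(1) unfolding pmq(1) by (auto simp: alternating_def successively_append_iff)
    have reduced: "conj_by (endo_comp b' c) h' \<noteq> endo_comp x (sum_value Aut_A2 m)"
      if "h' \<in> H" "x \<in> side_group s" "x \<noteq> (varX, varY)" for h' x
    proof -
      define l where "l = (if s then Inl x else Inr x)"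
      have "shear_word (l # m)"
        using m that pmq(3)[OF False] False by (auto simp: alternating_def successively_Cons l_def side_group_def split: if_splits)
      moreover have "isl (hd (l # m)) \<noteq> isl (last (l # m))"
        using pmq(3)[OF False] False by (simp add: l_def)
      moreover have "endo_comp b' c \<in> carrier Aut_A2" using Aut.m_closed[OF SA[OF b(2)] cA] by simp
      ultimately have "conj_by (endo_comp b' c) h' \<noteq> sum_value Aut_A2 (l # m)"
        using bounded_not_cyclically_reduced[OF H(1,2) that(1)] by blast
      then show ?thesis by (cases s) (simp_all add: l_def)
    qed
    note [simp] = SA[OF b(1)] SA[OF b(2)] SA[OF a(1)] cA
    have "conj_by (endo_comp b' c) h = conj_by b' k" by (simp add: conj_by_comp h(2))
    also have "\<dots> = endo_comp (endo_comp b' b) (sum_value Aut_A2 m)"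
      by (simp add: conj_by_def k endo_comp_assoc)
    finally have e1: "conj_by (endo_comp b' c) h = endo_comp (endo_comp b' b) (sum_value Aut_A2 m)" .
    have "endo_comp b' b \<in> side_group s" using S.m_closed[OF b(2,1)] by simp
    from reduced[OF h(1) this] e1 have 1: "endo_comp b' b = (varX, varY)" by blast
    have hh: "endo_comp h1 h \<in> H" using subgroup.m_closed[OF H(1) h1(1) h(1)] by simp
    have "conj_by (endo_comp b' c) (endo_comp h1 h) = conj_by b' (endo_comp a k)"
      by (simp add: conj_by_comp[symmetric] h(2) a_def conj_by_mult)
    also have "\<dots> = endo_comp (endo_comp (endo_comp b' a) b) (sum_value Aut_A2 m)"
      by (simp add: conj_by_def k endo_comp_assoc)
    finally have e2: "conj_by (endo_comp b' c) (endo_comp h1 h)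
        = endo_comp (endo_comp (endo_comp b' a) b) (sum_value Aut_A2 m)" .
    have "endo_comp (endo_comp b' a) b \<in> side_group s"
      using S.m_closed[OF S.m_closed[OF b(2) a(1)] b(1)] by simp
    from reduced[OF hh this] e2 have 2: "endo_comp (endo_comp b' a) b = (varX, varY)" by blast
    have "a = endo_comp (inv\<^bsub>Aut_A2\<^esub> b') (endo_comp (endo_comp (endo_comp b' a) b) (inv\<^bsub>Aut_A2\<^esub> b))"
      by (simp add: endo_comp_assoc)
    also have "\<dots> = endo_comp (inv\<^bsub>Aut_A2\<^esub> b') (endo_comp (endo_comp b' b) (inv\<^bsub>Aut_A2\<^esub> b))"
      unfolding 1 2 ..
    also have "\<dots> = (varX, varY)" by (simp add: endo_comp_assoc)
    finally show ?thesis using a(2) by blast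
  qed
qed

theorem bounded_subgroup_conjugate_into_factor:
  fixes H :: "'k::{alg_closed_field, field_char_0} endo set"
  assumes H: "subgroup H Aut_A2" "bounded_degree H" "H \<subseteq> equivariant_Aut"
  shows "\<exists>c\<in>equivariant_Aut. \<exists>s. conj_by c ` H \<subseteq> side_group s"
proof (cases "H \<subseteq> {(varX, varY)}")
  case True
  have "inv\<^bsub>Aut_A2\<^esub> (varX, varY) = ((varX, varY) :: 'k endo)" using Aut.inv_one by simp
  then have "conj_by (varX, varY) ` H \<subseteq> side_group True"
    using True subgroup.one_closed[OF subgroup_side_group[of True]] by (auto simp: conj_by_def)
  moreover have "(varX, varY) \<in> (equivariant_Aut :: 'k endo set)" using shear_equivariant(1)[of 0] by simp
  ultimately show ?thesis by blast
next
  case False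
  then obtain h where h: "h \<in> H" "h \<noteq> (varX, varY)" by blast
  obtain c w where c: "c \<in> equivariant_Aut" and w: "shear_word w" "length w \<le> 1" "conj_by c h = sum_value Aut_A2 w"
    using bounded_element_conjugate_letter[OF H h(1)] by blast
  have cA: "c \<in> carrier Aut_A2" using c by (simp add: equivariant_Aut_def)
  have "conj_by (inv\<^bsub>Aut_A2\<^esub> c) (conj_by c h) = h"
    using cA by (simp add: conj_by_def endo_comp_assoc)
  then have "conj_by c h \<noteq> (varX, varY)" using h(2) cA by (auto simp: conj_by_def)
  moreover have "conj_by c h \<in> side_group (isl (hd w))"
    unfolding w(3) using w(2) by (intro sum_value_side alternating_lists[OF w(1)]) (cases w; auto)
  ultimately have "conj_by c ` H \<subseteq> side_group (isl (hd w))"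
    using bounded_subgroup_in_factor[OF H c h(1)] by blast
  then show ?thesis using c by blast
qed


section \<open>Unipotent subgroups of shears\<close>

definition translation_difference :: "'k::field endo \<Rightarrow> ('k endo \<Rightarrow> 'k) \<Rightarrow> 'k endo \<Rightarrow> 'k" where
  "translation_difference g = (\<lambda>\<psi> x. \<psi> (x \<otimes>\<^bsub>Aut_A2\<^esub> g) - \<psi> x)"

definition locally_unipotent :: "'k::field endo set \<Rightarrow> 'k endo \<Rightarrow> ('k endo \<Rightarrow> 'k) set" where
  "locally_unipotent H g = {f. \<exists>n. \<forall>h\<in>H. (translation_difference g ^^ n) f h = 0}"

lemma iter_translation_add:
  "(translation_difference g ^^ n) (\<lambda>x. f x + f' x)
     = (\<lambda>x. (translation_difference g ^^ n) f x + (translation_difference g ^^ n) f' x)"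
proof -
  have "translation_difference g (\<lambda>x. f x + f' x) = (\<lambda>x. translation_difference g f x + translation_difference g f' x)" for f f'
    by (rule ext) (simp add: translation_difference_def)
  then show ?thesis by (induction n) simp_all
qed

lemma iter_translation_cong:
  assumes "subgroup H Aut_A2" "g \<in> H" "\<And>h. h \<in> H \<Longrightarrow> f h = f' h" "h \<in> H"
  shows "(translation_difference g ^^ n) f h = (translation_difference g ^^ n) f' h"
  using assms(4)
proof (induction n arbitrary: h)
  case (Suc n)
  moreover have "h \<otimes>\<^bsub>Aut_A2\<^esub> g \<in> H" using subgroup.m_closed[OF assms(1) Suc(2) assms(2)] .
  ultimately show ?case by (simp add: translation_difference_def)
qed (use assms(3) in simp)

lemma iter_translation_zero:
  assumes "subgroup H Aut_A2" "g \<in> H" "\<And>h. h \<in> H \<Longrightarrow> f h = 0" "h \<in> H"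
  shows "(translation_difference g ^^ n) f h = 0"
proof -
  have z: "(translation_difference g ^^ n) (\<lambda>_. 0) = (\<lambda>_. 0)"
    by (induction n) (simp_all add: translation_difference_def)
  have "(translation_difference g ^^ n) f h = (translation_difference g ^^ n) (\<lambda>_. 0) h"
    by (rule iter_translation_cong[OF assms(1,2)]) (use assms(3,4) in simp_all)
  then show ?thesis by (simp only: z)
qed

lemma iter_translation_zero_mono:
  assumes "subgroup H Aut_A2" "g \<in> H" "\<And>h. h \<in> H \<Longrightarrow> (translation_difference g ^^ m) f h = 0" "m \<le> n" "h \<in> H"
  shows "(translation_difference g ^^ n) f h = 0"
proof -
  have "(translation_difference g ^^ n) f = (translation_difference g ^^ (n - m)) ((translation_difference g ^^ m) f)"
    using assms(4) by (simp add: funpow_add[THEN fun_cong, unfolded comp_def, symmetric])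
  then show ?thesis using iter_translation_zero[OF assms(1,2,3,5)] by simp
qed

text \<open>From \<open>\<Delta>(f f') = \<Delta>f f' + f \<Delta>f' + \<Delta>f \<Delta>f'\<close> by induction: each summand needs fewer steps to vanish.\<close>

lemma iter_translation_mult:
  assumes "subgroup H Aut_A2" "g \<in> H"
    and "\<And>h. h \<in> H \<Longrightarrow> (translation_difference g ^^ m) f h = 0"
    and "\<And>h. h \<in> H \<Longrightarrow> (translation_difference g ^^ n) f' h = 0" and "h \<in> H"
  shows "(translation_difference g ^^ (m + n)) (\<lambda>x. f x * f' x) h = 0"
  using assms(3,4,5)
proof (induction "m + n" arbitrary: m n f f' h rule: less_induct)
  case less
  let ?D = "translation_difference g"
  consider "m = 0" | "n = 0" | m' n' where "m = Suc m'" "n = Suc n'" by (metis not0_implies_Suc)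
  then show ?case
  proof cases
    case 1
    then have "f h * f' h = 0" if "h \<in> H" for h using less(2)[OF that] by simp
    then show ?thesis by (rule iter_translation_zero[OF assms(1,2) _ less(4)])
  next
    case 2
    then have "f h * f' h = 0" if "h \<in> H" for h using less(3)[OF that] by simp
    then show ?thesis by (rule iter_translation_zero[OF assms(1,2) _ less(4)])
  next
    case 3
    have z: "(?D ^^ m') (?D f) h = 0" "(?D ^^ n') (?D f') h = 0" if "h \<in> H" for h
      using less(2,3)[OF that] unfolding 3 by (simp_all add: funpow_swap1)
    have "?D (\<lambda>x. f x * f' x) = (\<lambda>x. (?D f x * f' x + f x * ?D f' x) + ?D f x * ?D f' x)"
      by (rule ext) (simp add: translation_difference_def algebra_simps)
    then have "(?D ^^ (m + n)) (\<lambda>x. f x * f' x) h = (?D ^^ (m' + n)) (\<lambda>x. (?D f x * f' x + f x * ?D f' x) + ?D f x * ?D f' x) h"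
      unfolding 3 by (simp add: funpow_swap1)
    also have "\<dots> = (?D ^^ (m' + n)) (\<lambda>x. ?D f x * f' x) h + (?D ^^ (m' + n)) (\<lambda>x. f x * ?D f' x) h
        + (?D ^^ (m' + n)) (\<lambda>x. ?D f x * ?D f' x) h"
      unfolding iter_translation_add ..
    also have "(?D ^^ (m' + n)) (\<lambda>x. ?D f x * f' x) h = 0"
      by (rule less(1)) (simp add: 3, rule z(1), assumption, rule less(3), assumption, rule less(4))
    also have "(?D ^^ (m' + n)) (\<lambda>x. f x * ?D f' x) h = 0"
    proof -
      have "(?D ^^ (m + n')) (\<lambda>x. f x * ?D f' x) h = 0"
        by (rule less(1)) (simp add: 3, rule less(2), assumption, rule z(2), assumption, rule less(4))
      then show ?thesis by (simp add: 3)
    qed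
    also have "(?D ^^ (m' + n)) (\<lambda>x. ?D f x * ?D f' x) h = 0"
    proof (rule iter_translation_zero_mono[OF assms(1,2)])
      show "(?D ^^ (m' + n')) (\<lambda>x. ?D f x * ?D f' x) h = 0" if "h \<in> H" for h
        by (rule less(1)) (simp add: 3, rule z(1), assumption, rule z(2), assumption, rule that)
    qed (simp add: 3, rule less(4))
    finally show ?thesis by simp
  qed
qed

lemma scalar_algebra_locally_unipotent:
  assumes "subgroup H Aut_A2" "g \<in> H"
  shows "scalar_algebra (locally_unipotent H g)"
  unfolding scalar_algebra_def
proof (intro conjI allI ballI)
  show "(\<lambda>_. c) \<in> locally_unipotent H g" for c
    unfolding locally_unipotent_def by (rule CollectI, rule exI[of _ 1]) (simp add: translation_difference_def)
  fix f f' assume "f \<in> locally_unipotent H g" "f' \<in> locally_unipotent H g"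
  then obtain m n where mn: "\<And>h. h \<in> H \<Longrightarrow> (translation_difference g ^^ m) f h = 0"
    "\<And>h. h \<in> H \<Longrightarrow> (translation_difference g ^^ n) f' h = 0" unfolding locally_unipotent_def by blast
  have "(translation_difference g ^^ max m n) (\<lambda>x. f x + f' x) h = 0" if "h \<in> H" for h
    unfolding iter_translation_add
    using iter_translation_zero_mono[OF assms mn(1), of "max m n" h] iter_translation_zero_mono[OF assms mn(2), of "max m n" h] that
    by simp
  then show "(\<lambda>x. f x + f' x) \<in> locally_unipotent H g" unfolding locally_unipotent_def by blast
  show "(\<lambda>x. f x * f' x) \<in> locally_unipotent H g"
    unfolding locally_unipotent_def using iter_translation_mult[OF assms mn] by blast
qed

text \<open>On a group conjugate to a group of shears, right translation by \<open>g\<close> changes the coefficients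
  of the shear by constants. All coordinate functions are polynomials in these coefficients.\<close>

theorem unipotent_if_conjugate_to_shears:
  fixes H :: "'k::field endo set"
  assumes H: "algebraic_subgroup H" and c: "c \<in> carrier Aut_A2" and sub: "conj_by c ` H \<subseteq> range shear_x"
  shows "unipotent_algebraic_subgroup H"
  unfolding unipotent_algebraic_subgroup_def
proof (intro conjI ballI H)
  fix g :: "'k endo" and f :: "'k endo \<Rightarrow> 'k"
  assume g: "g \<in> H" and f: "f \<in> regular_functions Aut_ind"
  note [simp del] = mult_pCons_left mult_pCons_right
  have Hs: "subgroup H Aut_A2" using H by (simp add: algebraic_subgroup_def)
  interpret H: subgroup H Aut_A2 by (rule Hs)
  obtain d where "H \<subseteq> strat Aut_ind d" using H unfolding algebraic_subgroup_def by blast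
  then have d: "endo_degree h \<le> d" if "h \<in> H" for h
    using that in_strat_Aut_ind[of h d] by blast
  define D where "D = endo_degree c * d * endo_degree (inv\<^bsub>Aut_A2\<^esub> c)"
  have D: "total_degree (fst (conj_by c h)) \<le> D" if "h \<in> H" for h
  proof -
    have "endo_degree (conj_by c h) \<le> D" unfolding conj_by_def D_def
      by (meson d[OF that] endo_degree_comp le_trans mult_le_mono1 mult_le_mono2)
    then show ?thesis by (simp add: endo_degree_def)
  qed
  let ?S = "locally_unipotent H g"
  note S = scalar_algebra_locally_unipotent[OF Hs g]
  define s where "s k x = cf (fst (conj_by c x)) 0 (3 * k + 2)" for k x
  have coeff: "coeff p k = cf (fst (shear_x p)) 0 (3 * k + 2)" for p :: "'k poly" and k
  proof -
    have "(3 * k + 2) mod 3 = 2" "(3 * k + 2) div 3 = k" by presburger+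
    then show ?thesis unfolding cf_shear_x by simp
  qed
  have s: "s k \<in> ?S" for k
  proof -
    obtain q where q: "conj_by c g = shear_x q" using sub g by blast
    have step: "s k (endo_comp x g) - s k x = coeff q k" if "x \<in> H" for x
    proof -
      from sub that obtain p where p: "conj_by c x = shear_x p" by blast
      then have "conj_by c (endo_comp x g) = shear_x (p + q)" by (simp add: conj_by_mult[OF c] q shear_x_add)
      then show ?thesis unfolding s_def p by (simp only: coeff[symmetric]) simp
    qed
    have "(translation_difference g ^^ 2) (s k) x = 0" if x: "x \<in> H" for x
    proof -
      have "endo_comp x g \<in> H" using H.m_closed[OF x g] by simp
      then have "(s k (endo_comp (endo_comp x g) g) - s k (endo_comp x g)) - (s k (endo_comp x g) - s k x) = 0"
        by (simp only: step x diff_self)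
      then show ?thesis by (simp only: numeral_2_eq_2 translation_difference_def funpow.simps comp_apply id_apply mult_Aut)
    qed
    then show ?thesis unfolding locally_unipotent_def by blast
  qed
  define E where "E e x = (varX + (\<Sum>k\<le>D. cst (e * s k x) * varY ^ (3 * k + 2)), varY :: 'k poly poly)" for e x
  have E: "E e x = shear_x (smult e p)" if "x \<in> H" "conj_by c x = shear_x p" for e x p
  proof -
    have sp: "s k x = coeff p k" for k unfolding s_def that(2) by (simp only: coeff[symmetric])
    have "k \<le> D" if "coeff p k \<noteq> 0" for k
    proof -
      have "cf (fst (shear_x p)) 0 (3 * k + 2) \<noteq> 0" unfolding coeff[symmetric] by (rule that)
      from total_degreeD[OF this] have "3 * k + 2 \<le> total_degree (fst (shear_x p))" by simp
      then show ?thesis using D[OF \<open>x \<in> H\<close>] \<open>conj_by c x = shear_x p\<close> by simp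
    qed
    then have "coeff (smult e p) k = coeff (\<Sum>k\<le>D. monom (e * coeff p k) k) k" for k
      by (auto simp: coeff_sum)
    then have "smult e p = (\<Sum>k\<le>D. monom (e * coeff p k) k)" by (rule poly_eqI)
    moreover have "subst1 (\<Sum>k\<le>D. monom (e * coeff p k) k) P = (\<Sum>k\<le>D. cst (e * coeff p k) * P ^ k)" for P
    proof -
      have "subst1 (\<Sum>k\<in>A. monom (e * coeff p k) k) P = (\<Sum>k\<in>A. cst (e * coeff p k) * P ^ k)" for A :: "nat set"
        by (induction A rule: infinite_finite_induct) (simp_all add: subst1_add subst1_monom)
      then show ?thesis .
    qed
    ultimately show ?thesis
      unfolding E_def shear_x_def sp
      by (simp add: sum_distrib_left power_add power_mult[symmetric] power2_eq_square mult_ac)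
  qed
  have fam: "(\<lambda>x. fst (E e x)) \<in> families ?S" "(\<lambda>x. snd (E e x)) \<in> families ?S" for e
  proof -
    have "(\<lambda>x. e * s k x) \<in> ?S" for k using scalar_algebraD(3)[OF S scalar_algebraD(1)[OF S] s] .
    then show "(\<lambda>x. fst (E e x)) \<in> families ?S"
      unfolding E_def fst_conv by (intro families_add families_const families_sum families_mult families_scalar)
    show "(\<lambda>x. snd (E e x)) \<in> families ?S" unfolding E_def snd_conv by (rule families_const)
  qed
  define Q where "Q e x = endo_comp (inv\<^bsub>Aut_A2\<^esub> c) (endo_comp (E e x) c)" for e x
  have famQ: "(\<lambda>x. fst (Q e x)) \<in> families ?S" "(\<lambda>x. snd (Q e x)) \<in> families ?S" for e
    unfolding Q_def by (intro families_comp families_const fam)+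
  have Q: "x = Q 1 x" "inv\<^bsub>Aut_A2\<^esub> x = Q (- 1) x" if "x \<in> H" for x
  proof -
    from sub that obtain p where p: "conj_by c x = shear_x p" by blast
    have "Q 1 x = endo_comp (inv\<^bsub>Aut_A2\<^esub> c) (endo_comp (conj_by c x) c)"
      unfolding Q_def E[OF that p] p by simp
    then show 1: "x = Q 1 x" using c by (simp add: conj_by_def endo_comp_assoc)
    have EE: "endo_comp (E 1 x) (E (- 1) x) = (varX, varY)" "endo_comp (E (- 1) x) (E 1 x) = (varX, varY)"
      unfolding E[OF that p] by (simp_all add: shear_x_add)
    have "endo_comp (E 1 x) (endo_comp (E (- 1) x) y) = y" "endo_comp (E (- 1) x) (endo_comp (E 1 x) y) = y" for y
      unfolding endo_comp_assoc[symmetric] EE by simp_all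
    then have "endo_comp (Q 1 x) (Q (- 1) x) = (varX, varY)" "endo_comp (Q (- 1) x) (Q 1 x) = (varX, varY)"
      unfolding Q_def using c by (simp_all add: endo_comp_assoc)
    then have "inv\<^bsub>Aut_A2\<^esub> (Q 1 x) = Q (- 1) x" by (rule inv_Aut_eqI)
    then show "inv\<^bsub>Aut_A2\<^esub> x = Q (- 1) x" by (simp only: 1[symmetric])
  qed
  have cong: "\<psi> \<in> ?S" if "\<psi>' \<in> ?S" "\<And>x. x \<in> H \<Longrightarrow> \<psi> x = \<psi>' x" for \<psi> \<psi>'
  proof -
    from that(1) obtain n where n: "\<And>h. h \<in> H \<Longrightarrow> (translation_difference g ^^ n) \<psi>' h = 0"
      unfolding locally_unipotent_def by blast
    have "(translation_difference g ^^ n) \<psi> h = 0" if "h \<in> H" for h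
      using iter_translation_cong[OF Hs g \<open>\<And>x. x \<in> H \<Longrightarrow> \<psi> x = \<psi>' x\<close> that] n[OF that] by simp
    then show ?thesis unfolding locally_unipotent_def by blast
  qed
  have "f \<in> ?S"
    using f
  proof (induction rule: regular_functions.induct)
    case (coord f)
    then obtain i j where "f = (\<lambda>g. cf (fst g) i j) \<or> f = (\<lambda>g. cf (snd g) i j) \<or>
        f = (\<lambda>g. cf (fst (inv\<^bsub>Aut_A2\<^esub> g)) i j) \<or> f = (\<lambda>g. cf (snd (inv\<^bsub>Aut_A2\<^esub> g)) i j)"
      by (auto simp: Aut_ind_def)
    moreover have "(\<lambda>g. cf (fst g) i j) \<in> ?S"
      by (rule cong[OF families_coeff[OF S famQ(1)[of 1]]]) (simp only: Q(1)[symmetric])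
    moreover have "(\<lambda>g. cf (snd g) i j) \<in> ?S"
      by (rule cong[OF families_coeff[OF S famQ(2)[of 1]]]) (simp only: Q(1)[symmetric])
    moreover have "(\<lambda>g. cf (fst (inv\<^bsub>Aut_A2\<^esub> g)) i j) \<in> ?S"
      by (rule cong[OF families_coeff[OF S famQ(1)[of "- 1"]]]) (simp only: Q(2)[symmetric])
    moreover have "(\<lambda>g. cf (snd (inv\<^bsub>Aut_A2\<^esub> g)) i j) \<in> ?S"
      by (rule cong[OF families_coeff[OF S famQ(2)[of "- 1"]]]) (simp only: Q(2)[symmetric])
    ultimately show ?case by auto
  qed (rule scalar_algebraD[OF S]; assumption?)+
  then show "\<exists>n. \<forall>h\<in>H. ((\<lambda>\<psi> x. \<psi> (x \<otimes>\<^bsub>Aut_A2\<^esub> g) - \<psi> x) ^^ n) f h = 0"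
    unfolding locally_unipotent_def translation_difference_def by blast
qed

section \<open>Algebraic subgroups and the group of shears\<close>

lemma comm_group_if_conjugate_to_shears:
  assumes H: "subgroup H Aut_A2" and c: "c \<in> carrier Aut_A2" and sub: "conj_by c ` H \<subseteq> range shear_x"
  shows "comm_group (Aut_A2\<lparr>carrier := H\<rparr>)"
proof (rule group.group_comm_groupI[OF Aut.subgroup_imp_group[OF H]])
  fix x y assume "x \<in> carrier (Aut_A2\<lparr>carrier := H\<rparr>)" "y \<in> carrier (Aut_A2\<lparr>carrier := H\<rparr>)"
  then have xy: "x \<in> H" "y \<in> H" by simp_all
  obtain p where p: "conj_by c x = shear_x p" using sub xy(1) by blast
  obtain q where q: "conj_by c y = shear_x q" using sub xy(2) by blast
  have "conj_by c (endo_comp x y) = conj_by c (endo_comp y x)"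
    by (simp add: conj_by_mult[OF c] p q shear_x_add add.commute)
  then have "endo_comp (inv\<^bsub>Aut_A2\<^esub> c) (endo_comp (conj_by c (endo_comp x y)) c)
      = endo_comp (inv\<^bsub>Aut_A2\<^esub> c) (endo_comp (conj_by c (endo_comp y x)) c)" by (simp only:)
  then have "endo_comp x y = endo_comp y x" using c by (simp add: conj_by_def endo_comp_assoc)
  then show "x \<otimes>\<^bsub>Aut_A2\<lparr>carrier := H\<rparr>\<^esub> y = y \<otimes>\<^bsub>Aut_A2\<lparr>carrier := H\<rparr>\<^esub> x" by simp
qed

lemma conj_by_id: "conj_by (varX, varY) h = h"
proof -
  have "inv\<^bsub>Aut_A2\<^esub> (varX, varY) = ((varX, varY) :: 'a endo)" by (rule inv_Aut_eqI) simp_all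
  then show ?thesis by (simp add: conj_by_def)
qed

lemma conj_by_swap_shear_y: "conj_by (varY, varX) (shear_y f) = shear_x f"
proof -
  have tt: "endo_comp (varY, varX) (varY, varX) = ((varX, varY) :: 'a endo)"
    by (simp add: endo_comp_def subst2_varX subst2_varY)
  have inv: "inv\<^bsub>Aut_A2\<^esub> (varY, varX) = ((varY, varX) :: 'a endo)" by (rule inv_Aut_eqI[OF tt tt])
  have ttg: "endo_comp (varY, varX) (endo_comp (varY, varX) g) = g" for g :: "'a endo"
    by (simp only: endo_comp_assoc[symmetric] tt endo_comp_id)
  show ?thesis
    unfolding conj_by_def swap_shear[symmetric] inv by (simp only: endo_comp_assoc tt ttg endo_comp_id)
qed

text \<open>Conjugation by the swap exchanges the two factors.\<close>

lemma conjugate_to_shear_x: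
  assumes c: "c \<in> carrier Aut_A2" and sub: "conj_by c ` H \<subseteq> side_group s"
  shows "\<exists>b\<in>carrier Aut_A2. conj_by b ` H \<subseteq> range shear_x"
proof (cases s)
  case True
  then show ?thesis using assms by (auto simp: side_group_def)
next
  case False
  have "endo_comp (varY, varX) c \<in> carrier Aut_A2" using Aut.m_closed[OF swap_in_Aut c] by simp
  moreover have "conj_by (endo_comp (varY, varX) c) h \<in> range shear_x" if "h \<in> H" for h
  proof -
    from sub False that obtain f where "conj_by c h = shear_y f" unfolding side_group_def by auto
    then have "conj_by (endo_comp (varY, varX) c) h = shear_x f"
      using conj_by_comp[OF swap_in_Aut c, of h] by (simp add: conj_by_swap_shear_y)
    then show ?thesis by blast
  qed
  ultimately show ?thesis by blast
qed

lemma algebraic_subgroup_bounded: "algebraic_subgroup H \<Longrightarrow> bounded_degree H"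
  unfolding algebraic_subgroup_def bounded_degree_def using in_strat_Aut_ind by blast

text \<open>Algebraic subgroups are bounded, hence conjugate into one of the two factors. Conjugating further
  by the swap, if necessary, reduces commutativity and unipotency to groups of shears \<open>shear_x f\<close>.\<close>

theorem algebraic_subgroup_of_equivariant_Aut:
  fixes H :: "'k::{alg_closed_field, field_char_0} endo set"
  assumes H: "algebraic_subgroup H" "H \<subseteq> equivariant_Aut"
  shows "comm_group (Aut_A2\<lparr>carrier := H\<rparr>)" "unipotent_algebraic_subgroup H"
    and "\<exists>c\<in>equivariant_Aut. conj_by c ` H \<subseteq> range shear_x \<or> conj_by c ` H \<subseteq> range shear_y"
proof -
  have Hs: "subgroup H Aut_A2" using H(1) by (simp add: algebraic_subgroup_def)
  obtain c s where c: "c \<in> equivariant_Aut" "conj_by c ` H \<subseteq> side_group s"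
    using bounded_subgroup_conjugate_into_factor[OF Hs algebraic_subgroup_bounded[OF H(1)] H(2)] by blast
  then have cA: "c \<in> carrier Aut_A2" by (simp add: equivariant_Aut_def)
  obtain b where b: "b \<in> carrier Aut_A2" "conj_by b ` H \<subseteq> range shear_x"
    using conjugate_to_shear_x[OF cA c(2)] by blast
  show "comm_group (Aut_A2\<lparr>carrier := H\<rparr>)" by (rule comm_group_if_conjugate_to_shears[OF Hs b])
  show "unipotent_algebraic_subgroup H" by (rule unipotent_if_conjugate_to_shears[OF H(1) b])
  show "\<exists>c\<in>equivariant_Aut. conj_by c ` H \<subseteq> range shear_x \<or> conj_by c ` H \<subseteq> range shear_y"
    using c by (cases s) (auto simp: side_group_def)
qed

lemma coeff_shear_x: "cf (fst (shear_x p)) 0 (3 * k + 2) = coeff p k"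
proof -
  have "(3 * k + 2) mod 3 = 2" "(3 * k + 2) div 3 = k" by presburger+
  then show ?thesis unfolding cf_shear_x by simp
qed

lemma endo_degree_shear_x: "degree f \<le> n \<Longrightarrow> endo_degree (shear_x f) \<le> 3 * n + 2"
proof -
  assume n: "degree f \<le> n"
  have "total_degree (fst (shear_x f)) \<le> 3 * n + 2"
    unfolding total_degree_le_iff
  proof (intro allI impI)
    fix i j assume nz: "cf (fst (shear_x f)) i j \<noteq> 0"
    consider "i = 1" "j = 0" | "i = 0" "j mod 3 = 2" "coeff f (j div 3) \<noteq> 0"
      using nz unfolding cf_shear_x by (auto split: if_splits)
    then show "i + j \<le> 3 * n + 2"
    proof cases
      case 2
      then have "j div 3 \<le> n" using le_degree n le_trans by blast
      then show ?thesis using 2(1,2) by presburger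
    qed simp
  qed
  then show ?thesis by (simp add: endo_degree_def shear_x_def)
qed

text \<open>The shears of bounded degree form an algebraic subgroup, and it is unipotent because it already
  consists of shears.\<close>

lemma nested_unipotent_shear_x: "nested_unipotent (range (shear_x :: 'k::field poly \<Rightarrow> _))"
  unfolding nested_unipotent_def
proof (intro exI conjI allI)
  define U where "U n = shear_x ` {f :: 'k poly. degree f \<le> n}" for n
  fix n
  have "subgroup (U n) Aut_A2"
  proof (rule Aut.subgroupI)
    show "U n \<subseteq> carrier Aut_A2" using shear_in_Aut by (auto simp: U_def)
    show "U n \<noteq> {}" by (auto simp: U_def intro: exI[of _ 0])
    show "inv\<^bsub>Aut_A2\<^esub> a \<in> U n" if a: "a \<in> U n" for a
    proof -
      obtain f where "degree f \<le> n" "a = shear_x f" using a unfolding U_def by blast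
      then show ?thesis unfolding U_def by (intro image_eqI[of _ _ "- f"]) (simp_all add: inv_shear)
    qed
    show "a \<otimes>\<^bsub>Aut_A2\<^esub> b \<in> U n" if ab: "a \<in> U n" "b \<in> U n" for a b
    proof -
      obtain f g where "degree f \<le> n" "a = shear_x f" "degree g \<le> n" "b = shear_x g" using ab unfolding U_def by blast
      then show ?thesis unfolding U_def
        by (intro image_eqI[of _ _ "f + g"]) (simp_all add: shear_x_add degree_add_le)
    qed
  qed
  moreover have "U n \<subseteq> strat Aut_ind (3 * n + 2)"
  proof
    fix g assume "g \<in> U n"
    then obtain f where f: "degree f \<le> n" "g = shear_x f" unfolding U_def by blast
    then show "g \<in> strat Aut_ind (3 * n + 2)"
      using endo_degree_shear_x[of f n] endo_degree_shear_x[of "- f" n]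
      by (simp add: in_strat_Aut_ind shear_in_Aut inv_shear)
  qed
  moreover have "closedin (ind_topology Aut_ind) (U n)"
  proof -
    let ?X = "{(0, j, 0) | j. j > 3 * n + 2} :: (nat \<times> nat \<times> 'k) set"
    have "range shear_x \<inter> {g \<in> carrier Aut_A2. (\<forall>(i, j, c)\<in>?X. cf (fst g) i j = c) \<and> (\<forall>(i, j, c)\<in>{}. cf (snd g) i j = c)} = U n"
    proof (intro subset_antisym subsetI)
      fix g assume "g \<in> range shear_x \<inter> {g \<in> carrier Aut_A2. (\<forall>(i, j, c)\<in>?X. cf (fst g) i j = c) \<and> (\<forall>(i, j, c)\<in>{}. cf (snd g) i j = c)}"
      then obtain f where f: "g = shear_x f" and z: "\<forall>(i, j, c)\<in>?X. cf (fst g) i j = c" by blast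
      have "coeff f k = 0" if "k > n" for k
      proof -
        have "(0, 3 * k + 2, 0) \<in> ?X" using that by simp
        from bspec[OF z this] have "cf (fst g) 0 (3 * k + 2) = 0" by simp
        then show ?thesis unfolding f coeff_shear_x .
      qed
      then have "degree f \<le> n" by (intro degree_le) blast
      then show "g \<in> U n" unfolding U_def f by blast
    next
      fix g assume "g \<in> U n"
      then obtain f where f: "degree f \<le> n" "g = shear_x f" unfolding U_def by blast
      have "cf (fst g) 0 j = 0" if "j > 3 * n + 2" for j
        using endo_degree_shear_x[OF f(1)] that unfolding f(2) endo_degree_def by (intro cf_eq_0_if_degree) simp
      then show "g \<in> range shear_x \<inter> {g \<in> carrier Aut_A2. (\<forall>(i, j, c)\<in>?X. cf (fst g) i j = c) \<and> (\<forall>(i, j, c)\<in>{}. cf (snd g) i j = c)}"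
        unfolding f(2) using shear_in_Aut(1)[of f] by auto
    qed
    moreover have "closedin (ind_topology Aut_ind) (range shear_x \<inter> {g \<in> carrier Aut_A2. (\<forall>(i, j, c)\<in>?X. cf (fst g) i j = c) \<and> (\<forall>(i, j, c)\<in>{}. cf (snd g) i j = c)})"
      by (rule closedin_Int[OF closedin_shear_x closedin_coeff_conditions])
    ultimately show ?thesis by (simp only:)
  qed
  ultimately have alg: "algebraic_subgroup (U n)"
    unfolding algebraic_subgroup_def using openin_topspace[of "ind_topology (Aut_ind :: ('k endo, 'k) ind_variety)"]
      closedin_subset[of "ind_topology Aut_ind" "U n"] by (metis inf.absorb2)
  have "(varX, varY) \<in> carrier Aut_A2" using Aut.one_closed by simp
  then show "unipotent_algebraic_subgroup (U n)"
    by (rule unipotent_if_conjugate_to_shears[OF alg]) (auto simp: conj_by_id U_def)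
  show "U n \<subseteq> U (Suc n)" unfolding U_def by (intro image_mono) auto
  show "range shear_x = (\<Union>n. U n)" unfolding U_def by blast
qed

text \<open>The coefficients of \<open>f\<close> are coordinates of \<open>shear_x f\<close>, and every other coordinate of this
  automorphism or of its inverse \<open>shear_x (- f)\<close> is constant or the negative of a coefficient.\<close>

lemma ind_group_isomorphic_shear_x:
  defines "J \<equiv> range (shear_x :: 'k::field poly \<Rightarrow> _)"
  shows "ind_group_isomorphic (Aut_A2\<lparr>carrier := J\<rparr>) (ind_subvariety Aut_ind J) poly_add_group poly_ind"
proof -
  define \<phi> where "\<phi> = inv_into UNIV (shear_x :: 'k poly \<Rightarrow> _)"
  have "inj (shear_x :: 'k poly \<Rightarrow> _)" by (rule injI) (simp add: shear_inj)
  then have \<phi>: "\<phi> (shear_x f) = f" for f unfolding \<phi>_def by (rule inv_f_f)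
  have \<phi>_coeff: "coeff (\<phi> g) k = cf (fst g) 0 (3 * k + 2)" if "g \<in> J" for g k
  proof -
    from that obtain f where "g = shear_x f" unfolding J_def by blast
    then show ?thesis by (simp only: \<phi> coeff_shear_x)
  qed
  have bij: "bij_betw \<phi> J UNIV"
    by (rule bij_betw_byWitness[where f' = shear_x]) (auto simp: J_def \<phi>)
  have iso: "\<phi> \<in> iso (Aut_A2\<lparr>carrier := J\<rparr>) poly_add_group"
    unfolding iso_def poly_add_group_def using bij by (auto simp: hom_def J_def \<phi> shear_x_add)
  have inverse: "inv_into (carrier (Aut_A2\<lparr>carrier := J\<rparr>)) \<phi> = shear_x"
  proof (rule ext)
    show "inv_into (carrier (Aut_A2\<lparr>carrier := J\<rparr>)) \<phi> f = shear_x f" for f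
      using bij by (intro inv_into_f_eq) (auto simp: bij_betw_def J_def \<phi>)
  qed
  have 1: "ind_morphism (ind_subvariety Aut_ind J) poly_ind \<phi>"
    unfolding ind_morphism_def
  proof (intro allI exI conjI ballI)
    fix d
    show "\<phi> ` strat (ind_subvariety Aut_ind J) d \<subseteq> strat poly_ind d"
    proof
      fix f assume "f \<in> \<phi> ` strat (ind_subvariety Aut_ind J) d"
      then obtain g where g: "g \<in> strat Aut_ind d" "g \<in> J" "f = \<phi> g" by (auto simp: ind_subvariety_def)
      have "coeff f k = 0" if "k > d" for k
        using that g in_strat_Aut_ind[of g d] unfolding g(3) \<phi>_coeff[OF g(2)]
        by (intro cf_eq_0_if_degree) (auto simp: endo_degree_def)
      then have "degree f \<le> d" by (intro degree_le) blast
      then show "f \<in> strat poly_ind d" by (simp add: poly_ind_def)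
    qed
    fix f assume "f \<in> regular_functions (poly_ind :: ('k poly, 'k) ind_variety)"
    then show "\<exists>g\<in>regular_functions (ind_subvariety Aut_ind J). \<forall>x\<in>strat (ind_subvariety Aut_ind J) d. f (\<phi> x) = g x"
    proof (induction rule: regular_functions.induct)
      case (coord f)
      then obtain k where f: "f = (\<lambda>f. coeff f k)" by (auto simp: poly_ind_def)
      have "(\<lambda>g. cf (fst g) 0 (3 * k + 2)) \<in> coords (ind_subvariety Aut_ind J)"
        unfolding ind_subvariety_def Aut_ind_def ind_variety.simps by blast
      then have "(\<lambda>g. cf (fst g) 0 (3 * k + 2)) \<in> regular_functions (ind_subvariety Aut_ind J)"
        by (rule regular_functions.coord)
      moreover have "\<forall>x\<in>strat (ind_subvariety Aut_ind J) d. f (\<phi> x) = cf (fst x) 0 (3 * k + 2)"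
        unfolding f using \<phi>_coeff by (simp add: ind_subvariety_def)
      ultimately show ?case by (intro bexI[of _ "\<lambda>g. cf (fst g) 0 (3 * k + 2)"])
    next
      case (const c)
      show ?case by (rule bexI[OF _ regular_functions.const[of c]]) simp
    next
      case (add f f')
      then obtain g g' where "g \<in> regular_functions (ind_subvariety Aut_ind J)" "g' \<in> regular_functions (ind_subvariety Aut_ind J)"
        "\<forall>x\<in>strat (ind_subvariety Aut_ind J) d. f (\<phi> x) = g x" "\<forall>x\<in>strat (ind_subvariety Aut_ind J) d. f' (\<phi> x) = g' x"
        by blast
      then show ?case by (intro bexI[OF _ regular_functions.add[of g _ g']]) auto
    next
      case (mult f f')
      then obtain g g' where "g \<in> regular_functions (ind_subvariety Aut_ind J)" "g' \<in> regular_functions (ind_subvariety Aut_ind J)"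
        "\<forall>x\<in>strat (ind_subvariety Aut_ind J) d. f (\<phi> x) = g x" "\<forall>x\<in>strat (ind_subvariety Aut_ind J) d. f' (\<phi> x) = g' x"
        by blast
      then show ?case by (intro bexI[OF _ regular_functions.mult[of g _ g']]) auto
    qed
  qed
  have coord_reg: "(\<lambda>f. e * coeff f k) \<in> regular_functions (poly_ind :: ('k poly, 'k) ind_variety)" for k e
    by (rule regular_functions.mult[OF regular_functions.const regular_functions.coord]) (auto simp: poly_ind_def)
  have coeff_reg: "(\<lambda>f. cf (fst (shear_x (smult e f))) i j) \<in> regular_functions (poly_ind :: ('k poly, 'k) ind_variety)" for e i j
    unfolding cf_shear_x coeff_smult using coord_reg regular_functions.const
    by (cases "(i, j) = (1, 0)"; cases "i = 0 \<and> j mod 3 = 2") auto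
  have 2: "ind_morphism poly_ind (ind_subvariety Aut_ind J) (inv_into (carrier (Aut_A2\<lparr>carrier := J\<rparr>)) \<phi>)"
    unfolding ind_morphism_def inverse
  proof (intro allI exI conjI ballI)
    fix d
    show "shear_x ` strat poly_ind d \<subseteq> strat (ind_subvariety Aut_ind J) (3 * d + 2)"
    proof
      fix g :: "'k endo" assume "g \<in> shear_x ` strat poly_ind d"
      then obtain f where f: "g = shear_x f" "degree f \<le> d" by (auto simp: poly_ind_def)
      then show "g \<in> strat (ind_subvariety Aut_ind J) (3 * d + 2)"
        using endo_degree_shear_x[of f d] endo_degree_shear_x[of "- f" d]
        by (simp add: ind_subvariety_def in_strat_Aut_ind shear_in_Aut inv_shear J_def)
    qed
    fix f assume "f \<in> regular_functions (ind_subvariety Aut_ind J)"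
    then have "(\<lambda>p. f (shear_x p)) \<in> regular_functions (poly_ind :: ('k poly, 'k) ind_variety)"
    proof (induction rule: regular_functions.induct)
      case (coord f)
      then obtain i j where "f = (\<lambda>g. cf (fst g) i j) \<or> f = (\<lambda>g. cf (snd g) i j) \<or>
          f = (\<lambda>g. cf (fst (inv\<^bsub>Aut_A2\<^esub> g)) i j) \<or> f = (\<lambda>g. cf (snd (inv\<^bsub>Aut_A2\<^esub> g)) i j)"
        by (auto simp: Aut_ind_def ind_subvariety_def)
      moreover have "snd (shear_x p) = varY" for p :: "'k poly" by (simp add: shear_x_def)
      ultimately show ?case
        using coeff_reg[where e = 1 and i = i and j = j] coeff_reg[where e = "- 1" and i = i and j = j] regular_functions.const[of "cf varY i j"] by (auto simp: inv_shear)
    qed (simp_all add: regular_functions.intros)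
    then show "\<exists>g\<in>regular_functions poly_ind. \<forall>x\<in>strat poly_ind d. f (shear_x x) = g x"
      by (rule bexI[rotated]) simp
  qed
  show ?thesis unfolding ind_group_isomorphic_def using iso 1 2 by blast
qed


section \<open>The centralizer of the two quadratic shears\<close>

lemma eval2_simps:
  "eval2 (p + q) z = eval2 p z + eval2 q z" "eval2 (p * q) z = eval2 p z * eval2 q z"
  "eval2 (p ^ n) z = eval2 p z ^ n" "eval2 varX z = fst z" "eval2 varY z = snd z" "eval2 (cst c) z = c"
  by (simp_all add: eval2_def varX_def varY_def)

lemma eval2_subst1: "eval2 (subst1 f P) z = poly f (eval2 P z)"
  by (induction f) (simp_all add: subst1_pCons eval2_simps del: mult_pCons_left, simp add: eval2_def)

text \<open>The value at \<open>0\<close> is taken at all multiples of the period, which are infinitely many.\<close>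

lemma periodic_poly_const:
  fixes p :: "'a::{idom, ring_char_0} poly"
  assumes "pcompose p [:c, 1:] = p" "c \<noteq> 0"
  shows "degree p = 0"
proof -
  have step: "poly p (z + c) = poly p z" for z
    using arg_cong[OF assms(1), of "\<lambda>q. poly q z"] by (simp add: poly_pcompose add.commute)
  have "poly p (of_nat n * c) = poly p 0" for n
  proof (induction n)
    case (Suc n)
    then show ?case using step[of "of_nat n * c"] by (simp add: algebra_simps)
  qed simp
  then have "range (\<lambda>n. of_nat n * c) \<subseteq> {z. poly (p - [:poly p 0:]) z = 0}" by auto
  moreover have "infinite (range (\<lambda>n. of_nat n * c))"
    using assms(2) by (intro range_inj_infinite injI) simp
  ultimately have "infinite {z. poly (p - [:poly p 0:]) z = 0}" using finite_subset by blast
  then have "p - [:poly p 0:] = 0" using poly_roots_finite by blast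
  then show ?thesis by (metis degree_pCons_0 eq_iff_diff_eq_0)
qed

lemma subst2_varX_left: "subst2 p (varX, q) = pcompose p q"
  by (induction p) (simp_all add: subst2_pCons subst1_varX pcompose_pCons)

text \<open>Up to the constant term the polynomial is additive; doubling the argument multiplies the
  coefficient of degree \<open>n\<close> by \<open>2\<^bsup>n\<^esup>\<close>, which equals \<open>2\<close> only for \<open>n = 1\<close>.\<close>

lemma additive_poly_linear:
  fixes p :: "'k::field_char_0 poly"
  assumes "\<And>a b. poly p (a + b) = poly p a + poly p b - poly p 0"
  shows "p = [:coeff p 0, coeff p 1:]"
proof -
  define q where "q = p - [:poly p 0:]"
  have "poly (pcompose q [:0, 2:]) a = poly (smult 2 q) a" for a
    using assms[of a a] by (simp add: q_def poly_pcompose algebra_simps)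
  then have "poly (pcompose q [:0, 2:]) = poly (smult 2 q)" by (rule ext)
  then have qq: "pcompose q [:0, 2:] = smult 2 q" unfolding poly_eq_poly_eq_iff .
  have two: "2 ^ n * coeff q n = 2 * coeff q n" for n
    using coeff_pcompose_linear[of q 2 n] unfolding qq by simp
  have q: "coeff q n = 0" if "n \<noteq> 1" for n
  proof -
    have "(2 :: 'k) ^ n \<noteq> 2"
    proof
      assume "(2 :: 'k) ^ n = 2"
      then have "of_nat (2 ^ n) = (of_nat 2 :: 'k)" by simp
      then have "(2 :: nat) ^ n = 2 ^ 1" unfolding of_nat_eq_iff by simp
      then show False using that power_inject_exp[of "2 :: nat" n 1] by simp
    qed
    then show ?thesis using two[of n] by simp
  qed
  have "coeff p n = coeff [:coeff p 0, coeff p 1:] n" for n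
  proof (cases "n \<le> 1")
    case True
    then have "n = 0 \<or> n = 1" by auto
    then show ?thesis by auto
  next
    case False
    then obtain m where "n = Suc (Suc m)" by (metis One_nat_def Suc_le_mono le0 not0_implies_Suc)
    then show ?thesis using q[of n] by (simp add: q_def)
  qed
  then show ?thesis by (rule poly_eqI)
qed

lemma cube_root_in_Aut:
  assumes "\<zeta> ^ 3 = (1 :: 'k::field)"
  shows "(scale2 \<zeta> varX, scale2 (\<zeta> ^ 2) varY) \<in> carrier Aut_A2"
proof -
  have z: "\<zeta> * \<zeta> ^ 2 = 1" "\<zeta> ^ 2 * \<zeta> = 1" using assms by (simp_all add: power3_eq_cube power2_eq_square mult.assoc)
  have s: "scale2 a (scale2 b p) = scale2 (a * b) p" "scale2 1 p = p" for a b :: 'k and p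
    by (simp_all add: scale2_def one_pCons[symmetric] mult.commute)
  have c: "subst2 (scale2 a p) g = scale2 a (subst2 p g)" for a :: 'k and p g
    by (simp add: scale2_eq subst2_mult del: mult_pCons_left)
  show ?thesis
    by (rule carrier_AutI[where h = "(scale2 (\<zeta> ^ 2) varX, scale2 \<zeta> varY)"])
      (simp_all only: endo_comp_def fst_conv snd_conv c subst2_varX subst2_varY s z)
qed

text \<open>If \<open>(f, h)\<close> commutes with both shears, then \<open>h\<close> is periodic in \<open>x\<close> and \<open>f\<close> is periodic in \<open>y\<close>. The
  remaining equations \<open>f(x + y\<^sup>2) = f(x) + h(y)\<^sup>2\<close> and \<open>h(y + x\<^sup>2) = h(y) + f(x)\<^sup>2\<close> make \<open>f\<close> and \<open>h\<close>
  additive up to constants, hence linear, and then determine the coefficients.\<close>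

lemma commutes_with_shears_imp_cube_root:
  fixes g :: "'k::{alg_closed_field, field_char_0} endo"
  assumes g: "g \<in> carrier Aut_A2" and u: "endo_comp g (shear_x 1) = endo_comp (shear_x 1) g"
    and v: "endo_comp g (shear_y 1) = endo_comp (shear_y 1) g"
  shows "\<exists>\<zeta>. \<zeta> ^ 3 = 1 \<and> g = (scale2 \<zeta> varX, scale2 (\<zeta> ^ 2) varY)"
proof -
  obtain f h where fh: "g = (f, h)" by fastforce
  have ux: "shear_x 1 = ((varX + varY ^ 2, varY) :: 'k endo)" and vy: "shear_y 1 = ((varX, varY + varX ^ 2) :: 'k endo)"
    by (simp_all add: shear_x_def shear_y_def subst1_1)
  have fu: "subst2 f (varX + varY ^ 2, varY) = f + h ^ 2" and hu: "subst2 h (varX + varY ^ 2, varY) = h"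
    using u unfolding ux fh by (simp_all add: endo_comp_def subst2_simps)
  have fv: "subst2 f (varX, varY + varX ^ 2) = f" and hv: "subst2 h (varX, varY + varX ^ 2) = h + f ^ 2"
    using v unfolding vy fh by (simp_all add: endo_comp_def subst2_simps)
  have X2: "varY + varX ^ 2 = [:[:0, 1:] ^ 2, 1 :: 'k poly:]"
    by (simp add: varX_def varY_def power2_eq_square)
  have ne: "[:0, 1 :: 'k:] ^ 2 \<noteq> 0" by simp
  have "degree f = 0"
    using fv unfolding subst2_varX_left X2 by (rule periodic_poly_const[OF _ ne])
  then obtain f0 where f0: "f = [:f0:]" by (metis degree_eq_zeroE)
  define h' where "h' = subst2 h (varY, varX)"
  have "subst2 h' (varX, varY + varX ^ 2) = subst2 (subst2 h (varX + varY ^ 2, varY)) (varY, varX)"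
    unfolding h'_def subst2_subst2 by (simp add: endo_comp_def subst2_simps)
  then have "subst2 h' (varX, varY + varX ^ 2) = h'" unfolding hu h'_def .
  then have "degree h' = 0"
    unfolding subst2_varX_left X2 by (rule periodic_poly_const[OF _ ne])
  then obtain h0 where h0': "h' = [:h0:]" by (metis degree_eq_zeroE)
  have "h = subst2 h' (varY, varX)"
    unfolding h'_def subst2_subst2 by (simp add: endo_comp_def subst2_varX subst2_varY subst2_id)
  then have h0: "h = subst1 h0 varY" by (simp add: h0' subst2_const)
  have f0': "f = subst1 f0 varX" by (simp add: f0 subst1_varX)
  have F: "poly f0 (a + b ^ 2) = poly f0 a + poly h0 b ^ 2" for a b
    using arg_cong[OF fu, of "\<lambda>p. eval2 p (a, b)"]
    unfolding f0' h0 subst2_subst1 subst2_varX fst_conv by (simp add: eval2_simps eval2_subst1)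
  have G: "poly h0 (b + a ^ 2) = poly h0 b + poly f0 a ^ 2" for a b
    using arg_cong[OF hv, of "\<lambda>p. eval2 p (a, b)"]
    unfolding f0' h0 subst2_subst1 subst2_varY snd_conv by (simp add: eval2_simps eval2_subst1)
  have sqrt: "\<exists>b. b ^ 2 = c" for c :: 'k using nth_root_exists[of 2 c] by simp
  have "poly f0 (a + c) = poly f0 a + poly f0 c - poly f0 0" for a c
  proof -
    obtain b where "b ^ 2 = c" using sqrt by blast
    then show ?thesis using F[of a b] F[of 0 b] by simp
  qed
  from additive_poly_linear[OF this] obtain \<alpha> \<beta> where f1: "f0 = [:\<beta>, \<alpha>:]" by blast
  have "poly h0 (a + c) = poly h0 a + poly h0 c - poly h0 0" for a c
  proof -
    obtain b where "b ^ 2 = c" using sqrt by blast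
    then show ?thesis using G[of a b] G[of 0 b] by simp
  qed
  from additive_poly_linear[OF this] obtain \<gamma> \<delta> where h1: "h0 = [:\<delta>, \<gamma>:]" by blast
  have \<delta>: "\<delta> = 0" using F[of 0 0] by (simp add: f1 h1)
  have \<beta>: "\<beta> = 0" using G[of 0 0] by (simp add: f1 h1)
  have ab: "\<alpha> = \<gamma> ^ 2" "\<gamma> = \<alpha> ^ 2" using F[of 0 1] G[of 0 1] by (simp_all add: f1 h1 \<delta> \<beta>)
  have "\<alpha> \<noteq> 0"
  proof
    assume "\<alpha> = 0"
    then have "f = 0" by (simp add: f0 f1 \<beta>)
    then obtain k where "endo_comp (0, h) k = (varX, varY)" using g unfolding fh carrier_Aut_iff by blast
    then have "varX = (0 :: 'k poly poly)" by (simp add: endo_comp_def)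
    then show False by (simp add: varX_def)
  qed
  moreover have "\<alpha> * \<alpha> ^ 3 = \<alpha> * 1" using ab by (simp add: power2_eq_square power3_eq_cube mult_ac)
  ultimately have "\<alpha> ^ 3 = 1" by (metis mult_left_cancel)
  moreover have "f = scale2 \<alpha> varX" by (simp add: f0 f1 \<beta> scale2_def varX_def)
  moreover have "h = scale2 (\<alpha> ^ 2) varY"
    unfolding h0 h1 \<delta> ab(2)[symmetric] scale2_eq by (simp add: subst1_pCons mult.commute)
  ultimately show ?thesis unfolding fh by blast
qed

lemma tangent_to_identity_iff:
  fixes g :: "'k::field_char_0 endo"
  shows "endo_point g (0, 0) = (0, 0) \<and> differential_at g (0, 0) = id \<longleftrightarrow>
    cf (fst g) 0 0 = 0 \<and> cf (snd g) 0 0 = 0 \<and> cf (fst g) 1 0 = 1 \<and> cf (fst g) 0 1 = 0 \<and>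
    cf (snd g) 1 0 = 0 \<and> cf (snd g) 0 1 = 1"
proof -
  have e: "eval2 p (0, 0) = cf p 0 0" for p :: "'k poly poly"
    by (simp add: eval2_def poly_0_coeff_0)
  have x: "eval2 (partial_x p) (0, 0) = cf p 1 0" and y: "eval2 (partial_y p) (0, 0) = cf p 0 1" for p :: "'k poly poly"
    by (simp_all add: e cf_partial_x cf_partial_y)
  have "differential_at g (0, 0) = id \<longleftrightarrow> cf (fst g) 1 0 = 1 \<and> cf (fst g) 0 1 = 0 \<and> cf (snd g) 1 0 = 0 \<and> cf (snd g) 0 1 = 1"
  proof
    assume "differential_at g (0, 0) = id"
    then have "differential_at g (0, 0) (1, 0) = (1, 0)" "differential_at g (0, 0) (0, 1) = (0, 1)" by simp_all
    then show "cf (fst g) 1 0 = 1 \<and> cf (fst g) 0 1 = 0 \<and> cf (snd g) 1 0 = 0 \<and> cf (snd g) 0 1 = 1"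
      unfolding differential_at_def x y by simp
  next
    assume "cf (fst g) 1 0 = 1 \<and> cf (fst g) 0 1 = 0 \<and> cf (snd g) 1 0 = 0 \<and> cf (snd g) 0 1 = 1"
    then show "differential_at g (0, 0) = id" unfolding differential_at_def x y by (auto simp: fun_eq_iff)
  qed
  then show ?thesis unfolding endo_point_def e by auto
qed

lemma equivariant_Aut_iff_commutes:
  fixes g :: "'k::{alg_closed_field, field_char_0} endo"
  shows "g \<in> equivariant_Aut \<longleftrightarrow> g \<in> carrier Aut_A2 \<and> endo_point g (0, 0) = (0, 0) \<and> differential_at g (0, 0) = id \<and>
    (\<forall>\<zeta>. \<zeta> ^ 3 = 1 \<longrightarrow> endo_comp g (scale2 \<zeta> varX, scale2 (\<zeta> ^ 2) varY) = endo_comp (scale2 \<zeta> varX, scale2 (\<zeta> ^ 2) varY) g)"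
proof -
  have "endo_comp (scale2 \<zeta> varX, scale2 (\<zeta> ^ 2) varY) g = (scale2 (\<zeta> ^ 1) (fst g), scale2 (\<zeta> ^ 2) (snd g))" for \<zeta>
    by (simp add: endo_comp_def scale2_eq subst2_simps del: mult_pCons_left)
  then have "graded 1 (fst g) \<and> graded 2 (snd g) \<longleftrightarrow>
    (\<forall>\<zeta>. \<zeta> ^ 3 = 1 \<longrightarrow> endo_comp g (scale2 \<zeta> varX, scale2 (\<zeta> ^ 2) varY) = endo_comp (scale2 \<zeta> varX, scale2 (\<zeta> ^ 2) varY) g)"
    using graded_iff_semi_invariant[of 1 "fst g"] graded_iff_semi_invariant[of 2 "snd g"]
    by (auto simp: endo_comp_def[of g])
  moreover have "cf (fst g) 0 0 = 0 \<and> cf (snd g) 0 0 = 0 \<and> cf (fst g) 0 1 = 0 \<and> cf (snd g) 1 0 = 0"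
    if "graded 1 (fst g)" "graded 2 (snd g)"
    using gradedD[OF that(1), of 0 0] gradedD[OF that(2), of 0 0] gradedD[OF that(1), of 0 1] gradedD[OF that(2), of 1 0]
    by simp
  ultimately show ?thesis
    unfolding equivariant_Aut_def mem_Collect_eq using tangent_to_identity_iff[of g] by metis
qed

section \<open>The closure of the free group\<close>

theorem theorem6p4p2:
  fixes u v \<tau> :: "'k::{alg_closed_field, field_char_0} endo"
    and F FF AA S J J' :: "'k endo set"
  defines "u \<equiv> (varX + varY ^ 2, varY)"
    and "v \<equiv> (varX, varY + varX ^ 2)"
    and "F \<equiv> generate Aut_A2 {u, v}"
    and "FF \<equiv> ind_topology Aut_ind closure_of F"
    and "AA \<equiv> {g \<in> carrier Aut_A2. endo_point g (0, 0) = (0, 0) \<and> differential_at g (0, 0) = id}"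
    and "S \<equiv> {(scale2 \<zeta> varX, scale2 (\<zeta> ^ 2) varY) | \<zeta>. \<zeta> ^ 3 = 1}"
    and "J \<equiv> {(varX + varY ^ 2 * subst1 f (varY ^ 3), varY) | f. True}"
    and "J' \<equiv> {(varX, varY + varX ^ 2 * subst1 f (varX ^ 3)) | f. True}"
    and "\<tau> \<equiv> (varY, varX)"
  shows
    "(u \<in> carrier Aut_A2 \<and> v \<in> carrier Aut_A2 \<and>
      freely_generated (Aut_A2\<lparr>carrier := F\<rparr>) UNIV (\<lambda>b. if b then u else v) \<and>
      (\<exists>g\<in>F. \<not> locally_finite g)) \<and>

     (FF = {g \<in> AA. \<forall>s\<in>S. g \<otimes>\<^bsub>Aut_A2\<^esub> s = s \<otimes>\<^bsub>Aut_A2\<^esub> g} \<and>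
      FF = centralizer (Aut_A2\<lparr>carrier := AA\<rparr>) S \<and>
      S = centralizer Aut_A2 F) \<and>

     (subgroup FF Aut_A2 \<and>
      is_free_product_of (Aut_A2\<lparr>carrier := FF\<rparr>) J J' \<and>
      J' = {\<tau> \<otimes>\<^bsub>Aut_A2\<^esub> g \<otimes>\<^bsub>Aut_A2\<^esub> \<tau> | g. g \<in> J} \<and>
      subgroup J Aut_A2 \<and>
      comm_group (Aut_A2\<lparr>carrier := J\<rparr>) \<and>
      nested_unipotent J \<and>
      closedin (ind_topology Aut_ind) J \<and>
      ind_group_isomorphic (Aut_A2\<lparr>carrier := J\<rparr>) (ind_subvariety Aut_ind J)
        poly_add_group poly_ind) \<and>

     (\<forall>H. algebraic_subgroup H \<and> H \<subseteq> FF \<longrightarrow>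
        comm_group (Aut_A2\<lparr>carrier := H\<rparr>) \<and>
        unipotent_algebraic_subgroup H \<and>
        (\<exists>g\<in>FF. (\<lambda>h. g \<otimes>\<^bsub>Aut_A2\<^esub> h \<otimes>\<^bsub>Aut_A2\<^esub> inv\<^bsub>Aut_A2\<^esub> g) ` H \<subseteq> J \<or>
                (\<lambda>h. g \<otimes>\<^bsub>Aut_A2\<^esub> h \<otimes>\<^bsub>Aut_A2\<^esub> inv\<^bsub>Aut_A2\<^esub> g) ` H \<subseteq> J'))"
proof -
  have u: "u = shear_x 1" and v: "v = shear_y 1"
    by (simp_all add: u_def v_def shear_x_def shear_y_def subst1_1)
  have J: "J = range shear_x" and J': "J' = range shear_y"
    unfolding J_def J'_def shear_x_def shear_y_def by blast+
  have F: "F = generate Aut_A2 {shear_x 1, shear_y 1}" unfolding F_def u v ..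
  have FF: "FF = equivariant_Aut" unfolding FF_def F by (rule closure_of_quadratic_shears)
  have gen: "equivariant_Aut = generate Aut_A2 (J \<union> J')" unfolding J J' by (rule equivariant_Aut_generated)
  have JJ: "J \<subseteq> carrier Aut_A2" "J' \<subseteq> carrier Aut_A2" using shear_in_Aut by (auto simp: J J')
  have sub_FF: "subgroup FF Aut_A2"
    unfolding FF gen by (rule Aut.generate_is_subgroup) (use JJ in blast)
  have J_sub: "J \<subseteq> FF" "J' \<subseteq> FF" using shear_equivariant by (auto simp: FF J J')
  have sJ: "subgroup J Aut_A2" "subgroup J' Aut_A2" unfolding J J' by (rule subgroup_shear_x subgroup_shear_y)+
  have F_sub: "F \<subseteq> FF" unfolding FF gen F by (rule Aut.mono_generate) (auto simp: J J')

  have free: "freely_generated (Aut_A2\<lparr>carrier := F\<rparr>) UNIV (\<lambda>b. if b then u else v)"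
    unfolding F u v by (rule shears_freely_generate)
  have "shear_x 1 \<in> F" "shear_y 1 \<in> F" unfolding F by (auto intro: generate.incl)
  then have "endo_comp (shear_x 1) (shear_y 1) \<in> F" unfolding F using generate.eng by fastforce
  then have not_lf: "\<exists>g\<in>F. \<not> locally_finite g" using not_locally_finite_shear_product by blast

  have FF_iff: "g \<in> FF \<longleftrightarrow> g \<in> AA \<and> (\<forall>s\<in>S. endo_comp g s = endo_comp s g)" for g
    unfolding FF equivariant_Aut_iff_commutes AA_def S_def by blast
  have cent: "S = centralizer Aut_A2 F"
  proof (intro subset_antisym subsetI)
    fix s assume s: "s \<in> S"
    then have "s \<in> carrier Aut_A2" using cube_root_in_Aut by (auto simp: S_def)
    moreover have "endo_comp s g = endo_comp g s" if "g \<in> F" for g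
      using F_sub FF_iff[of g] s that by auto
    ultimately show "s \<in> centralizer Aut_A2 F" by (simp add: centralizer_def)
  next
    fix s assume "s \<in> centralizer Aut_A2 F"
    then have "s \<in> carrier Aut_A2" "endo_comp s (shear_x 1) = endo_comp (shear_x 1) s" "endo_comp s (shear_y 1) = endo_comp (shear_y 1) s"
      using \<open>shear_x 1 \<in> F\<close> \<open>shear_y 1 \<in> F\<close> by (simp_all add: centralizer_def)
    from commutes_with_shears_imp_cube_root[OF this] show "s \<in> S" unfolding S_def by blast
  qed

  have fp: "is_free_product_of (Aut_A2\<lparr>carrier := FF\<rparr>) J J'"
  proof (rule is_free_product_ofI)
    show "group (Aut_A2\<lparr>carrier := FF\<rparr>)" by (rule Aut.subgroup_imp_group[OF sub_FF])
    show "subgroup J (Aut_A2\<lparr>carrier := FF\<rparr>)" "subgroup J' (Aut_A2\<lparr>carrier := FF\<rparr>)"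
      using Aut.subgroup_incl[OF sJ(1) sub_FF J_sub(1)] Aut.subgroup_incl[OF sJ(2) sub_FF J_sub(2)] by simp_all
    show "carrier (Aut_A2\<lparr>carrier := FF\<rparr>) = generate (Aut_A2\<lparr>carrier := FF\<rparr>) (J \<union> J')"
      using Aut.generate_consistent[OF _ sub_FF, of "J \<union> J'"] J_sub gen FF by simp
    fix w assume "alternating (Aut_A2\<lparr>carrier := FF\<rparr>) J J' w" "w \<noteq> []"
    then show "sum_value (Aut_A2\<lparr>carrier := FF\<rparr>) w \<noteq> \<one>\<^bsub>Aut_A2\<lparr>carrier := FF\<rparr>\<^esub>"
      using shear_word_nontrivial[of w] by (simp add: alternating_def word_value_def J J')
  qed
  have swap: "J' = {\<tau> \<otimes>\<^bsub>Aut_A2\<^esub> g \<otimes>\<^bsub>Aut_A2\<^esub> \<tau> | g. g \<in> J}"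
  proof -
    have e: "\<tau> \<otimes>\<^bsub>Aut_A2\<^esub> shear_x f \<otimes>\<^bsub>Aut_A2\<^esub> \<tau> = shear_y f" for f
      unfolding \<tau>_def mult_Aut endo_comp_assoc by (rule swap_shear)
    show ?thesis
    proof (intro subset_antisym subsetI)
      fix h assume "h \<in> J'"
      then obtain f where "h = \<tau> \<otimes>\<^bsub>Aut_A2\<^esub> shear_x f \<otimes>\<^bsub>Aut_A2\<^esub> \<tau>" unfolding J' e by blast
      then show "h \<in> {\<tau> \<otimes>\<^bsub>Aut_A2\<^esub> g \<otimes>\<^bsub>Aut_A2\<^esub> \<tau> | g. g \<in> J}" unfolding J by blast
    next
      fix h assume "h \<in> {\<tau> \<otimes>\<^bsub>Aut_A2\<^esub> g \<otimes>\<^bsub>Aut_A2\<^esub> \<tau> | g. g \<in> J}"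
      then obtain f where "h = \<tau> \<otimes>\<^bsub>Aut_A2\<^esub> shear_x f \<otimes>\<^bsub>Aut_A2\<^esub> \<tau>" unfolding J by blast
      then show "h \<in> J'" unfolding J' e by blast
    qed
  qed
  have "(varX, varY) \<in> carrier Aut_A2" using Aut.one_closed by simp
  then have commJ: "comm_group (Aut_A2\<lparr>carrier := J\<rparr>)"
    by (rule comm_group_if_conjugate_to_shears[OF sJ(1)]) (auto simp: conj_by_id J)

  have alg: "comm_group (Aut_A2\<lparr>carrier := H\<rparr>) \<and> unipotent_algebraic_subgroup H \<and>
        (\<exists>g\<in>FF. (\<lambda>h. g \<otimes>\<^bsub>Aut_A2\<^esub> h \<otimes>\<^bsub>Aut_A2\<^esub> inv\<^bsub>Aut_A2\<^esub> g) ` H \<subseteq> J \<or>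
                (\<lambda>h. g \<otimes>\<^bsub>Aut_A2\<^esub> h \<otimes>\<^bsub>Aut_A2\<^esub> inv\<^bsub>Aut_A2\<^esub> g) ` H \<subseteq> J')"
    if H: "algebraic_subgroup H \<and> H \<subseteq> FF" for H
    using algebraic_subgroup_of_equivariant_Aut[of H] H unfolding FF J J' conj_by_def[abs_def] mult_Aut by blast

  have 1: "u \<in> carrier Aut_A2 \<and> v \<in> carrier Aut_A2 \<and>
      freely_generated (Aut_A2\<lparr>carrier := F\<rparr>) UNIV (\<lambda>b. if b then u else v) \<and> (\<exists>g\<in>F. \<not> locally_finite g)"
  proof (intro conjI free not_lf)
    show "u \<in> carrier Aut_A2" "v \<in> carrier Aut_A2" unfolding u v by (rule shear_in_Aut)+
  qed
  have 2: "FF = {g \<in> AA. \<forall>s\<in>S. g \<otimes>\<^bsub>Aut_A2\<^esub> s = s \<otimes>\<^bsub>Aut_A2\<^esub> g} \<and>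
      FF = centralizer (Aut_A2\<lparr>carrier := AA\<rparr>) S \<and> S = centralizer Aut_A2 F"
  proof (intro conjI cent)
    show "FF = {g \<in> AA. \<forall>s\<in>S. g \<otimes>\<^bsub>Aut_A2\<^esub> s = s \<otimes>\<^bsub>Aut_A2\<^esub> g}"
      unfolding mult_Aut using FF_iff by blast
    then show "FF = centralizer (Aut_A2\<lparr>carrier := AA\<rparr>) S" by (simp add: centralizer_def)
  qed
  have 3: "subgroup FF Aut_A2 \<and> is_free_product_of (Aut_A2\<lparr>carrier := FF\<rparr>) J J' \<and>
      J' = {\<tau> \<otimes>\<^bsub>Aut_A2\<^esub> g \<otimes>\<^bsub>Aut_A2\<^esub> \<tau> | g. g \<in> J} \<and> subgroup J Aut_A2 \<and>
      comm_group (Aut_A2\<lparr>carrier := J\<rparr>) \<and> nested_unipotent J \<and> closedin (ind_topology Aut_ind) J \<and>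
      ind_group_isomorphic (Aut_A2\<lparr>carrier := J\<rparr>) (ind_subvariety Aut_ind J) poly_add_group poly_ind"
    using sub_FF fp swap sJ(1) commJ nested_unipotent_shear_x closedin_shear_x ind_group_isomorphic_shear_x
    unfolding J by (intro conjI)
  show ?thesis by (rule conjI[OF 1 conjI[OF 2 conjI[OF 3]]]) (intro allI impI alg)
qed

end
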